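(* Let $r,\mu,\rho\in\mathbb{R}$, $\sigma>0$, $\lambda=\frac{\mu-r}{\sigma}$, $\gamma>1$, and assume $\rho>(1-\gamma)\left(r+\frac{\lambda^2}{2\gamma}\right)$. Set $$a=\left(\frac{\rho-(1-\gamma)\left(r+\frac{\lambda^2}{2\gamma}\right)}{\gamma}\right)^{-\gamma}.$$ Let $x>0$, let $\widehat X$ be the unique strong solution of the closed loop equation $$\mathrm{d}X_t=\left(r+\frac{\lambda^2}{\gamma}-a^{-1/\gamma}\right)X_t\,\mathrm{d}t+\frac{\lambda}{\gamma}X_t\,\mathrm{d}W_t,\qquad X_0=x,$$ and define the feedback strategy $$\widehat c_t:=a^{-1/\gamma}\,\widehat X_t,\qquad \widehat\pi_t:=\frac{\lambda}{\sigma\gamma}\,\widehat X_t,\qquad t\ge 0.$$ Then $(\widehat c,\widehat\pi)\in\mathcal{A}(x)$ and $(\widehat c,\widehat\pi)$ is optimal, i.e. $$V(x)=\mathbb{E}\left[\int_0^\infty e^{-\rho s}\frac{\widehat c_s^{\,1-\gamma}}{1-\gamma}\,\mathrm{d}s\right].$$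
   Context: $W$ is a standard one-dimensional Brownian motion on a filtered probability space $(\Omega,\mathcal{F},\mathbb{F}=(\mathcal{F}_t)_{t\ge0},\mathbb{P})$ satisfying the usual conditions. $\mathbb{R}^+$ denotes the set of nonnegative reals. $L^{2,\mathbb{F}}_{\mathrm{loc}}(\Omega\times[0,\infty);\mathbb{R})$ is the space of $\mathbb{F}$-adapted real-valued (measurable in $(\omega,t)$) processes $Z$ with $\mathbb{E}\left[\int_0^R|Z_t|^2\mathrm{d}t\right]<\infty$ for every $R>0$; $L^{1,\mathbb{F}}_{\mathrm{loc}}(\Omega\times[0,\infty);\mathbb{R}^+)$ is the space of $\mathbb{F}$-adapted $\mathbb{R}^+$-valued (measurable) processes $Z$ with $\mathbb{E}\left[\int_0^R|Z_t|\mathrm{d}t\right]<\infty$ for every $R>0$. For $x>0$, $c\in L^{1,\mathbb{F}}_{\mathrm{loc}}(\Omega\times[0,\infty);\mathbb{R}^+)$ and $\pi\in L^{2,\mathbb{F}}_{\mathrm{loc}}(\Omega\times[0,\infty);\mathbb{R})$, the wealth process $X=X^{x;c,\pi}$ is the unique strong solution of $$\mathrm{d}X_t=(rX_t+\sigma\lambda\pi_t)\,\mathrm{d}t+\sigma\pi_t\,\mathrm{d}W_t-c_t\,\mathrm{d}t,\qquad X_0=x.$$ The set of admissible strategies is $$\mathcal{A}(x)=\{(c,\pi)\in L^{1,\mathbb{F}}_{\mathrm{loc}}(\Omega\times[0,\infty);\mathbb{R}^+)\times L^{2,\mathbb{F}}_{\mathrm{loc}}(\Omega\times[0,\infty);\mathbb{R}):\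 X^{x;c,\pi}\ge0\}.$$ The objective functional is $J(c)=\mathbb{E}\left[\int_0^\infty e^{-\rho s}\frac{c_s^{1-\gamma}}{1-\gamma}\,\mathrm{d}s\right]\in[-\infty,0]$ (with the convention that $\frac{0^{1-\gamma}}{1-\gamma}=-\infty$), and the value function is $V(x)=\sup_{(c,\pi)\in\mathcal{A}(x)}J(c)\in[-\infty,0]$. *)

theory Defs
  imports "HOL-Probability.Probability"
begin

text \<open>Time is \<^typ>\<open>real\<close>; a process \<open>Z\<close> is written \<open>Z t \<omega>\<close>, and only its values at \<open>t \<ge> 0\<close>
  matter. The same goes for filtrations.\<close>

locale usual_filtered_prob_space = prob_space M
  for M :: "'a measure" and F :: "real \<Rightarrow> 'a measure" +
  assumes subalg: "0 \<le> t \<Longrightarrow> subalgebra M (F t)"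
    and filtration_mono: "0 \<le> s \<Longrightarrow> s \<le> t \<Longrightarrow> sets (F s) \<subseteq> sets (F t)"
    and right_continuous: "0 \<le> t \<Longrightarrow> sets (F t) = (\<Inter>s\<in>{t<..}. sets (F s))"
    and complete: "N \<in> null_sets M \<Longrightarrow> A \<subseteq> N \<Longrightarrow> A \<in> sets (F 0)"

definition adapted :: "(real \<Rightarrow> 'a measure) \<Rightarrow> (real \<Rightarrow> 'a \<Rightarrow> real) \<Rightarrow> bool" where
  "adapted F Z \<longleftrightarrow> (\<forall>t\<ge>0. Z t \<in> borel_measurable (F t))"

definition measurable_process :: "'a measure \<Rightarrow> (real \<Rightarrow> 'a \<Rightarrow> real) \<Rightarrow> bool" where
  "measurable_process M Z \<longleftrightarrow>
     (\<lambda>(\<omega>, t). Z t \<omega>) \<in> borel_measurable (M \<Otimes>\<^sub>M restrict_space borel {0..})"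

definition continuous_paths :: "'a measure \<Rightarrow> (real \<Rightarrow> 'a \<Rightarrow> real) \<Rightarrow> bool" where
  "continuous_paths M Z \<longleftrightarrow> (AE \<omega> in M. continuous_on {0..} (\<lambda>t. Z t \<omega>))"

locale brownian_motion = usual_filtered_prob_space M F
  for M :: "'a measure" and F :: "real \<Rightarrow> 'a measure" +
  fixes W :: "real \<Rightarrow> 'a \<Rightarrow> real"
  assumes W_adapted: "adapted F W"
    and W_zero: "AE \<omega> in M. W 0 \<omega> = 0"
    and W_continuous: "continuous_paths M W"
    and W_normal: "0 \<le> s \<Longrightarrow> s < t \<Longrightarrow>
      distributed M lborel (\<lambda>\<omega>. W t \<omega> - W s \<omega>) (normal_density 0 (sqrt (t - s)))"
    and W_indep: "0 \<le> s \<Longrightarrow> s < t \<Longrightarrow>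
      indep_set (sets (F s)) (sets (vimage_algebra (space M) (\<lambda>\<omega>. W t \<omega> - W s \<omega>) borel))"

definition L2_loc :: "'a measure \<Rightarrow> (real \<Rightarrow> 'a measure) \<Rightarrow> (real \<Rightarrow> 'a \<Rightarrow> real) set" where
  "L2_loc M F = {Z. measurable_process M Z \<and> adapted F Z \<and>
     (\<forall>R>0. (\<integral>\<^sup>+\<omega>. (\<integral>\<^sup>+t\<in>{0..R}. ennreal (\<bar>Z t \<omega>\<bar>\<^sup>2) \<partial>lborel) \<partial>M) < \<infinity>)}"

text \<open>Elements of the Lebesgue spaces are processes up to \<open>\<P> \<otimes> dt\<close>-null sets, hence the
  constraint of being \<open>\<real>\<^sup>+\<close>-valued is imposed almost everywhere.\<close>

definition L1_loc_nonneg :: "'a measure \<Rightarrow> (real \<Rightarrow> 'a measure) \<Rightarrow> (real \<Rightarrow> 'a \<Rightarrow> real) set" where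
  "L1_loc_nonneg M F = {Z. measurable_process M Z \<and> adapted F Z \<and>
     (AE \<omega> in M. AE t in lborel. 0 \<le> t \<longrightarrow> 0 \<le> Z t \<omega>) \<and>
     (\<forall>R>0. (\<integral>\<^sup>+\<omega>. (\<integral>\<^sup>+t\<in>{0..R}. ennreal \<bar>Z t \<omega>\<bar> \<partial>lborel) \<partial>M) < \<infinity>)}"

text \<open>The Ito integral: first of step processes
  \<open>\<Sum>i<n. \<xi>\<^sub>i 1\<^bsub>(u\<^sub>i, u\<^sub>i\<^sub>+\<^sub>1]\<^esub>\<close>, then as an \<open>L\<^sup>2\<close>-limit, then by localisation.\<close>

definition step_integrand ::
  "'a measure \<Rightarrow> (real \<Rightarrow> 'a measure) \<Rightarrow> nat \<Rightarrow> (nat \<Rightarrow> real) \<Rightarrow> (nat \<Rightarrow> 'a \<Rightarrow> real) \<Rightarrow> bool" where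
  "step_integrand M F n u \<xi> \<longleftrightarrow> 0 \<le> u 0 \<and>
     (\<forall>i<n. u i \<le> u (Suc i) \<and> \<xi> i \<in> borel_measurable (F (u i)) \<and> bounded (\<xi> i ` space M))"

definition step_process ::
  "nat \<Rightarrow> (nat \<Rightarrow> real) \<Rightarrow> (nat \<Rightarrow> 'a \<Rightarrow> real) \<Rightarrow> real \<Rightarrow> 'a \<Rightarrow> real" where
  "step_process n u \<xi> t \<omega> = (\<Sum>i<n. \<xi> i \<omega> * indicator {u i<..u (Suc i)} t)"

definition step_integral ::
  "(real \<Rightarrow> 'a \<Rightarrow> real) \<Rightarrow> nat \<Rightarrow> (nat \<Rightarrow> real) \<Rightarrow> (nat \<Rightarrow> 'a \<Rightarrow> real) \<Rightarrow> real \<Rightarrow> 'a \<Rightarrow> real" where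
  "step_integral W n u \<xi> t \<omega> = (\<Sum>i<n. \<xi> i \<omega> * (W (min t (u (Suc i))) \<omega> - W (min t (u i)) \<omega>))"

definition ito_integral_L2 ::
  "'a measure \<Rightarrow> (real \<Rightarrow> 'a measure) \<Rightarrow> (real \<Rightarrow> 'a \<Rightarrow> real) \<Rightarrow> (real \<Rightarrow> 'a \<Rightarrow> real) \<Rightarrow>
   (real \<Rightarrow> 'a \<Rightarrow> real) \<Rightarrow> bool" where
  "ito_integral_L2 M F W H I \<longleftrightarrow>
     H \<in> L2_loc M F \<and> adapted F I \<and> continuous_paths M I \<and>
     (\<forall>T\<ge>0. \<exists>n u \<xi>. (\<forall>k. step_integrand M F (n k) (u k) (\<xi> k)) \<and>
        (\<lambda>k. \<integral>\<^sup>+\<omega>. (\<integral>\<^sup>+t\<in>{0..T}. ennreal ((step_process (n k) (u k) (\<xi> k) t \<omega> - H t \<omega>)\<^sup>2) \<partial>lborel) \<partial>M)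
          \<longlonglongrightarrow> 0 \<and>
        (\<lambda>k. \<integral>\<^sup>+\<omega>. ennreal ((step_integral W (n k) (u k) (\<xi> k) T \<omega> - I T \<omega>)\<^sup>2) \<partial>M)
          \<longlonglongrightarrow> 0)"

text \<open>\<open>I\<close> is the stochastic integral process \<open>\<integral>\<^sub>0\<^sup>t H dW\<close>. The localising sequence makes
  \<open>\<integral>\<^sub>0\<^sup>T H\<^sup>2 dt < \<infinity>\<close> almost surely, for every \<open>T\<close>, automatic.\<close>

definition ito_integral ::
  "'a measure \<Rightarrow> (real \<Rightarrow> 'a measure) \<Rightarrow> (real \<Rightarrow> 'a \<Rightarrow> real) \<Rightarrow> (real \<Rightarrow> 'a \<Rightarrow> real) \<Rightarrow>
   (real \<Rightarrow> 'a \<Rightarrow> real) \<Rightarrow> bool" where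
  "ito_integral M F W H I \<longleftrightarrow>
     measurable_process M H \<and> adapted F H \<and> adapted F I \<and> continuous_paths M I \<and>
     (\<exists>\<tau> :: nat \<Rightarrow> 'a \<Rightarrow> real.
        (\<forall>n. stopping_time F (\<tau> n) \<and> (\<forall>\<omega>\<in>space M. 0 \<le> \<tau> n \<omega>)) \<and>
        (AE \<omega> in M. incseq (\<lambda>n. \<tau> n \<omega>) \<and> filterlim (\<lambda>n. \<tau> n \<omega>) at_top sequentially) \<and>
        (\<forall>n. ito_integral_L2 M F W (\<lambda>t \<omega>. if t \<le> \<tau> n \<omega> then H t \<omega> else 0)
               (\<lambda>t \<omega>. I (min t (\<tau> n \<omega>)) \<omega>)))"

text \<open>\<open>X\<close> satisfies \<open>dX\<^sub>t = b\<^sub>t dt + H\<^sub>t dW\<^sub>t\<close>, \<open>X\<^sub>0 = x\<close>. In a stochastic differential equation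
  the processes \<open>b\<close> and \<open>H\<close> are themselves expressed through \<open>X\<close>.\<close>

definition solves_SDE ::
  "'a measure \<Rightarrow> (real \<Rightarrow> 'a measure) \<Rightarrow> (real \<Rightarrow> 'a \<Rightarrow> real) \<Rightarrow> real \<Rightarrow>
   (real \<Rightarrow> 'a \<Rightarrow> real) \<Rightarrow> (real \<Rightarrow> 'a \<Rightarrow> real) \<Rightarrow> (real \<Rightarrow> 'a \<Rightarrow> real) \<Rightarrow> bool" where
  "solves_SDE M F W x b H X \<longleftrightarrow>
     measurable_process M X \<and> adapted F X \<and> continuous_paths M X \<and>
     (AE \<omega> in M. \<forall>T\<ge>0. set_integrable lborel {0..T} (\<lambda>s. b s \<omega>)) \<and>
     (\<exists>I. ito_integral M F W H I \<and>
        (AE \<omega> in M. \<forall>t\<ge>0. X t \<omega> = x + (LBINT s:{0..t}. b s \<omega>) + I t \<omega>))"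

definition wealth_process ::
  "'a measure \<Rightarrow> (real \<Rightarrow> 'a measure) \<Rightarrow> (real \<Rightarrow> 'a \<Rightarrow> real) \<Rightarrow> real \<Rightarrow> real \<Rightarrow> real \<Rightarrow> real \<Rightarrow>
   (real \<Rightarrow> 'a \<Rightarrow> real) \<Rightarrow> (real \<Rightarrow> 'a \<Rightarrow> real) \<Rightarrow> (real \<Rightarrow> 'a \<Rightarrow> real) \<Rightarrow> bool" where
  "wealth_process M F W r \<sigma> lam x c \<pi> X \<longleftrightarrow>
     solves_SDE M F W x (\<lambda>t \<omega>. r * X t \<omega> + \<sigma> * lam * \<pi> t \<omega> - c t \<omega>) (\<lambda>t \<omega>. \<sigma> * \<pi> t \<omega>) X"

definition admissible ::
  "'a measure \<Rightarrow> (real \<Rightarrow> 'a measure) \<Rightarrow> (real \<Rightarrow> 'a \<Rightarrow> real) \<Rightarrow> real \<Rightarrow> real \<Rightarrow> real \<Rightarrow> real \<Rightarrow>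
   ((real \<Rightarrow> 'a \<Rightarrow> real) \<times> (real \<Rightarrow> 'a \<Rightarrow> real)) set" where
  "admissible M F W r \<sigma> lam x =
     {(c, \<pi>). c \<in> L1_loc_nonneg M F \<and> \<pi> \<in> L2_loc M F \<and>
        (\<exists>X. wealth_process M F W r \<sigma> lam x c \<pi> X \<and> (AE \<omega> in M. \<forall>t\<ge>0. 0 \<le> X t \<omega>))}"

definition crra_utility :: "real \<Rightarrow> real \<Rightarrow> ereal" where
  "crra_utility \<gamma> y = (if y \<le> 0 then -\<infinity> else ereal (y powr (1 - \<gamma>) / (1 - \<gamma>)))"

text \<open>For \<open>\<gamma> > 1\<close> the integrand \<open>e\<^sup>-\<^sup>\<rho>\<^sup>s u(c\<^sub>s)\<close> is nonpositive, so that the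
  \<open>[-\<infinity>, 0]\<close>-valued integral is minus the nonnegative integral of its negation.\<close>

definition objective :: "'a measure \<Rightarrow> real \<Rightarrow> real \<Rightarrow> (real \<Rightarrow> 'a \<Rightarrow> real) \<Rightarrow> ereal" where
  "objective M \<rho> \<gamma> c = - enn2ereal (\<integral>\<^sup>+\<omega>. (\<integral>\<^sup>+s\<in>{0..}.
      e2ennreal (- (ereal (exp (- \<rho> * s)) * crra_utility \<gamma> (c s \<omega>))) \<partial>lborel) \<partial>M)"

definition value_function ::
  "'a measure \<Rightarrow> (real \<Rightarrow> 'a measure) \<Rightarrow> (real \<Rightarrow> 'a \<Rightarrow> real) \<Rightarrow> real \<Rightarrow> real \<Rightarrow> real \<Rightarrow> real \<Rightarrow> real \<Rightarrow>
   real \<Rightarrow> ereal" where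
  "value_function M F W r \<sigma> lam \<rho> \<gamma> x =
     (SUP (c, \<pi>) \<in> admissible M F W r \<sigma> lam x. objective M \<rho> \<gamma> c)"

end

theory Submission
  imports Defs
begin

text \<open>The proof is by convex duality and needs no Ito formula. Let
  \<open>M\<^sup>\<alpha>\<^sub>t = exp (\<alpha> W\<^sub>t - \<alpha>\<^sup>2 t / 2)\<close>. On elementary integrands one checks directly the isometry
  \<open>E[I\<^sub>s I\<^sub>t] = E \<integral>\<^sub>0\<^sup>s H\<^sup>2 dv\<close> and the Girsanov identity \<open>E[M\<^sup>\<alpha>\<^sub>T I\<^sub>t] = \<alpha> E \<integral>\<^sub>0\<^sup>t M\<^sup>\<alpha>\<^sub>v H\<^sub>v dv\<close>; both are
  pairings, linear and \<open>L\<^sup>2\<close>-continuous in the integrand.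

  With \<open>\<alpha> = - lam\<close> the Girsanov identity, applied along a localising sequence, gives the budget
  inequality \<open>E \<integral> Z\<^sub>s c\<^sub>s ds \<le> x\<close> for every admissible consumption \<open>c\<close>, where
  \<open>Z\<^sub>s = exp (- r s) M\<^sup>\<alpha>\<^sub>s\<close>. With \<open>\<alpha> = lam / \<gamma>\<close> the two identities together compute the
  \<open>L\<^sup>2\<close>-distance between a stopped solution of the closed loop equation and the explicit geometric
  Brownian motion, and Gronwall's inequality shows that it vanishes in the limit. Finally
  \<open>exp (- \<rho> s) u'\<close> at the candidate is a constant multiple \<open>y Z\<^sub>s\<close> of \<open>Z\<^sub>s\<close>, so that by concavity
  the candidate maximises \<open>E \<integral> exp (- \<rho> s) u(c\<^sub>s) - y Z\<^sub>s c\<^sub>s ds\<close>. As the candidate exhausts the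
  budget \<open>x\<close>, it is optimal.\<close>

subsection \<open>Square-integrable functions\<close>

definition square_integrable :: "'b measure \<Rightarrow> ('b \<Rightarrow> real) \<Rightarrow> bool" where
  "square_integrable N f \<longleftrightarrow> f \<in> borel_measurable N \<and> integrable N (\<lambda>x. (f x)\<^sup>2)"

lemma square_integrableD:
  assumes "square_integrable N f"
  shows "f \<in> borel_measurable N" "integrable N (\<lambda>x. (f x)\<^sup>2)"
  using assms by (auto simp: square_integrable_def)

lemma square_integrable_mult_integrable:
  assumes "square_integrable N f" "square_integrable N g"
  shows "integrable N (\<lambda>x. f x * g x)"
proof (rule Bochner_Integration.integrable_bound)
  show "integrable N (\<lambda>x. (f x)\<^sup>2 + (g x)\<^sup>2)"
    using assms by (auto simp: square_integrable_def)
  have "\<bar>a * b\<bar> \<le> a\<^sup>2 + b\<^sup>2" for a b :: real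
    using sum_squares_bound[of "\<bar>a\<bar>" "\<bar>b\<bar>"] mult_nonneg_nonneg[of "\<bar>a\<bar>" "\<bar>b\<bar>"]
    unfolding abs_mult power2_abs by linarith
  then show "AE x in N. norm (f x * g x) \<le> norm ((f x)\<^sup>2 + (g x)\<^sup>2)"
    by (intro AE_I2) (metis abs_ge_self order_trans real_norm_def)
  show "(\<lambda>x. f x * g x) \<in> borel_measurable N"
    using assms by (auto simp: square_integrable_def)
qed

lemma square_integrable_add:
  assumes "square_integrable N f" "square_integrable N g"
  shows "square_integrable N (\<lambda>x. f x + g x)"
  using assms square_integrable_mult_integrable[OF assms]
  by (auto simp: square_integrable_def power2_sum mult.assoc)

lemma square_integrable_cmult:
  assumes "square_integrable N f"
  shows "square_integrable N (\<lambda>x. c * f x)"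
  using assms by (auto simp: square_integrable_def power_mult_distrib)

lemma square_integrable_diff:
  assumes "square_integrable N f" "square_integrable N g"
  shows "square_integrable N (\<lambda>x. f x - g x)"
  using square_integrable_add[OF assms(1) square_integrable_cmult[OF assms(2), of "-1"]] by simp

lemma square_integrable_zero: "square_integrable N (\<lambda>x. 0)"
  by (simp add: square_integrable_def)

lemma square_integrable_sum:
  assumes "\<And>i. i \<in> A \<Longrightarrow> square_integrable N (f i)"
  shows "square_integrable N (\<lambda>x. \<Sum>i\<in>A. f i x)"
  using assms
  by (induction A rule: infinite_finite_induct)
    (auto intro!: square_integrable_add square_integrable_zero)

lemma square_integrable_bounded_mult:
  assumes f: "square_integrable N f" and [measurable]: "g \<in> borel_measurable N"
    and bound: "\<And>x. x \<in> space N \<Longrightarrow> \<bar>g x\<bar> \<le> B"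
  shows "square_integrable N (\<lambda>x. g x * f x)"
  unfolding square_integrable_def
proof
  note [measurable] = square_integrableD(1)[OF f]
  show "(\<lambda>x. g x * f x) \<in> borel_measurable N" by measurable
  show "integrable N (\<lambda>x. (g x * f x)\<^sup>2)"
  proof (rule Bochner_Integration.integrable_bound)
    show "integrable N (\<lambda>x. B\<^sup>2 * (f x)\<^sup>2)"
      using f by (auto simp: square_integrable_def)
    show "AE x in N. norm ((g x * f x)\<^sup>2) \<le> norm (B\<^sup>2 * (f x)\<^sup>2)"
    proof (rule AE_I2)
      fix x assume "x \<in> space N"
      then have "\<bar>g x\<bar>\<^sup>2 \<le> B\<^sup>2" using bound by (intro power_mono) auto
      then show "norm ((g x * f x)\<^sup>2) \<le> norm (B\<^sup>2 * (f x)\<^sup>2)"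
        by (auto simp: power_mult_distrib intro!: mult_right_mono)
    qed
  qed measurable
qed

lemma (in finite_measure) square_integrable_const: "square_integrable M (\<lambda>_. c)"
  by (simp add: square_integrable_def)

lemma (in finite_measure) square_integrable_integrable:
  "square_integrable M f \<Longrightarrow> integrable M f"
  by (auto simp: square_integrable_def intro: square_integrable_imp_integrable)

lemma square_integrable_cong_AE:
  assumes "square_integrable N f" "g \<in> borel_measurable N" "AE x in N. f x = g x"
  shows "square_integrable N g"
proof -
  have "AE x in N. (f x)\<^sup>2 = (g x)\<^sup>2" using assms(3) by eventually_elim simp
  then show ?thesis
    using assms(1,2) integrable_cong_AE[of "\<lambda>x. (f x)\<^sup>2" N "\<lambda>x. (g x)\<^sup>2"]
    by (auto simp: square_integrable_def)
qed

lemma integral_square_diff: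
  assumes f: "square_integrable N f" and g: "square_integrable N g"
  shows "(\<integral>x. (f x - g x)\<^sup>2 \<partial>N) = (\<integral>x. (f x)\<^sup>2 \<partial>N) - 2 * (\<integral>x. g x * f x \<partial>N) + (\<integral>x. (g x)\<^sup>2 \<partial>N)"
proof -
  have "(f x - g x)\<^sup>2 = (f x)\<^sup>2 - 2 * (g x * f x) + (g x)\<^sup>2" for x
    by (simp add: power2_diff)
  then show ?thesis
    using square_integrableD(2)[OF f] square_integrableD(2)[OF g]
      square_integrable_mult_integrable[OF g f]
    by simp
qed

lemma Cauchy_Schwarz_integral:
  assumes f: "square_integrable N f" and g: "square_integrable N g"
  shows "(\<integral>x. f x * g x \<partial>N)\<^sup>2 \<le> (\<integral>x. (f x)\<^sup>2 \<partial>N) * (\<integral>x. (g x)\<^sup>2 \<partial>N)"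
proof -
  note [measurable] = square_integrableD(1)[OF f] square_integrableD(1)[OF g]
  let ?A = "\<integral>x. \<bar>f x * g x\<bar> \<partial>N"
  have product: "integrable N (\<lambda>x. \<bar>f x * g x\<bar>)"
    using square_integrable_mult_integrable[OF f g] by simp
  have "(ennreal ?A)\<^sup>2 = (\<integral>\<^sup>+x. ennreal \<bar>f x\<bar> * ennreal \<bar>g x\<bar> \<partial>N)\<^sup>2"
    by (subst nn_integral_eq_integral[symmetric, OF product]) (auto simp: abs_mult ennreal_mult)
  also have "\<dots> \<le> (\<integral>\<^sup>+x. (ennreal \<bar>f x\<bar>)\<^sup>2 \<partial>N) * (\<integral>\<^sup>+x. (ennreal \<bar>g x\<bar>)\<^sup>2 \<partial>N)"
    by (rule Cauchy_Schwarz_nn_integral) auto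
  also have "\<dots> = ennreal (\<integral>x. (f x)\<^sup>2 \<partial>N) * ennreal (\<integral>x. (g x)\<^sup>2 \<partial>N)"
    using square_integrableD(2)[OF f] square_integrableD(2)[OF g]
    by (simp add: ennreal_power nn_integral_eq_integral)
  finally have "ennreal (?A\<^sup>2) \<le> ennreal ((\<integral>x. (f x)\<^sup>2 \<partial>N) * (\<integral>x. (g x)\<^sup>2 \<partial>N))"
    by (simp add: ennreal_power ennreal_mult)
  then have "?A\<^sup>2 \<le> (\<integral>x. (f x)\<^sup>2 \<partial>N) * (\<integral>x. (g x)\<^sup>2 \<partial>N)"
    by (subst (asm) ennreal_le_iff) auto
  moreover have "(\<integral>x. f x * g x \<partial>N)\<^sup>2 \<le> ?A\<^sup>2"
    using integral_abs_bound[of N "\<lambda>x. f x * g x"] by (intro power2_le_iff_abs_le[THEN iffD2]) auto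
  ultimately show ?thesis by linarith
qed

definition L2_tendsto :: "'b measure \<Rightarrow> (nat \<Rightarrow> 'b \<Rightarrow> real) \<Rightarrow> ('b \<Rightarrow> real) \<Rightarrow> bool" where
  "L2_tendsto N f g \<longleftrightarrow> (\<lambda>k. \<integral>\<^sup>+x. ennreal ((f k x - g x)\<^sup>2) \<partial>N) \<longlonglongrightarrow> 0"

lemma
  assumes f: "\<And>k. square_integrable N (f k)" and g [measurable]: "g \<in> borel_measurable N"
    and lim: "L2_tendsto N f g"
  shows square_integrable_L2_limit: "square_integrable N g"
    and tendsto_integral_mult_L2:
      "square_integrable N h \<Longrightarrow> (\<lambda>k. \<integral>x. h x * f k x \<partial>N) \<longlonglongrightarrow> (\<integral>x. h x * g x \<partial>N)"
proof -
  note [measurable] = square_integrableD(1)[OF f]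
  obtain k where "(\<integral>\<^sup>+x. ennreal ((f k x - g x)\<^sup>2) \<partial>N) < 1"
    using order_tendstoD(2)[OF lim[unfolded L2_tendsto_def], of 1]
    by (auto simp: eventually_sequentially)
  then have "square_integrable N (\<lambda>x. f k x - g x)"
    unfolding square_integrable_def
    by (auto intro!: integrableI_nonneg intro: order.strict_trans simp: less_top)
  from square_integrable_diff[OF f[of k] this] show g_square: "square_integrable N g" by simp
  have diff: "square_integrable N (\<lambda>x. f k x - g x)" for k
    by (rule square_integrable_diff[OF f g_square])
  then have "(\<lambda>k. ennreal (\<integral>x. (f k x - g x)\<^sup>2 \<partial>N)) \<longlonglongrightarrow> ennreal 0"
    using lim by (simp add: nn_integral_eq_integral square_integrable_def L2_tendsto_def)
  then have diff_lim: "(\<lambda>k. \<integral>x. (f k x - g x)\<^sup>2 \<partial>N) \<longlonglongrightarrow> 0"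
    by (subst (asm) tendsto_ennreal_iff) auto
  show "(\<lambda>k. \<integral>x. h x * f k x \<partial>N) \<longlonglongrightarrow> (\<integral>x. h x * g x \<partial>N)" if h: "square_integrable N h"
  proof (rule LIM_zero_cancel, rule Lim_null_comparison)
    show "\<forall>\<^sub>F k in sequentially. norm ((\<integral>x. h x * f k x \<partial>N) - (\<integral>x. h x * g x \<partial>N))
        \<le> sqrt ((\<integral>x. (h x)\<^sup>2 \<partial>N) * (\<integral>x. (f k x - g x)\<^sup>2 \<partial>N))"
    proof (intro always_eventually allI)
      fix k
      have "(\<integral>x. h x * f k x \<partial>N) - (\<integral>x. h x * g x \<partial>N) = (\<integral>x. h x * (f k x - g x) \<partial>N)"
        using square_integrable_mult_integrable[OF h f]
          square_integrable_mult_integrable[OF h g_square]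
        by (simp add: right_diff_distrib)
      then show "norm ((\<integral>x. h x * f k x \<partial>N) - (\<integral>x. h x * g x \<partial>N))
          \<le> sqrt ((\<integral>x. (h x)\<^sup>2 \<partial>N) * (\<integral>x. (f k x - g x)\<^sup>2 \<partial>N))"
        using Cauchy_Schwarz_integral[OF h diff] by (simp add: real_le_rsqrt)
    qed
    show "(\<lambda>k. sqrt ((\<integral>x. (h x)\<^sup>2 \<partial>N) * (\<integral>x. (f k x - g x)\<^sup>2 \<partial>N))) \<longlonglongrightarrow> 0"
      using tendsto_real_sqrt[OF tendsto_mult_right_zero[OF diff_lim]] by simp
  qed
qed

lemma nn_integral_le_liminf:
  fixes f :: "nat \<Rightarrow> 'b \<Rightarrow> ennreal"
  assumes "\<And>n. f n \<in> borel_measurable N" "\<And>n. (\<integral>\<^sup>+x. f n x \<partial>N) \<le> C n" "C \<longlonglongrightarrow> c"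
    and eventually_eq: "AE x in N. \<forall>\<^sub>F n in sequentially. f n x = g x"
  shows "(\<integral>\<^sup>+x. g x \<partial>N) \<le> c"
proof -
  have "(\<integral>\<^sup>+x. g x \<partial>N) = (\<integral>\<^sup>+x. liminf (\<lambda>n. f n x) \<partial>N)"
    using eventually_eq
    by (intro nn_integral_cong_AE) (auto elim!: eventually_mono dest!: tendsto_eventually
        intro!: lim_imp_Liminf[symmetric])
  also have "\<dots> \<le> liminf (\<lambda>n. \<integral>\<^sup>+x. f n x \<partial>N)" by (rule nn_integral_liminf[OF assms(1)])
  also have "\<dots> \<le> liminf C" by (intro Liminf_mono always_eventually allI assms(2))
  also have "\<dots> = c" by (intro lim_imp_Liminf assms(3)) simp
  finally show ?thesis .
qed

subsection \<open>Product measures\<close>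

context pair_sigma_finite
begin

lemma AE_fst:
  assumes "AE x in M1. P x"
  shows "AE (x, y) in M1 \<Otimes>\<^sub>M M2. P x"
proof -
  obtain A where A: "A \<in> null_sets M1" "{x \<in> space M1. \<not> P x} \<subseteq> A"
    using assms by (auto simp: eventually_ae_filter)
  then have "AE (x, y) in M1 \<Otimes>\<^sub>M M2. x \<notin> A"
    by (intro AE_pair_measure) (auto dest: AE_not_in)
  then show ?thesis
    using AE_space by eventually_elim (use A(2) in \<open>auto simp: space_pair_measure\<close>)
qed

lemma borel_measurable_nn_integral_snd:
  fixes f :: "_ \<Rightarrow> ennreal"
  assumes "f \<in> borel_measurable (M1 \<Otimes>\<^sub>M M2)"
  shows "(\<lambda>y. \<integral>\<^sup>+x. f (x, y) \<partial>M1) \<in> borel_measurable M2"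
  using M1.borel_measurable_nn_integral_fst[OF measurable_pair_swap[OF assms]] by simp

lemma
  fixes f g :: "_ \<Rightarrow> real"
  assumes f: "integrable M1 f" and g: "integrable M2 g"
  shows integrable_times: "integrable (M1 \<Otimes>\<^sub>M M2) (\<lambda>(x, y). f x * g y)"
    and integral_times:
      "(\<integral>(x, y). f x * g y \<partial>(M1 \<Otimes>\<^sub>M M2)) = (\<integral>x. f x \<partial>M1) * (\<integral>y. g y \<partial>M2)"
proof -
  note [measurable] = borel_measurable_integrable[OF f] borel_measurable_integrable[OF g]
  show product: "integrable (M1 \<Otimes>\<^sub>M M2) (\<lambda>(x, y). f x * g y)"
    by (rule Fubini_integrable) (use f g in \<open>auto simp: abs_mult\<close>)
  show "(\<integral>(x, y). f x * g y \<partial>(M1 \<Otimes>\<^sub>M M2)) = (\<integral>x. f x \<partial>M1) * (\<integral>y. g y \<partial>M2)"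
    using integral_fst[OF product] by simp
qed

lemma square_integrable_times:
  assumes f: "square_integrable M1 f" and g: "square_integrable M2 g"
  shows "square_integrable (M1 \<Otimes>\<^sub>M M2) (\<lambda>(x, y). f x * g y)"
proof -
  note [measurable] = square_integrableD(1)[OF f] square_integrableD(1)[OF g]
  have "integrable (M1 \<Otimes>\<^sub>M M2) (\<lambda>(x, y). (f x)\<^sup>2 * (g y)\<^sup>2)"
    using f g by (intro integrable_times) (auto simp: square_integrable_def)
  then show ?thesis by (simp add: square_integrable_def power_mult_distrib split_beta')
qed

lemma square_integrable_integral_fst:
  assumes M2: "finite_measure M2" and f: "square_integrable (M1 \<Otimes>\<^sub>M M2) (\<lambda>(x, y). f x y)"
  shows "square_integrable M1 (\<lambda>x. \<integral>y. f x y \<partial>M2)"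
proof -
  interpret M2: finite_measure M2 by fact
  note [measurable] = square_integrableD(1)[OF f]
  have f_square: "integrable (M1 \<Otimes>\<^sub>M M2) (\<lambda>(x, y). (f x y)\<^sup>2)"
    using square_integrableD(2)[OF f] by (simp add: split_beta')
  have "AE x in M1. norm ((\<integral>y. f x y \<partial>M2)\<^sup>2) \<le> measure M2 (space M2) * (\<integral>y. (f x y)\<^sup>2 \<partial>M2)"
    using AE_integrable_fst[OF f_square] AE_space
  proof eventually_elim
    case (elim x)
    then have "square_integrable M2 (f x)" by (simp add: square_integrable_def)
    from Cauchy_Schwarz_integral[OF M2.square_integrable_const[of 1] this] show ?case by simp
  qed
  then have "AE x in M1. norm ((\<integral>y. f x y \<partial>M2)\<^sup>2)
      \<le> norm (measure M2 (space M2) * (\<integral>y. (f x y)\<^sup>2 \<partial>M2))"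
    by simp
  then have "integrable M1 (\<lambda>x. (\<integral>y. f x y \<partial>M2)\<^sup>2)"
    by (rule Bochner_Integration.integrable_bound[OF
      integrable_mult_right[OF integrable_fst[OF f_square]], rotated])
      measurable
  then show ?thesis by (simp add: square_integrable_def)
qed

end

subsection \<open>Integration over a time interval\<close>

definition lborel_upto :: "real \<Rightarrow> real measure" where
  "lborel_upto T = restrict_space lborel {0..T}"

lemma space_lborel_upto [simp]: "space (lborel_upto T) = {0..T}"
  by (simp add: lborel_upto_def space_restrict_space)

lemma sets_lborel_upto [measurable_cong]:
  "sets (lborel_upto T) = sets (restrict_space borel {0..T})"
  by (simp add: lborel_upto_def sets_restrict_space)

interpretation lborel_upto: finite_measure "lborel_upto T" for T
  by (rule finite_measureI)
    (simp add: lborel_upto_def space_restrict_space emeasure_restrict_space emeasure_lborel_Icc_eq)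

lemma measurable_lborel_upto:
  "f \<in> borel \<rightarrow>\<^sub>M N \<Longrightarrow> f \<in> lborel_upto T \<rightarrow>\<^sub>M N"
  by (simp add: lborel_upto_def measurable_restrict_space1)

abbreviation half_line :: "real measure" where
  "half_line \<equiv> restrict_space lborel {0..}"

lemma measurable_fst_lborel_upto [measurable]: "fst \<in> borel_measurable (lborel_upto T \<Otimes>\<^sub>M N)"
  and measurable_snd_lborel_upto [measurable]: "snd \<in> borel_measurable (N \<Otimes>\<^sub>M lborel_upto T)"
  by (auto intro!: measurable_compose[OF measurable_fst, of "\<lambda>t. t"]
      measurable_compose[OF measurable_snd, of "\<lambda>t. t"] measurable_lborel_upto)

lemma set_integral_upto: "(LBINT s:{0..T}. f s) = (\<integral>s. f s \<partial>lborel_upto T)"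
  and set_integrable_upto: "set_integrable lborel {0..T} f \<longleftrightarrow> integrable (lborel_upto T) f"
  for f :: "real \<Rightarrow> real"
  by (simp_all add: lborel_upto_def set_lebesgue_integral_def set_integrable_def
      integral_restrict_space integrable_restrict_space)

lemma set_nn_integral_upto: "(\<integral>\<^sup>+s\<in>{0..T}. f s \<partial>lborel) = (\<integral>\<^sup>+s. f s \<partial>lborel_upto T)"
  by (simp add: lborel_upto_def nn_integral_restrict_space)

lemma AE_lborel_uptoI:
  assumes "AE t in lborel. 0 \<le> t \<longrightarrow> P t"
  shows "AE t in lborel_upto T. P t"
  unfolding lborel_upto_def
  by (subst AE_restrict_space_iff) (use assms in \<open>auto elim!: eventually_mono\<close>)

lemma lborel_upto_eq_restrict_space:
  assumes "s \<le> T"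
  shows "lborel_upto s = restrict_space (lborel_upto T) {..s}"
proof -
  have "{0..T} \<inter> {..s} = {0..s}" using assms by auto
  then show ?thesis
    unfolding lborel_upto_def by (subst restrict_restrict_space) auto
qed

lemma atMost_Int_lborel_upto: "{..s} \<inter> space (lborel_upto T) \<in> sets (lborel_upto T)"
  unfolding lborel_upto_def by (subst sets_restrict_space_iff) (auto simp: space_restrict_space)

lemma
  fixes f :: "real \<Rightarrow> real" and g :: "real \<Rightarrow> ennreal"
  assumes "s \<le> T"
  shows integral_upto_eq_indicator:
      "(\<integral>v. f v \<partial>lborel_upto s) = (\<integral>v. indicator {..s} v * f v \<partial>lborel_upto T)"
    and integrable_upto_iff_indicator:
      "integrable (lborel_upto s) f \<longleftrightarrow> integrable (lborel_upto T) (\<lambda>v. indicator {..s} v * f v)"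
    and nn_integral_upto_eq_indicator:
      "(\<integral>\<^sup>+v. g v \<partial>lborel_upto s) = (\<integral>\<^sup>+v. indicator {..s} v * g v \<partial>lborel_upto T)"
  unfolding lborel_upto_eq_restrict_space[OF assms]
  by (simp_all only: integral_restrict_space[OF atMost_Int_lborel_upto] real_scaleR_def
      integrable_restrict_space[OF atMost_Int_lborel_upto]
      nn_integral_restrict_space[OF atMost_Int_lborel_upto] mult.commute)

lemma integrable_upto_subset:
  fixes f :: "real \<Rightarrow> real"
  assumes "integrable (lborel_upto T) f" "s \<le> T"
  shows "integrable (lborel_upto s) f"
  unfolding integrable_upto_iff_indicator[OF assms(2)]
  using integrable_mult_indicator[OF atMost_Int_lborel_upto assms(1), of s]
  by (rule Bochner_Integration.integrable_cong[THEN iffD1, OF refl, rotated])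
    (auto simp: indicator_def)

lemma integrable_upto_continuous:
  fixes f :: "real \<Rightarrow> real"
  assumes "continuous_on {0..T} f"
  shows "integrable (lborel_upto T) f"
  using borel_integrable_atLeastAtMost'[OF assms] by (simp add: set_integrable_upto)

lemma integrable_upto_continuous_mult:
  fixes f h :: "real \<Rightarrow> real"
  assumes h: "continuous_on {0..T} h" and f: "integrable (lborel_upto T) f"
  shows "integrable (lborel_upto T) (\<lambda>s. h s * f s)"
proof -
  obtain B where "\<forall>s\<in>{0..T}. \<bar>h s\<bar> \<le> B"
    using compact_imp_bounded[OF compact_continuous_image[OF h]] by (auto simp: bounded_iff)
  then have "\<bar>h s\<bar> * \<bar>f s\<bar> \<le> \<bar>B\<bar> * \<bar>f s\<bar>" if "s \<in> {0..T}" for s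
    using that by (intro mult_right_mono) force+
  then have "AE s in lborel_upto T. norm (h s * f s) \<le> norm (B * f s)"
    by (intro AE_I2) (simp add: abs_mult)
  moreover have "(\<lambda>s. h s * f s) \<in> borel_measurable (lborel_upto T)"
    using integrable_upto_continuous[OF h] f by (intro borel_measurable_times) auto
  ultimately show ?thesis
    by (intro Bochner_Integration.integrable_bound[OF integrable_mult_right[OF f]])
qed

lemma integral_upto_eq_integral:
  fixes f :: "real \<Rightarrow> real"
  assumes "integrable (lborel_upto T) f"
  shows "(\<integral>s. f s \<partial>lborel_upto T) = integral {0..T} f"
  using set_borel_integral_eq_integral(2)[of "{0..T}" f] assms
  by (simp add: set_integral_upto set_integrable_upto)

lemma continuous_on_integral_upto:
  fixes f :: "real \<Rightarrow> real"
  assumes f: "integrable (lborel_upto T) f"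
  shows "continuous_on {0..T} (\<lambda>t. \<integral>s. f s \<partial>lborel_upto t)"
proof -
  have "f integrable_on {0..T}"
    using f by (auto simp: set_integrable_upto[symmetric] intro: set_borel_integral_eq_integral(1))
  then have "continuous_on {0..T} (\<lambda>t. integral {0..t} f)"
    by (rule indefinite_integral_continuous_1)
  moreover have "(\<integral>s. f s \<partial>lborel_upto t) = integral {0..t} f" if "t \<in> {0..T}" for t
    using that by (intro integral_upto_eq_integral integrable_upto_subset[OF f]) auto
  ultimately show ?thesis by (subst continuous_on_cong[OF refl]) auto
qed

lemma integral_upto_exp:
  assumes "0 \<le> T"
  shows "c * (\<integral>s. exp (c * s) \<partial>lborel_upto T) = exp (c * T) - 1"
proof -
  have "(\<integral>s. c * exp (c * s) * indicator {0..T} s \<partial>lborel) = exp (c * T) - exp (c * 0)"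
    by (rule integral_FTC_Icc_real)
      (use assms in \<open>auto intro!: derivative_eq_intros continuous_intros\<close>)
  then show ?thesis
    by (simp add: lborel_upto_def integral_restrict_space mult_ac)
qed

lemma integral_upto_triangle:
  fixes f g :: "real \<Rightarrow> real"
  assumes f: "integrable (lborel_upto T) f" and g: "integrable (lborel_upto T) g"
  shows "(\<integral>s. f s * (\<integral>v. g v \<partial>lborel_upto s) \<partial>lborel_upto T)
    = (\<integral>v. g v * (\<integral>s. indicator {v..} s * f s \<partial>lborel_upto T) \<partial>lborel_upto T)"
proof -
  interpret pair_sigma_finite "lborel_upto T" "lborel_upto T" by unfold_locales
  note [measurable] = borel_measurable_integrable[OF f] borel_measurable_integrable[OF g]
  let ?k = "\<lambda>s v. if v \<le> s then f s * g v else 0"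
  have kernel: "integrable (lborel_upto T \<Otimes>\<^sub>M lborel_upto T) (\<lambda>(s, v). ?k s v)"
    by (rule Bochner_Integration.integrable_bound[OF integrable_times[OF f g]])
      (auto simp: split_beta')
  have "(\<integral>s. f s * (\<integral>v. g v \<partial>lborel_upto s) \<partial>lborel_upto T)
      = (\<integral>s. \<integral>v. ?k s v \<partial>lborel_upto T \<partial>lborel_upto T)"
  proof (intro Bochner_Integration.integral_cong refl)
    fix s assume "s \<in> space (lborel_upto T)"
    then have "f s * (\<integral>v. g v \<partial>lborel_upto s)
        = (\<integral>v. f s * (indicator {..s} v * g v) \<partial>lborel_upto T)"
      by (subst integral_upto_eq_indicator[of s T]) auto
    also have "\<dots> = (\<integral>v. ?k s v \<partial>lborel_upto T)"
      by (intro Bochner_Integration.integral_cong) (auto simp: indicator_def)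
    finally show "f s * (\<integral>v. g v \<partial>lborel_upto s) = (\<integral>v. ?k s v \<partial>lborel_upto T)" .
  qed
  also have "\<dots> = (\<integral>v. \<integral>s. ?k s v \<partial>lborel_upto T \<partial>lborel_upto T)"
    by (rule Fubini_integral[OF kernel, symmetric])
  also have "\<dots> = (\<integral>v. \<integral>s. g v * (indicator {v..} s * f s) \<partial>lborel_upto T \<partial>lborel_upto T)"
    by (intro Bochner_Integration.integral_cong) (auto simp: indicator_def)
  finally show ?thesis by simp
qed

lemma Gronwall_inequality:
  fixes D :: "real \<Rightarrow> real"
  assumes D: "continuous_on {0..T} D" and "0 \<le> K" "0 \<le> T"
    and bound: "\<And>t. t \<in> {0..T} \<Longrightarrow> D t \<le> e + K * (\<integral>s. D s \<partial>lborel_upto t)"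
  shows "D T \<le> e * exp (K * T)"
proof -
  define G where "G t = integral {0..t} D" for t
  define h where "h t = exp (- K * t) * (e + K * G t)" for t
  have G_bound: "D t \<le> e + K * G t" if "t \<in> {0..T}" for t
    using bound[OF that] that
    by (simp add: G_def integral_upto_eq_integral integrable_upto_continuous
      continuous_on_subset[OF D])
  have h_deriv: "(h has_real_derivative exp (- K * t) * (K * (D t - (e + K * G t)))) (at t within {0..T})"
    if "t \<in> {0..T}" for t
    unfolding h_def G_def
    by (auto intro!: derivative_eq_intros integral_has_real_derivative[OF D that]
      simp: algebra_simps)
  have "h T \<le> h 0"
  proof (rule DERIV_nonpos_imp_decreasing_open[OF \<open>0 \<le> T\<close>])
    show "\<exists>y. DERIV h t :> y \<and> y \<le> 0" if "0 < t" "t < T" for t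
      using h_deriv[of t] G_bound[of t] that \<open>0 \<le> K\<close>
      by (auto simp: at_within_Icc_at intro!: exI mult_nonneg_nonpos)
    show "continuous_on {0..T} h" using h_deriv by (intro DERIV_continuous_on) auto
  qed
  then have "e + K * G T \<le> e * exp (K * T)"
    by (simp add: h_def G_def exp_minus field_simps)
  then show ?thesis using G_bound[of T] \<open>0 \<le> T\<close> by simp
qed

lemma integral_upto_indicator_Ioc:
  assumes "0 \<le> a"
  shows "(\<integral>v. indicator {a<..b} v \<partial>lborel_upto T) = (max 0 (min T b - a) :: real)"
proof -
  have "(\<integral>v. indicator {a<..b} v \<partial>lborel_upto T)
      = (\<integral>v. (indicator {a<..min T b} v :: real) \<partial>lborel)"
    unfolding lborel_upto_def
    by (subst integral_restrict_space, simp, intro Bochner_Integration.integral_cong refl)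
      (use assms in \<open>auto simp: indicator_def\<close>)
  also have "\<dots> = max 0 (min T b - a)" by (cases "a \<le> min T b") auto
  finally show ?thesis .
qed

lemma mult_le_abs_mult:
  fixes c :: real
  assumes "0 \<le> s" "s \<le> T"
  shows "c * s \<le> \<bar>c\<bar> * T"
  using assms by (intro order_trans[OF mult_right_mono mult_left_mono]) auto

subsection \<open>Discounting\<close>

text \<open>\<open>discounted b T f\<close> is \<open>\<integral>\<^sub>0\<^sup>T exp (- b s) df(s)\<close> for \<open>f 0 = 0\<close>, integrated by parts so that it
  makes sense for paths of unbounded variation.\<close>

definition discounted :: "real \<Rightarrow> real \<Rightarrow> (real \<Rightarrow> real) \<Rightarrow> real" where
  "discounted b T f = exp (- b * T) * f T + b * (\<integral>s. exp (- b * s) * f s \<partial>lborel_upto T)"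

lemma integrable_upto_exp_mult:
  "integrable (lborel_upto T) f \<Longrightarrow> integrable (lborel_upto T) (\<lambda>s. exp (c * s) * f s)"
  by (rule integrable_upto_continuous_mult) (intro continuous_intros)

lemma discounted_const:
  assumes "0 \<le> T"
  shows "discounted b T (\<lambda>s. c) = c"
proof -
  have "discounted b T (\<lambda>s. c) = (exp (- b * T) + b * (\<integral>s. exp (- b * s) \<partial>lborel_upto T)) * c"
    by (simp add: discounted_def algebra_simps)
  then show ?thesis using integral_upto_exp[OF assms, of "- b"] by simp
qed

lemma discounted_add:
  assumes "integrable (lborel_upto T) f" "integrable (lborel_upto T) g"
  shows "discounted b T (\<lambda>s. f s + g s) = discounted b T f + discounted b T g"
  using integrable_upto_exp_mult[OF assms(1), of "-b"]
    integrable_upto_exp_mult[OF assms(2), of "-b"]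
  by (simp add: discounted_def algebra_simps)

lemma discounted_cong:
  assumes "\<And>s. s \<in> {0..T} \<Longrightarrow> f s = g s" "0 \<le> T"
  shows "discounted b T f = discounted b T g"
  unfolding discounted_def using assms by (auto intro!: Bochner_Integration.integral_cong)

lemma discounted_integral:
  assumes g: "integrable (lborel_upto T) g" and T: "0 \<le> T"
  shows "discounted b T (\<lambda>t. \<integral>v. g v \<partial>lborel_upto t) = (\<integral>v. exp (- b * v) * g v \<partial>lborel_upto T)"
proof -
  have tail: "b * (\<integral>s. indicator {v..} s * exp (- b * s) \<partial>lborel_upto T)
      = exp (- b * v) - exp (- b * T)"
    if "v \<in> {0..T}" for v
  proof -
    have "(\<integral>s. b * exp (- b * s) * indicator {v..T} s \<partial>lborel)
        = - exp (- b * T) - (- exp (- b * v))"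
      by (rule integral_FTC_Icc_real)
        (use that in \<open>auto intro!: derivative_eq_intros continuous_intros\<close>)
    moreover have "b * exp (- b * s) * indicator {v..T} s
        = b * (indicator {0..T} s * (indicator {v..} s * exp (- b * s)))" for s
      using that by (auto simp: indicator_def)
    ultimately have "(\<integral>s. b * (indicator {0..T} s * (indicator {v..} s * exp (- b * s))) \<partial>lborel)
        = exp (- b * v) - exp (- b * T)"
      by (simp only:)
    then show ?thesis by (simp add: lborel_upto_def integral_restrict_space)
  qed
  have "b * (\<integral>s. exp (- b * s) * (\<integral>v. g v \<partial>lborel_upto s) \<partial>lborel_upto T)
      = b * (\<integral>v. g v * (\<integral>s. indicator {v..} s * exp (- b * s) \<partial>lborel_upto T) \<partial>lborel_upto T)"
    by (subst integral_upto_triangle[OF _ g])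
      (auto intro!: integrable_upto_continuous continuous_intros)
  also have "\<dots> = (\<integral>v. g v * (b * (\<integral>s. indicator {v..} s * exp (- b * s) \<partial>lborel_upto T)) \<partial>lborel_upto T)"
    by (simp add: mult.left_commute flip: integral_mult_right_zero)
  also have "\<dots> = (\<integral>v. exp (- b * v) * g v - exp (- b * T) * g v \<partial>lborel_upto T)"
    by (intro Bochner_Integration.integral_cong refl) (subst tail, auto simp: algebra_simps)
  also have "\<dots> = (\<integral>v. exp (- b * v) * g v \<partial>lborel_upto T) - exp (- b * T) * (\<integral>v. g v \<partial>lborel_upto T)"
    using g integrable_upto_exp_mult[OF g, of "-b"] by simp
  finally show ?thesis by (simp add: discounted_def)
qed

lemma discounted_stopped:
  assumes N: "continuous_on {0..} N" and T: "0 \<le> T" "0 \<le> \<tau>"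
  shows "discounted b T (\<lambda>s. N (min s \<tau>)) = discounted b (min T \<tau>) N"
proof (cases "T \<le> \<tau>")
  case True
  then show ?thesis using T by (auto intro!: discounted_cong simp: min_def)
next
  case False
  have "continuous_on {0..T} (\<lambda>s. N (min s \<tau>))"
    using T by (intro continuous_on_compose2[OF N] continuous_intros) auto
  then have int: "integrable (lborel_upto T) (\<lambda>s. N (min s \<tau>))" "integrable (lborel_upto \<tau>) N"
    using integrable_upto_continuous continuous_on_subset[OF N, of "{0..\<tau>}"] by auto
  have "discounted b T (\<lambda>s. N (min s \<tau>)) - N \<tau> = discounted b T (\<lambda>s. N (min s \<tau>) + - N \<tau>)"
    using T by (subst discounted_add) (auto simp: discounted_const int)
  also have "\<dots> = b * (\<integral>s. exp (- b * s) * (N (min s \<tau>) - N \<tau>) \<partial>lborel_upto T)"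
    using False by (simp add: discounted_def)
  also have "\<dots> = b * (\<integral>s. indicator {..\<tau>} s * (exp (- b * s) * (N s - N \<tau>)) \<partial>lborel_upto T)"
    by (intro arg_cong[where f="\<lambda>z. b * z"] Bochner_Integration.integral_cong)
      (auto simp: indicator_def)
  also have "\<dots> = discounted b \<tau> (\<lambda>s. N s + - N \<tau>)"
    using False by (simp add: discounted_def integral_upto_eq_indicator[of \<tau> T])
  also have "\<dots> = discounted b \<tau> N - N \<tau>"
    using T by (subst discounted_add) (auto simp: discounted_const int)
  finally show ?thesis using False by (simp add: min_def)
qed

lemma linear_path_equation:
  assumes f: "continuous_on {0..T} f" and N: "continuous_on {0..T} N"
    and drift: "integrable (lborel_upto T) (\<lambda>s. b * f s + g s)" and T: "0 \<le> T"
    and eq: "\<And>t. t \<in> {0..T} \<Longrightarrow> f t = x + (\<integral>s. b * f s + g s \<partial>lborel_upto t) + N t"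
  shows "integrable (lborel_upto T) g"
    and "exp (- b * T) * f T = x + (\<integral>s. exp (- b * s) * g s \<partial>lborel_upto T) + discounted b T N"
proof -
  have f_int: "integrable (lborel_upto T) f" using f by (rule integrable_upto_continuous)
  from Bochner_Integration.integrable_diff[OF drift integrable_mult_right[OF f_int, of b]]
  show g_int: "integrable (lborel_upto T) g" by simp
  let ?G = "\<lambda>t. \<integral>s. b * f s + g s \<partial>lborel_upto t"
  have int: "integrable (lborel_upto T) ?G" "integrable (lborel_upto T) N"
    using continuous_on_integral_upto[OF drift] N by (auto intro: integrable_upto_continuous)
  have "discounted b T f = discounted b T (\<lambda>t. (x + ?G t) + N t)"
    by (rule discounted_cong[OF eq T])
  also have "\<dots> = x + discounted b T ?G + discounted b T N"
    by (simp add: discounted_add int discounted_const[OF T])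
  also have "discounted b T ?G = (\<integral>v. exp (- b * v) * (b * f v + g v) \<partial>lborel_upto T)"
    by (rule discounted_integral[OF drift T])
  also have "\<dots> = b * (\<integral>v. exp (- b * v) * f v \<partial>lborel_upto T)
      + (\<integral>v. exp (- b * v) * g v \<partial>lborel_upto T)"
    using integrable_upto_exp_mult[OF f_int, of "-b"] integrable_upto_exp_mult[OF g_int, of "-b"]
    by (simp add: algebra_simps)
  finally show "exp (- b * T) * f T
      = x + (\<integral>s. exp (- b * s) * g s \<partial>lborel_upto T) + discounted b T N"
    by (simp add: discounted_def)
qed

lemma stopped_linear_path_equation:
  assumes f: "continuous_on {0..} f" and N: "continuous_on {0..} N"
    and drift: "\<And>t. 0 \<le> t \<Longrightarrow> integrable (lborel_upto t) (\<lambda>s. b * f s + g s)"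
    and eq: "\<And>t. 0 \<le> t \<Longrightarrow> f t = x + (\<integral>s. b * f s + g s \<partial>lborel_upto t) + N t"
    and T: "0 \<le> T" "0 \<le> \<tau>"
  shows "integrable (lborel_upto (min T \<tau>)) g"
    and "exp (- b * min T \<tau>) * f (min T \<tau>)
      = x + (\<integral>s. exp (- b * s) * g s \<partial>lborel_upto (min T \<tau>)) + discounted b T (\<lambda>s. N (min s \<tau>))"
  unfolding discounted_stopped[OF N T]
  by (rule linear_path_equation[where x = x and N = N];
      use T in \<open>auto intro!: continuous_on_subset[OF f] continuous_on_subset[OF N] drift eq\<close>)+

subsection \<open>Processes with continuous paths\<close>

lemma measurable_process_restrict_space:
  assumes Z: "measurable_process M Z" and A: "A \<subseteq> {0..}"
  shows "(\<lambda>(\<omega>, t). Z t \<omega>) \<in> borel_measurable (M \<Otimes>\<^sub>M restrict_space lborel A)"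
proof -
  have "(\<lambda>t. t) \<in> restrict_space lborel A \<rightarrow>\<^sub>M restrict_space borel {0..}"
    using A by (intro measurable_restrict_space2 measurable_restrict_space1)
      (auto simp: space_restrict_space)
  then have "(\<lambda>p. (fst p, snd p))
      \<in> M \<Otimes>\<^sub>M restrict_space lborel A \<rightarrow>\<^sub>M M \<Otimes>\<^sub>M restrict_space borel {0..}"
    by (intro measurable_Pair measurable_fst measurable_compose[OF measurable_snd])
  from measurable_compose[OF this Z[unfolded measurable_process_def]] show ?thesis
    by (simp add: split_beta')
qed

lemma measurable_process_upto:
  "measurable_process M Z \<Longrightarrow> (\<lambda>(\<omega>, t). Z t \<omega>) \<in> borel_measurable (M \<Otimes>\<^sub>M lborel_upto T)"
  unfolding lborel_upto_def by (rule measurable_process_restrict_space) auto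

lemma measurable_process_section:
  assumes "measurable_process M Z" "0 \<le> t"
  shows "Z t \<in> borel_measurable M"
proof -
  have "(\<lambda>\<omega>. (\<omega>, t)) \<in> M \<rightarrow>\<^sub>M M \<Otimes>\<^sub>M restrict_space borel {0..}"
    using assms(2) by (intro measurable_Pair) (auto simp: space_restrict_space)
  from measurable_compose[OF this assms(1)[unfolded measurable_process_def]] show ?thesis by simp
qed

lemma floor_approximation_tendsto:
  fixes t :: real
  assumes "0 \<le> t"
  shows "(\<lambda>n. real (nat \<lfloor>real (Suc n) * t\<rfloor>) / real (Suc n)) \<longlonglongrightarrow> t"
proof (rule LIM_zero_cancel, rule Lim_null_comparison)
  show "\<forall>\<^sub>F n in sequentially.
      norm (real (nat \<lfloor>real (Suc n) * t\<rfloor>) / real (Suc n) - t) \<le> inverse (real (Suc n))"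
  proof (intro always_eventually allI)
    fix n
    have "\<bar>real (nat \<lfloor>real (Suc n) * t\<rfloor>) - real (Suc n) * t\<bar> \<le> 1"
      using assms by (simp del: of_nat_Suc) linarith
    moreover have "real (nat \<lfloor>real (Suc n) * t\<rfloor>) / real (Suc n) - t
        = (real (nat \<lfloor>real (Suc n) * t\<rfloor>) - real (Suc n) * t) / real (Suc n)"
      by (simp add: diff_divide_distrib del: of_nat_Suc)
    ultimately show "norm (real (nat \<lfloor>real (Suc n) * t\<rfloor>) / real (Suc n) - t)
        \<le> inverse (real (Suc n))"
      by (simp add: abs_divide inverse_eq_divide divide_right_mono del: of_nat_Suc)
  qed
qed (rule LIMSEQ_inverse_real_of_nat)

lemma measurable_process_continuous:
  assumes Z: "\<And>t. 0 \<le> t \<Longrightarrow> Z t \<in> borel_measurable M"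
    and cont: "\<And>\<omega>. continuous_on {0..} (\<lambda>t. Z t \<omega>)"
  shows "measurable_process M Z"
  unfolding measurable_process_def
proof (rule borel_measurable_LIMSEQ_real)
  let ?N = "M \<Otimes>\<^sub>M restrict_space borel {0::real..}"
  let ?q = "\<lambda>n t. real (nat \<lfloor>real (Suc n) * t\<rfloor>) / real (Suc n)"
  fix p assume "p \<in> space ?N"
  then have "0 \<le> snd p" by (auto simp: space_pair_measure space_restrict_space)
  then show "(\<lambda>n. Z (?q n (snd p)) (fst p)) \<longlonglongrightarrow> (case p of (\<omega>, t) \<Rightarrow> Z t \<omega>)"
    unfolding split_beta'
    by (intro continuous_on_tendsto_compose[OF cont floor_approximation_tendsto]) auto
next
  fix n
  let ?N = "M \<Otimes>\<^sub>M restrict_space borel {0::real..}"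
  have [measurable]: "snd \<in> borel_measurable ?N"
    by (rule measurable_compose[OF measurable_snd measurable_restrict_space1]) simp
  show "(\<lambda>p. Z (real (nat \<lfloor>real (Suc n) * snd p\<rfloor>) / real (Suc n)) (fst p)) \<in> borel_measurable ?N"
  proof (rule measurable_compose_countable[where f = "\<lambda>i p. Z (real i / real (Suc n)) (fst p)"])
    show "(\<lambda>p. Z (real i / real (Suc n)) (fst p)) \<in> borel_measurable ?N" for i
      by (rule measurable_compose[OF measurable_fst Z]) simp
  qed measurable
qed

text \<open>Paths are only almost surely continuous. Setting the exceptional paths to \<open>0\<close> preserves
  adaptedness, since the filtration is complete, and gives joint measurability.\<close>

definition continuous_version :: "(real \<Rightarrow> 'a \<Rightarrow> real) \<Rightarrow> real \<Rightarrow> 'a \<Rightarrow> real" where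
  "continuous_version Z t \<omega> = (if continuous_on {0..} (\<lambda>t. Z t \<omega>) then Z t \<omega> else 0)"

lemma continuous_on_continuous_version: "continuous_on {0..} (\<lambda>t. continuous_version Z t \<omega>)"
  by (cases "continuous_on {0..} (\<lambda>t. Z t \<omega>)") (auto simp: continuous_version_def)

lemma AE_continuous_version:
  "continuous_paths M Z \<Longrightarrow> AE \<omega> in M. \<forall>t. continuous_version Z t \<omega> = Z t \<omega>"
  unfolding continuous_paths_def by (erule eventually_mono) (auto simp: continuous_version_def)

context usual_filtered_prob_space
begin

lemma space_F [simp]: "0 \<le> t \<Longrightarrow> space (F t) = space M"
  using subalg[of t] by (auto simp: subalgebra_def)

lemma measurable_F_imp_M: "0 \<le> t \<Longrightarrow> f \<in> F t \<rightarrow>\<^sub>M S \<Longrightarrow> f \<in> M \<rightarrow>\<^sub>M S"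
  using subalg by (rule measurable_from_subalg)

lemma measurable_F_mono:
  assumes "0 \<le> s" "s \<le> t" "f \<in> F s \<rightarrow>\<^sub>M S"
  shows "f \<in> F t \<rightarrow>\<^sub>M S"
proof (rule measurable_from_subalg[OF _ assms(3)])
  show "subalgebra (F t) (F s)"
    using assms filtration_mono by (auto simp: subalgebra_def)
qed

lemma adapted_continuous_version:
  assumes Z: "adapted F Z" and cont: "continuous_paths M Z"
  shows "adapted F (continuous_version Z)"
  unfolding adapted_def
proof (intro allI impI)
  fix t :: real assume t: "0 \<le> t"
  let ?C = "\<lambda>\<omega>. continuous_on {0..} (\<lambda>t. Z t \<omega>)"
  obtain N where "N \<in> null_sets M" "{\<omega> \<in> space M. \<not> ?C \<omega>} \<subseteq> N"
    using cont unfolding continuous_paths_def eventually_ae_filter by blast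
  then have "{\<omega> \<in> space M. \<not> ?C \<omega>} \<in> sets (F 0)" by (rule complete)
  then have "{\<omega> \<in> space M. \<not> ?C \<omega>} \<in> sets (F t)"
    using filtration_mono[of 0 t] t by auto
  then have "Measurable.pred (F t) (\<lambda>\<omega>. \<not> ?C \<omega>)" using t by (simp add: pred_def)
  from pred_intros_logic(2)[OF this] have [measurable]: "Measurable.pred (F t) ?C" by simp
  have [measurable]: "Z t \<in> borel_measurable (F t)" using Z t by (auto simp: adapted_def)
  show "continuous_version Z t \<in> borel_measurable (F t)"
    unfolding continuous_version_def by measurable
qed

lemma measurable_process_adapted_continuous:
  assumes "adapted F Z" "\<And>\<omega>. continuous_on {0..} (\<lambda>t. Z t \<omega>)"
  shows "measurable_process M Z"
  using assms
  by (intro measurable_process_continuous) (auto simp: adapted_def intro: measurable_F_imp_M)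

sublocale upto: pair_sigma_finite M "lborel_upto T" for T
  by unfold_locales

sublocale half_line: pair_sigma_finite M half_line
proof -
  interpret half_line: sigma_finite_measure half_line
    by (rule sigma_finite_measure_restrict_space) (auto intro: lborel.sigma_finite_measure_axioms)
  show "pair_sigma_finite M half_line" by unfold_locales
qed

abbreviation prod_upto :: "real \<Rightarrow> ('a \<times> real) measure" where
  "prod_upto T \<equiv> M \<Otimes>\<^sub>M lborel_upto T"

lemma square_integrable_processI:
  assumes Z: "measurable_process M Z"
    and Z_square: "\<And>t. t \<in> {0..T} \<Longrightarrow> square_integrable M (Z t)"
    and bound: "\<And>t. t \<in> {0..T} \<Longrightarrow> expectation (\<lambda>\<omega>. (Z t \<omega>)\<^sup>2) \<le> C"
  shows "square_integrable (prod_upto T) (\<lambda>(\<omega>, t). Z t \<omega>)"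
proof -
  note [measurable] = measurable_process_upto[OF Z, of T]
  have "integrable (prod_upto T) (\<lambda>p. (case p of (\<omega>, t) \<Rightarrow> Z t \<omega>)\<^sup>2)"
  proof (rule integrableI_bounded)
    have "(\<integral>\<^sup>+p. ennreal (norm ((case p of (\<omega>, t) \<Rightarrow> Z t \<omega>)\<^sup>2)) \<partial>prod_upto T)
        = (\<integral>\<^sup>+t. \<integral>\<^sup>+\<omega>. ennreal ((Z t \<omega>)\<^sup>2) \<partial>M \<partial>lborel_upto T)"
      by (subst upto.nn_integral_snd[symmetric]) auto
    also have "\<dots> \<le> (\<integral>\<^sup>+t. ennreal C \<partial>lborel_upto T)"
    proof (rule nn_integral_mono)
      fix t assume "t \<in> space (lborel_upto T)"
      then show "(\<integral>\<^sup>+\<omega>. ennreal ((Z t \<omega>)\<^sup>2) \<partial>M) \<le> ennreal C"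
        using Z_square[of t] bound[of t]
        by (subst nn_integral_eq_integral) (auto simp: square_integrable_def intro: ennreal_leI)
    qed
    also have "\<dots> < \<infinity>"
      using lborel_upto.emeasure_finite[of T "{0..T}"]
      by (simp add: ennreal_mult_eq_top_iff less_top[symmetric])
    finally show "(\<integral>\<^sup>+p. ennreal (norm ((case p of (\<omega>, t) \<Rightarrow> Z t \<omega>)\<^sup>2)) \<partial>prod_upto T) < \<infinity>" .
  qed measurable
  then show ?thesis by (simp add: square_integrable_def)
qed

lemma stopping_time_measurable:
  assumes "stopping_time F \<tau>" and nonneg: "\<And>\<omega>. \<omega> \<in> space M \<Longrightarrow> 0 \<le> \<tau> \<omega>"
  shows "\<tau> \<in> borel_measurable M"
proof (rule borel_measurableI_le)
  fix t :: real
  show "{\<omega> \<in> space M. \<tau> \<omega> \<le> t} \<in> sets M"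
  proof (cases "0 \<le> t")
    case True
    have "Measurable.pred (F t) (\<lambda>\<omega>. \<tau> \<omega> \<le> t)" using assms(1) by (simp add: stopping_time_def)
    from measurable_F_imp_M[OF True this] show ?thesis by (simp add: pred_def)
  next
    case False
    then have "{\<omega> \<in> space M. \<tau> \<omega> \<le> t} = {}" using nonneg by force
    then show ?thesis by (simp only: sets.empty_sets)
  qed
qed

lemma integral_prod_upto_eq_indicator:
  fixes f :: "'a \<Rightarrow> real \<Rightarrow> real"
  assumes "s \<le> T" "integrable (prod_upto s) (\<lambda>(\<omega>, v). f \<omega> v)"
    and "integrable (prod_upto T) (\<lambda>(\<omega>, v). indicator {..s} v * f \<omega> v)"
  shows "(\<integral>(\<omega>, v). f \<omega> v \<partial>prod_upto s) = (\<integral>(\<omega>, v). indicator {..s} v * f \<omega> v \<partial>prod_upto T)"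
  using upto.integral_fst[OF assms(2)] upto.integral_fst[OF assms(3)]
  by (simp add: integral_upto_eq_indicator[OF assms(1)])

lemma square_integrable_exp_mult_prod:
  assumes "square_integrable (prod_upto T) (\<lambda>(\<omega>, s). Z s \<omega>)"
  shows "square_integrable (prod_upto T) (\<lambda>(\<omega>, s). exp (c * s) * Z s \<omega>)"
proof -
  have "(\<lambda>p. exp (c * snd p)) \<in> borel_measurable (prod_upto T)" by measurable
  then have "square_integrable (prod_upto T) (\<lambda>p. exp (c * snd p) * (case p of (\<omega>, s) \<Rightarrow> Z s \<omega>))"
    by (rule square_integrable_bounded_mult[OF assms, where B = "exp (\<bar>c\<bar> * T)"])
      (auto simp: space_pair_measure intro!: mult_le_abs_mult)
  then show ?thesis by (simp add: split_beta')
qed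

lemma L2_locI:
  assumes Z: "measurable_process M Z" "adapted F Z"
    and Z_square: "\<And>R. square_integrable (prod_upto R) (\<lambda>(\<omega>, t). Z t \<omega>)"
  shows "Z \<in> L2_loc M F"
proof -
  have "(\<integral>\<^sup>+\<omega>. (\<integral>\<^sup>+t\<in>{0..R}. ennreal (\<bar>Z t \<omega>\<bar>\<^sup>2) \<partial>lborel) \<partial>M) < \<infinity>" for R
  proof -
    note [measurable] = square_integrableD(1)[OF Z_square[of R]]
    have "(\<integral>\<^sup>+\<omega>. (\<integral>\<^sup>+t. ennreal (\<bar>Z t \<omega>\<bar>\<^sup>2) \<partial>lborel_upto R) \<partial>M)
        = (\<integral>\<^sup>+p. ennreal ((case p of (\<omega>, t) \<Rightarrow> Z t \<omega>)\<^sup>2) \<partial>prod_upto R)"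
      by (subst lborel_upto.nn_integral_fst[symmetric]) auto
    then show ?thesis
      using square_integrableD(2)[OF Z_square[of R]]
      by (simp add: set_nn_integral_upto nn_integral_eq_integral)
  qed
  then show ?thesis using Z by (simp add: L2_loc_def)
qed

lemma L1_loc_nonnegI:
  assumes Z: "measurable_process M Z" "adapted F Z" and nonneg: "AE \<omega> in M. \<forall>t\<ge>0. 0 \<le> Z t \<omega>"
    and Z_integrable: "\<And>R. integrable (prod_upto R) (\<lambda>(\<omega>, t). Z t \<omega>)"
  shows "Z \<in> L1_loc_nonneg M F"
proof -
  have "(\<integral>\<^sup>+\<omega>. (\<integral>\<^sup>+t\<in>{0..R}. ennreal \<bar>Z t \<omega>\<bar> \<partial>lborel) \<partial>M) < \<infinity>" for R
  proof -
    note [measurable] = borel_measurable_integrable[OF Z_integrable[of R]]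
    have "(\<integral>\<^sup>+\<omega>. (\<integral>\<^sup>+t. ennreal \<bar>Z t \<omega>\<bar> \<partial>lborel_upto R) \<partial>M)
        = (\<integral>\<^sup>+p. ennreal \<bar>case p of (\<omega>, t) \<Rightarrow> Z t \<omega>\<bar> \<partial>prod_upto R)"
      by (subst lborel_upto.nn_integral_fst[symmetric]) auto
    then show ?thesis
      using integrable_abs[OF Z_integrable[of R]]
      by (simp add: set_nn_integral_upto nn_integral_eq_integral)
  qed
  moreover have "AE \<omega> in M. AE t in lborel. 0 \<le> t \<longrightarrow> 0 \<le> Z t \<omega>"
    using nonneg by eventually_elim simp
  ultimately show ?thesis using Z by (simp add: L1_loc_nonneg_def)
qed

lemma L1_loc_path_integrable:
  assumes "c \<in> L1_loc_nonneg M F"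
  shows "AE \<omega> in M. integrable (lborel_upto T) (\<lambda>s. c s \<omega>)"
proof -
  define R where "R = max T 1"
  have R: "0 < R" "T \<le> R" by (auto simp: R_def)
  have c: "measurable_process M c"
    and finite: "(\<integral>\<^sup>+\<omega>. (\<integral>\<^sup>+s. ennreal \<bar>c s \<omega>\<bar> \<partial>lborel_upto R) \<partial>M) < \<infinity>"
    using assms R by (auto simp: L1_loc_nonneg_def set_nn_integral_upto)
  note [measurable] = measurable_process_upto[OF c, of R]
  have "(\<lambda>\<omega>. \<integral>\<^sup>+s. ennreal \<bar>c s \<omega>\<bar> \<partial>lborel_upto R) \<in> borel_measurable M" by measurable
  from nn_integral_PInf_AE[OF this] finite
  have "AE \<omega> in M. (\<integral>\<^sup>+s. ennreal \<bar>c s \<omega>\<bar> \<partial>lborel_upto R) \<noteq> \<infinity>" by simp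
  then show ?thesis
    using AE_space
  proof eventually_elim
    case (elim \<omega>)
    then have "integrable (lborel_upto R) (\<lambda>s. c s \<omega>)"
      by (intro integrableI_bounded) (auto simp: less_top)
    then show ?case using R(2) by (rule integrable_upto_subset)
  qed
qed

definition bounded_measurable :: "real \<Rightarrow> ('a \<Rightarrow> real) \<Rightarrow> bool" where
  "bounded_measurable t Y \<longleftrightarrow> Y \<in> borel_measurable (F t) \<and> (\<exists>B. \<forall>\<omega>\<in>space M. \<bar>Y \<omega>\<bar> \<le> B)"

lemma bounded_measurable_mono:
  "0 \<le> s \<Longrightarrow> s \<le> t \<Longrightarrow> bounded_measurable s Y \<Longrightarrow> bounded_measurable t Y"
  unfolding bounded_measurable_def using measurable_F_mono by blast

lemma bounded_measurable_mult:
  assumes "bounded_measurable t Y" "bounded_measurable t Z"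
  shows "bounded_measurable t (\<lambda>\<omega>. Y \<omega> * Z \<omega>)"
proof -
  obtain B C where "\<forall>\<omega>\<in>space M. \<bar>Y \<omega>\<bar> \<le> B" "\<forall>\<omega>\<in>space M. \<bar>Z \<omega>\<bar> \<le> C"
    using assms by (auto simp: bounded_measurable_def)
  then have "\<forall>\<omega>\<in>space M. \<bar>Y \<omega> * Z \<omega>\<bar> \<le> B * C"
    by (auto simp: abs_mult intro!: mult_mono order_trans[OF abs_ge_zero])
  then show ?thesis using assms unfolding bounded_measurable_def by auto
qed

lemma bounded_measurable_mult_square_integrable:
  assumes "0 \<le> t" "bounded_measurable t Y" "square_integrable M f"
  shows "square_integrable M (\<lambda>\<omega>. Y \<omega> * f \<omega>)"
  using assms measurable_F_imp_M[OF assms(1)] unfolding bounded_measurable_def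
  by (auto intro: square_integrable_bounded_mult)

lemma bounded_measurable_square_integrable:
  assumes "0 \<le> t" "bounded_measurable t Y"
  shows "square_integrable M Y"
  using bounded_measurable_mult_square_integrable[OF assms square_integrable_const[of 1]] by simp

lemma square_integrable_elementary:
  assumes "0 \<le> a" "bounded_measurable a \<xi>"
  shows "square_integrable (prod_upto T) (\<lambda>(\<omega>, v). \<xi> \<omega> * indicator {a<..b} v)"
proof (rule upto.square_integrable_times[OF bounded_measurable_square_integrable[OF assms]])
  have "(\<lambda>v. indicator {a<..b} v :: real) \<in> borel_measurable (lborel_upto T)"
    by (intro measurable_lborel_upto) measurable
  then have "square_integrable (lborel_upto T) (\<lambda>v. indicator {a<..b} v * 1)"
    by (rule square_integrable_bounded_mult[OF lborel_upto.square_integrable_const, where B = 1])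
      (simp add: indicator_def)
  then show "square_integrable (lborel_upto T) (indicator {a<..b})" by simp
qed

lemma step_integrandD:
  assumes "step_integrand M F n u \<xi>" "i < n"
  shows "0 \<le> u i" "u i \<le> u (Suc i)" "bounded_measurable (u i) (\<xi> i)"
proof -
  have "j \<le> n \<Longrightarrow> 0 \<le> u j" for j
  proof (induction j)
    case (Suc j)
    then have "u j \<le> u (Suc j)" using assms(1) by (auto simp: step_integrand_def)
    then show ?case using Suc by simp
  qed (use assms in \<open>auto simp: step_integrand_def\<close>)
  then show "0 \<le> u i" using assms(2) by simp
  show "u i \<le> u (Suc i)" "bounded_measurable (u i) (\<xi> i)"
    using assms by (auto simp: step_integrand_def bounded_measurable_def bounded_iff)
qed

end

subsection \<open>Gaussian increments\<close>

lemma normal_density_mult_exp: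
  assumes "0 < s"
  shows "normal_density 0 s x * exp (\<alpha> * x) = exp (\<alpha>\<^sup>2 * s\<^sup>2 / 2) * normal_density (\<alpha> * s\<^sup>2) s x"
proof -
  have "- (x - 0)\<^sup>2 / (2 * s\<^sup>2) + \<alpha> * x = \<alpha>\<^sup>2 * s\<^sup>2 / 2 + - (x - \<alpha> * s\<^sup>2)\<^sup>2 / (2 * s\<^sup>2)"
    using assms by (simp add: field_simps power2_eq_square)
  then have "exp (- (x - 0)\<^sup>2 / (2 * s\<^sup>2)) * exp (\<alpha> * x)
      = exp (\<alpha>\<^sup>2 * s\<^sup>2 / 2) * exp (- (x - \<alpha> * s\<^sup>2)\<^sup>2 / (2 * s\<^sup>2))"
    by (simp only: exp_add[symmetric])
  then show ?thesis unfolding normal_density_def by (simp add: mult_ac)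
qed

context prob_space
begin

lemma indep_var_of_indep_set:
  assumes indep: "indep_set (sets A) (sets B)" and A: "subalgebra M A" and B: "subalgebra M B"
    and X: "X \<in> A \<rightarrow>\<^sub>M S" and Y: "Y \<in> B \<rightarrow>\<^sub>M T"
  shows "indep_var S X T Y"
  unfolding indep_var_eq
proof (intro conjI)
  show "X \<in> M \<rightarrow>\<^sub>M S" "Y \<in> M \<rightarrow>\<^sub>M T"
    using measurable_from_subalg[OF A X] measurable_from_subalg[OF B Y] by auto
  have generated: "sigma_sets (space M) {Z -` C \<inter> space M |C. C \<in> sets R} \<subseteq> sets N"
    if "subalgebra M N" "Z \<in> N \<rightarrow>\<^sub>M R" for N Z and R :: "'z measure"
    using measurable_sets[OF that(2)] that(1) sets.top[of N]
    by (intro sets.sigma_sets_subset') (auto simp: subalgebra_def)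
  show "indep_set (sigma_sets (space M) {X -` C \<inter> space M |C. C \<in> sets S})
      (sigma_sets (space M) {Y -` C \<inter> space M |C. C \<in> sets T})"
    using indep generated[OF A X] generated[OF B Y] unfolding indep_sets2_eq by blast
qed

lemma indep_var_nn_integral_mult:
  fixes X Y :: "'a \<Rightarrow> ennreal"
  assumes "indep_var borel X borel Y"
  shows "(\<integral>\<^sup>+\<omega>. X \<omega> * Y \<omega> \<partial>M) = (\<integral>\<^sup>+\<omega>. X \<omega> \<partial>M) * (\<integral>\<^sup>+\<omega>. Y \<omega> \<partial>M)"
proof -
  have "indep_vars (\<lambda>_. borel) (case_bool X Y) UNIV"
    using assms unfolding indep_var_def
    by (rule subst[where P="\<lambda>B. indep_vars B _ _", rotated]) (auto split: bool.split)
  from indep_vars_nn_integral[OF _ this] show ?thesis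
    by (simp add: UNIV_bool mult.commute)
qed

end

context brownian_motion
begin

lemma W_measurable_F: "0 \<le> s \<Longrightarrow> s \<le> t \<Longrightarrow> W s \<in> borel_measurable (F t)"
  using W_adapted measurable_F_mono[of s t] by (auto simp: adapted_def)

lemma W_measurable [measurable]: "0 \<le> t \<Longrightarrow> W t \<in> borel_measurable M"
  using W_measurable_F measurable_F_imp_M by blast

lemma increment_indep_var:
  assumes st: "0 \<le> s" "s \<le> t" and Y: "Y \<in> F s \<rightarrow>\<^sub>M S" and g: "g \<in> borel \<rightarrow>\<^sub>M T"
  shows "indep_var S Y T (\<lambda>\<omega>. g (W t \<omega> - W s \<omega>))"
proof (cases "s = t")
  case True
  have "indep_set (sets (F s)) (sets (sigma (space M) {}))"
    using subalg[OF st(1)]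
    by (auto simp: indep_sets2_eq subalgebra_def sigma_sets_empty_eq prob_space Int_absorb2
        dest: sets.sets_into_space)
  then have "indep_var S Y T (\<lambda>_. g 0)"
    by (rule indep_var_of_indep_set[OF _ subalg[OF st(1)] _ Y])
      (auto simp: subalgebra_def sigma_sets_empty_eq
        intro!: measurable_const measurable_space[OF g])
  with True show ?thesis by simp
next
  case False
  then have strict: "s < t" using st by simp
  let ?B = "vimage_algebra (space M) (\<lambda>\<omega>. W t \<omega> - W s \<omega>) borel"
  have "subalgebra M ?B"
    using W_indep[OF st(1) strict] unfolding indep_sets2_eq by (auto simp: subalgebra_def)
  moreover have "(\<lambda>\<omega>. g (W t \<omega> - W s \<omega>)) \<in> ?B \<rightarrow>\<^sub>M T"
    by (rule measurable_compose[OF measurable_vimage_algebra1 g]) auto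
  ultimately show ?thesis
    by (rule indep_var_of_indep_set[OF W_indep[OF st(1) strict] subalg[OF st(1)] _ Y])
qed

lemma
  fixes Y :: "'a \<Rightarrow> real"
  assumes "0 \<le> s" "s \<le> t" "Y \<in> borel_measurable (F s)" "g \<in> borel_measurable borel"
    and "integrable M Y" "integrable M (\<lambda>\<omega>. g (W t \<omega> - W s \<omega>))"
  shows integrable_mult_increment: "integrable M (\<lambda>\<omega>. Y \<omega> * g (W t \<omega> - W s \<omega>))"
    and expectation_mult_increment: "expectation (\<lambda>\<omega>. Y \<omega> * g (W t \<omega> - W s \<omega>))
      = expectation Y * expectation (\<lambda>\<omega>. g (W t \<omega> - W s \<omega>))"
  using indep_var_integrable[OF increment_indep_var[OF assms(1-4)] assms(5,6)]
    indep_var_lebesgue_integral[OF increment_indep_var[OF assms(1-4)] assms(5,6)] by auto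

lemma
  assumes st: "0 \<le> s" "s < t" and [measurable]: "g \<in> borel_measurable borel"
    and int: "integrable lborel (\<lambda>x. normal_density (\<alpha> * (t - s)) (sqrt (t - s)) x * g x)"
  shows increment_tilted_integrable:
      "integrable M (\<lambda>\<omega>. exp (\<alpha> * (W t \<omega> - W s \<omega>)) * g (W t \<omega> - W s \<omega>))"
    and increment_tilted_expectation:
      "expectation (\<lambda>\<omega>. exp (\<alpha> * (W t \<omega> - W s \<omega>)) * g (W t \<omega> - W s \<omega>))
        = exp (\<alpha>\<^sup>2 * (t - s) / 2) * (\<integral>x. normal_density (\<alpha> * (t - s)) (sqrt (t - s)) x * g x \<partial>lborel)"
proof -
  have density: "normal_density 0 (sqrt (t - s)) x * (exp (\<alpha> * x) * g x)
      = exp (\<alpha>\<^sup>2 * (t - s) / 2) * (normal_density (\<alpha> * (t - s)) (sqrt (t - s)) x * g x)" for x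
    using normal_density_mult_exp[of "sqrt (t - s)" x \<alpha>] st by (simp flip: mult.assoc)
  show "integrable M (\<lambda>\<omega>. exp (\<alpha> * (W t \<omega> - W s \<omega>)) * g (W t \<omega> - W s \<omega>))"
    using distributed_integrable[OF W_normal[OF st], of "\<lambda>x. exp (\<alpha> * x) * g x"] int
    by (simp add: density)
  show "expectation (\<lambda>\<omega>. exp (\<alpha> * (W t \<omega> - W s \<omega>)) * g (W t \<omega> - W s \<omega>))
      = exp (\<alpha>\<^sup>2 * (t - s) / 2) * (\<integral>x. normal_density (\<alpha> * (t - s)) (sqrt (t - s)) x * g x \<partial>lborel)"
    using distributed_integral[OF W_normal[OF st], of "\<lambda>x. exp (\<alpha> * x) * g x"]
    by (simp add: density)
qed

lemma
  assumes "0 \<le> s" "s \<le> t"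
  shows increment_exp_integrable: "integrable M (\<lambda>\<omega>. exp (\<alpha> * (W t \<omega> - W s \<omega>)))"
    and increment_exp_expectation:
      "expectation (\<lambda>\<omega>. exp (\<alpha> * (W t \<omega> - W s \<omega>))) = exp (\<alpha>\<^sup>2 * (t - s) / 2)"
  using assms increment_tilted_integrable[of s t "\<lambda>_. 1" \<alpha>]
    increment_tilted_expectation[of s t "\<lambda>_. 1" \<alpha>]
  by (cases "s = t"; simp add: prob_space)+

lemma
  assumes "0 \<le> s" "s \<le> t"
  shows increment_exp_mult_integrable:
      "integrable M (\<lambda>\<omega>. exp (\<alpha> * (W t \<omega> - W s \<omega>)) * (W t \<omega> - W s \<omega>))"
    and increment_exp_mult_expectation:
      "expectation (\<lambda>\<omega>. exp (\<alpha> * (W t \<omega> - W s \<omega>)) * (W t \<omega> - W s \<omega>))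
        = exp (\<alpha>\<^sup>2 * (t - s) / 2) * (\<alpha> * (t - s))"
  using assms increment_tilted_integrable[of s t "\<lambda>x. x" \<alpha>]
    increment_tilted_expectation[of s t "\<lambda>x. x" \<alpha>]
    integrable_normal_moment_nz_1[of "sqrt (t - s)" "\<alpha> * (t - s)"]
    integral_normal_moment_nz_1[of "sqrt (t - s)" "\<alpha> * (t - s)"]
  by (cases "s = t"; simp add: less_le)+

lemma
  assumes "0 \<le> s" "s \<le> t"
  shows square_integrable_increment: "square_integrable M (\<lambda>\<omega>. W t \<omega> - W s \<omega>)"
    and increment_square_expectation: "expectation (\<lambda>\<omega>. (W t \<omega> - W s \<omega>)\<^sup>2) = t - s"
  using assms increment_tilted_integrable[of s t "\<lambda>x. x\<^sup>2" 0]
    increment_tilted_expectation[of s t "\<lambda>x. x\<^sup>2" 0]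
    integrable_normal_moment[of "sqrt (t - s)" 0 2]
    integral_normal_moment_even[of "sqrt (t - s)" 0 1]
  by (cases "s = t"; simp add: square_integrable_def less_le fact_numeral)+

lemma increment_expectation:
  assumes "0 \<le> s" "s \<le> t"
  shows "expectation (\<lambda>\<omega>. W t \<omega> - W s \<omega>) = 0"
  using increment_exp_mult_expectation[OF assms, of 0] by simp

subsection \<open>Exponential martingales\<close>

definition exp_martingale :: "real \<Rightarrow> real \<Rightarrow> 'a \<Rightarrow> real" where
  "exp_martingale \<alpha> t \<omega> = exp (\<alpha> * continuous_version W t \<omega> - \<alpha>\<^sup>2 * t / 2)"

lemma exp_martingale_pos [simp]:
  "0 < exp_martingale \<alpha> t \<omega>" "0 \<le> exp_martingale \<alpha> t \<omega>"
  "\<bar>exp_martingale \<alpha> t \<omega>\<bar> = exp_martingale \<alpha> t \<omega>"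
  by (auto simp: exp_martingale_def)

lemma exp_martingale_0 [simp]: "exp_martingale 0 t \<omega> = 1"
  by (simp add: exp_martingale_def)

lemma exp_martingale_times:
  "exp_martingale \<alpha> t \<omega> * exp_martingale \<beta> t \<omega> = exp (\<alpha> * \<beta> * t) * exp_martingale (\<alpha> + \<beta>) t \<omega>"
  by (simp add: exp_martingale_def exp_add[symmetric] algebra_simps power2_eq_square
    add_divide_distrib)

lemma exp_martingale_measurable_F: "0 \<le> t \<Longrightarrow> exp_martingale \<alpha> t \<in> borel_measurable (F t)"
  using adapted_continuous_version[OF W_adapted W_continuous]
  by (auto simp: exp_martingale_def[abs_def] adapted_def)

lemma exp_martingale_measurable [measurable]: "0 \<le> t \<Longrightarrow> exp_martingale \<alpha> t \<in> borel_measurable M"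
  using exp_martingale_measurable_F measurable_F_imp_M by blast

lemma measurable_process_exp_martingale: "measurable_process M (exp_martingale \<alpha>)"
  by (intro measurable_process_continuous exp_martingale_measurable)
    (auto simp: exp_martingale_def intro!: continuous_intros continuous_on_continuous_version)

lemma AE_exp_martingale_increment:
  "AE \<omega> in M. exp_martingale \<alpha> t \<omega>
    = exp_martingale \<alpha> s \<omega> * (exp (\<alpha> * (W t \<omega> - W s \<omega>)) * exp (- \<alpha>\<^sup>2 * (t - s) / 2))"
  using AE_continuous_version[OF W_continuous]
  by eventually_elim
    (simp add: exp_martingale_def exp_add[symmetric] algebra_simps diff_divide_distrib)

lemma
  assumes st: "0 \<le> s" "s \<le> t" and Y: "Y \<in> borel_measurable (F s)"
    and int: "integrable M (\<lambda>\<omega>. exp_martingale \<alpha> s \<omega> * Y \<omega>)"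
    and g [measurable]: "g \<in> borel_measurable borel"
    and tilted: "integrable M (\<lambda>\<omega>. exp (\<alpha> * (W t \<omega> - W s \<omega>)) * g (W t \<omega> - W s \<omega>))"
  shows exp_martingale_increment_integrable:
      "integrable M (\<lambda>\<omega>. exp_martingale \<alpha> t \<omega> * (Y \<omega> * g (W t \<omega> - W s \<omega>)))"
    and exp_martingale_increment_expectation:
      "expectation (\<lambda>\<omega>. exp_martingale \<alpha> t \<omega> * (Y \<omega> * g (W t \<omega> - W s \<omega>)))
        = expectation (\<lambda>\<omega>. exp_martingale \<alpha> s \<omega> * Y \<omega>)
          * (expectation (\<lambda>\<omega>. exp (\<alpha> * (W t \<omega> - W s \<omega>)) * g (W t \<omega> - W s \<omega>)) * exp (- \<alpha>\<^sup>2 * (t - s) / 2))"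
proof -
  let ?h = "\<lambda>x. exp (\<alpha> * x) * g x * exp (- \<alpha>\<^sup>2 * (t - s) / 2)"
  let ?MY = "\<lambda>\<omega>. exp_martingale \<alpha> s \<omega> * Y \<omega>"
  have MY_measurable: "?MY \<in> borel_measurable (F s)"
    using exp_martingale_measurable_F[OF st(1)] Y by measurable
  have h_measurable: "?h \<in> borel_measurable borel" by measurable
  have h_integrable: "integrable M (\<lambda>\<omega>. ?h (W t \<omega> - W s \<omega>))" using tilted by simp
  note product = integrable_mult_increment[OF st MY_measurable h_measurable int h_integrable]
  have [measurable]: "Y \<in> borel_measurable M" by (rule measurable_F_imp_M[OF st(1) Y])
  have meas: "(\<lambda>\<omega>. exp_martingale \<alpha> t \<omega> * (Y \<omega> * g (W t \<omega> - W s \<omega>))) \<in> borel_measurable M"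
    using st order_trans[OF st] by measurable
  have eq: "AE \<omega> in M. ?MY \<omega> * ?h (W t \<omega> - W s \<omega>)
      = exp_martingale \<alpha> t \<omega> * (Y \<omega> * g (W t \<omega> - W s \<omega>))"
    using AE_exp_martingale_increment[of \<alpha> t s] by eventually_elim (simp add: mult_ac)
  show "integrable M (\<lambda>\<omega>. exp_martingale \<alpha> t \<omega> * (Y \<omega> * g (W t \<omega> - W s \<omega>)))"
    using integrable_cong_AE[OF borel_measurable_integrable[OF product] meas eq] product by simp
  show "expectation (\<lambda>\<omega>. exp_martingale \<alpha> t \<omega> * (Y \<omega> * g (W t \<omega> - W s \<omega>)))
      = expectation ?MY * (expectation (\<lambda>\<omega>. exp (\<alpha> * (W t \<omega> - W s \<omega>)) * g (W t \<omega> - W s \<omega>))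
        * exp (- \<alpha>\<^sup>2 * (t - s) / 2))"
    using integral_cong_AE[OF borel_measurable_integrable[OF product] meas eq]
      expectation_mult_increment[OF st MY_measurable h_measurable int h_integrable] by simp
qed

lemma
  assumes st: "0 \<le> s" "s \<le> t" and Y: "Y \<in> borel_measurable (F s)"
    and int: "integrable M (\<lambda>\<omega>. exp_martingale \<alpha> s \<omega> * Y \<omega>)"
  shows exp_martingale_mult_integrable: "integrable M (\<lambda>\<omega>. exp_martingale \<alpha> t \<omega> * Y \<omega>)"
    and exp_martingale_mult_expectation:
      "expectation (\<lambda>\<omega>. exp_martingale \<alpha> t \<omega> * Y \<omega>) = expectation (\<lambda>\<omega>. exp_martingale \<alpha> s \<omega> * Y \<omega>)"
    and exp_martingale_mult_increment_expectation:
      "expectation (\<lambda>\<omega>. exp_martingale \<alpha> t \<omega> * (Y \<omega> * (W t \<omega> - W s \<omega>)))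
        = expectation (\<lambda>\<omega>. exp_martingale \<alpha> s \<omega> * Y \<omega>) * (\<alpha> * (t - s))"
  using exp_martingale_increment_integrable[OF assms, of "\<lambda>_. 1"]
    exp_martingale_increment_expectation[OF assms, of "\<lambda>_. 1"]
    exp_martingale_increment_expectation[OF assms, of "\<lambda>x. x"]
    increment_exp_integrable[OF st, of \<alpha>] increment_exp_expectation[OF st, of \<alpha>]
    increment_exp_mult_integrable[OF st, of \<alpha>] increment_exp_mult_expectation[OF st, of \<alpha>]
  by (simp_all add: exp_minus)

lemma exp_martingale_mult_nn_integral:
  assumes st: "0 \<le> s" "s \<le> t" and Y: "Y \<in> borel_measurable (F s)"
  shows "(\<integral>\<^sup>+\<omega>. ennreal (exp_martingale \<alpha> t \<omega>) * Y \<omega> \<partial>M)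
      = (\<integral>\<^sup>+\<omega>. ennreal (exp_martingale \<alpha> s \<omega>) * Y \<omega> \<partial>M)"
proof -
  let ?h = "\<lambda>x. ennreal (exp (\<alpha> * x) * exp (- \<alpha>\<^sup>2 * (t - s) / 2))"
  let ?MY = "\<lambda>\<omega>. ennreal (exp_martingale \<alpha> s \<omega>) * Y \<omega>"
  have MY_measurable: "?MY \<in> borel_measurable (F s)"
    using exp_martingale_measurable_F[OF st(1)] Y by measurable
  have h_measurable: "?h \<in> borel_measurable borel" by measurable
  have h_integral: "(\<integral>\<^sup>+\<omega>. ?h (W t \<omega> - W s \<omega>) \<partial>M) = 1"
    using increment_exp_integrable[OF st, of \<alpha>] increment_exp_expectation[OF st, of \<alpha>]
    by (subst nn_integral_eq_integral) (auto simp: exp_minus)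
  have "(\<integral>\<^sup>+\<omega>. ennreal (exp_martingale \<alpha> t \<omega>) * Y \<omega> \<partial>M) = (\<integral>\<^sup>+\<omega>. ?MY \<omega> * ?h (W t \<omega> - W s \<omega>) \<partial>M)"
    using AE_exp_martingale_increment[of \<alpha> t s]
    by (intro nn_integral_cong_AE, eventually_elim) (simp add: ennreal_mult mult_ac)
  also have "\<dots> = (\<integral>\<^sup>+\<omega>. ?MY \<omega> \<partial>M)"
    by (subst indep_var_nn_integral_mult[OF increment_indep_var[OF st MY_measurable h_measurable]])
      (simp only: h_integral mult_1_right)
  finally show ?thesis .
qed

lemma
  assumes t: "0 \<le> t"
  shows exp_martingale_integrable: "integrable M (exp_martingale \<alpha> t)"
    and exp_martingale_expectation: "expectation (exp_martingale \<alpha> t) = 1"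
proof -
  have start: "AE \<omega> in M. 1 = exp_martingale \<alpha> 0 \<omega> * 1"
    using AE_continuous_version[OF W_continuous] W_zero
    by eventually_elim (simp add: exp_martingale_def)
  have "integrable M (\<lambda>\<omega>. exp_martingale \<alpha> 0 \<omega> * 1)"
    using integrable_cong_AE[THEN iffD1, OF _ _ start] by auto
  moreover have "expectation (\<lambda>\<omega>. exp_martingale \<alpha> 0 \<omega> * 1) = 1"
    using integral_cong_AE[OF _ _ start] by (simp add: prob_space)
  ultimately show "integrable M (exp_martingale \<alpha> t)" "expectation (exp_martingale \<alpha> t) = 1"
    using exp_martingale_mult_integrable[OF order_refl t, of "\<lambda>_. 1" \<alpha>]
      exp_martingale_mult_expectation[OF order_refl t, of "\<lambda>_. 1" \<alpha>] by simp_all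
qed

lemma
  assumes t: "0 \<le> t"
  shows exp_martingale_square_integrable: "square_integrable M (exp_martingale \<alpha> t)"
    and exp_martingale_square_expectation:
      "expectation (\<lambda>\<omega>. (exp_martingale \<alpha> t \<omega>)\<^sup>2) = exp (\<alpha>\<^sup>2 * t)"
proof -
  have "(exp_martingale \<alpha> t \<omega>)\<^sup>2 = exp (\<alpha>\<^sup>2 * t) * exp_martingale (2 * \<alpha>) t \<omega>" for \<omega>
    using exp_martingale_times[of \<alpha> t \<omega> \<alpha>] by (simp add: power2_eq_square)
  then show "square_integrable M (exp_martingale \<alpha> t)"
    "expectation (\<lambda>\<omega>. (exp_martingale \<alpha> t \<omega>)\<^sup>2) = exp (\<alpha>\<^sup>2 * t)"
    using t exp_martingale_integrable[OF t, of "2 * \<alpha>"] exp_martingale_expectation[OF t, of "2 * \<alpha>"]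
    by (simp_all add: square_integrable_def)
qed

lemma exp_martingale_square_integrable_prod:
  "square_integrable (prod_upto T) (\<lambda>(\<omega>, t). exp_martingale \<alpha> t \<omega>)"
  by (rule square_integrable_processI[OF measurable_process_exp_martingale, where C = "exp (\<alpha>\<^sup>2 * T)"])
    (auto simp: exp_martingale_square_integrable exp_martingale_square_expectation mult_left_mono)

subsection \<open>The Ito isometry and the Girsanov identity\<close>

lemma expectation_mult_increment_eq_0:
  assumes "0 \<le> c" "c \<le> d" "Y \<in> borel_measurable (F c)" "integrable M Y"
  shows "expectation (\<lambda>\<omega>. Y \<omega> * (W d \<omega> - W c \<omega>)) = 0"
  using expectation_mult_increment[OF assms(1-3) _ assms(4), of "\<lambda>x. x"]
    square_integrable_integrable[OF square_integrable_increment[OF assms(1,2)]]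
    increment_expectation[OF assms(1,2)] by simp

lemma expectation_increments_disjoint:
  assumes ab: "0 \<le> a" "a \<le> b" and cd: "b \<le> c" "c \<le> d" and Y: "bounded_measurable c Y"
  shows "expectation (\<lambda>\<omega>. Y \<omega> * ((W b \<omega> - W a \<omega>) * (W d \<omega> - W c \<omega>))) = 0"
proof -
  have "integrable M (\<lambda>\<omega>. Y \<omega> * (W b \<omega> - W a \<omega>))"
    using assms by (intro square_integrable_integrable
        bounded_measurable_mult_square_integrable[OF _ Y] square_integrable_increment) auto
  moreover have "(\<lambda>\<omega>. Y \<omega> * (W b \<omega> - W a \<omega>)) \<in> borel_measurable (F c)"
    using assms W_measurable_F[of a c] W_measurable_F[of b c] by (auto simp: bounded_measurable_def)
  ultimately show ?thesis
    using expectation_mult_increment_eq_0[OF _ cd(2), of "\<lambda>\<omega>. Y \<omega> * (W b \<omega> - W a \<omega>)"] ab cd(1)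
    by (simp add: mult.assoc)
qed

lemma expectation_increment_square:
  assumes cm: "0 \<le> c" "c \<le> m" and Y: "bounded_measurable c Y"
  shows "expectation (\<lambda>\<omega>. Y \<omega> * (W m \<omega> - W c \<omega>)\<^sup>2) = expectation Y * (m - c)"
  using expectation_mult_increment[OF cm, of Y "\<lambda>x. x\<^sup>2"] Y
    square_integrable_integrable[OF bounded_measurable_square_integrable[OF cm(1) Y]]
    square_integrableD(2)[OF square_integrable_increment[OF cm]] increment_square_expectation[OF cm]
  by (simp add: bounded_measurable_def)

text \<open>Both increments are split at \<open>c\<close> and at \<open>m = min b d\<close>; only \<open>W\<^sub>m - W\<^sub>c\<close> is common to them.\<close>

lemma expectation_increments_ordered:
  assumes ab: "0 \<le> a" "a \<le> b" and cd: "a \<le> c" "c \<le> d" and Y: "bounded_measurable c Y"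
  shows "expectation (\<lambda>\<omega>. Y \<omega> * ((W b \<omega> - W a \<omega>) * (W d \<omega> - W c \<omega>)))
    = expectation Y * max 0 (min b d - c)"
proof (cases "b \<le> c")
  case True
  then show ?thesis using expectation_increments_disjoint[OF ab True cd(2) Y] cd by simp
next
  case False
  define m where "m = min b d"
  let ?E = "\<lambda>p q p' q' \<omega>. Y \<omega> * ((W q \<omega> - W p \<omega>) * (W q' \<omega> - W p' \<omega>))"
  have m: "c \<le> m" "m \<le> b" "m \<le> d" and c: "0 \<le> c" using False ab cd by (auto simp: m_def)
  have Y_m: "bounded_measurable m Y" by (rule bounded_measurable_mono[OF c m(1) Y])
  have int: "integrable M (?E p q p' q')" if "0 \<le> p" "p \<le> q" "0 \<le> p'" "p' \<le> q'" for p q p' q'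
    using square_integrable_mult_integrable[OF
        bounded_measurable_mult_square_integrable[OF c Y square_integrable_increment[OF that(1,2)]]
        square_integrable_increment[OF that(3,4)]] by (simp add: mult.assoc)
  have "?E a b c d \<omega> = (?E a c c d \<omega> + ?E c m c m \<omega>) + (?E c m m d \<omega> + ?E c m m b \<omega>)" for \<omega>
    by (cases "b \<le> d") (auto simp: m_def min_def algebra_simps)
  then have "expectation (?E a b c d) = (expectation (?E a c c d) + expectation (?E c m c m))
      + (expectation (?E c m m d) + expectation (?E c m m b))"
    using ab cd m c by (simp add: int)
  also have "expectation (?E c m c m) = expectation Y * (m - c)"
    using expectation_increment_square[OF c m(1) Y] by (simp add: power2_eq_square)
  finally show ?thesis
    using False m cd expectation_increments_disjoint[OF ab(1) cd(1) order_refl cd(2) Y]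
      expectation_increments_disjoint[OF c m(1) order_refl m(3) Y_m]
      expectation_increments_disjoint[OF c m(1) order_refl m(2) Y_m] by (simp add: m_def)
qed

lemma expectation_increments:
  assumes ab: "0 \<le> a" "a \<le> b" and cd: "0 \<le> c" "c \<le> d" and Y: "bounded_measurable (max a c) Y"
  shows "expectation (\<lambda>\<omega>. Y \<omega> * ((W b \<omega> - W a \<omega>) * (W d \<omega> - W c \<omega>)))
    = expectation Y * max 0 (min b d - max a c)"
proof (cases "a \<le> c")
  case True
  then show ?thesis using expectation_increments_ordered[OF ab True cd(2)] Y by (simp add: max_def)
next
  case False
  then show ?thesis using expectation_increments_ordered[OF cd _ ab(2), of Y] Y
    by (simp add: max_def min.commute mult.commute)
qed

lemma square_integrable_step:
  assumes step: "step_integrand M F n u \<xi>" and t: "0 \<le> t"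
  shows "square_integrable M (step_integral W n u \<xi> t)"
    and "square_integrable (prod_upto T) (\<lambda>(\<omega>, v). step_process n u \<xi> v \<omega>)"
proof -
  note u = step_integrandD[OF step]
  show "square_integrable M (step_integral W n u \<xi> t)"
    unfolding step_integral_def
    by (intro square_integrable_sum bounded_measurable_mult_square_integrable[OF u(1,3)]
        square_integrable_increment) (use t u in \<open>auto simp: min.coboundedI2 min_le_iff_disj\<close>)
  have "square_integrable (prod_upto T)
      (\<lambda>p. \<Sum>i<n. case p of (\<omega>, v) \<Rightarrow> \<xi> i \<omega> * indicator {u i<..u (Suc i)} v)"
    using u by (intro square_integrable_sum square_integrable_elementary) auto
  then show "square_integrable (prod_upto T) (\<lambda>(\<omega>, v). step_process n u \<xi> v \<omega>)"
    by (simp add: step_process_def split_beta')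
qed

text \<open>The isometry and the Girsanov identity both express an expectation \<open>E[Y I\<^sub>t]\<close> as a \<open>\<P> \<otimes> dt\<close>
  integral against the integrand. By linearity and \<open>L\<^sup>2\<close> continuity such a pairing only has to be
  checked on elementary integrands \<open>\<xi> 1\<^bsub>(a, b]\<^esub>\<close>.\<close>

context
  fixes Y :: "'a \<Rightarrow> real" and K :: "real \<Rightarrow> 'a \<Rightarrow> real" and t :: real
  assumes t: "0 \<le> t" and Y: "square_integrable M Y"
    and K: "square_integrable (prod_upto t) (\<lambda>(\<omega>, v). K v \<omega>)"
    and elementary: "\<And>a b \<xi>. 0 \<le> a \<Longrightarrow> a \<le> b \<Longrightarrow> b \<le> t \<Longrightarrow> bounded_measurable a \<xi> \<Longrightarrow>
      expectation (\<lambda>\<omega>. Y \<omega> * (\<xi> \<omega> * (W b \<omega> - W a \<omega>)))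
        = (\<integral>(\<omega>, v). K v \<omega> * (\<xi> \<omega> * indicator {a<..b} v) \<partial>prod_upto t)"
begin

lemma elementary_pairing_stopped:
  assumes ab: "0 \<le> a" "a \<le> b" and \<xi>: "bounded_measurable a \<xi>"
  shows "expectation (\<lambda>\<omega>. Y \<omega> * (\<xi> \<omega> * (W (min t b) \<omega> - W (min t a) \<omega>)))
    = (\<integral>(\<omega>, v). K v \<omega> * (\<xi> \<omega> * indicator {a<..b} v) \<partial>prod_upto t)"
proof (cases "a \<le> t")
  case True
  have "(\<integral>(\<omega>, v). K v \<omega> * (\<xi> \<omega> * indicator {a<..min t b} v) \<partial>prod_upto t)
      = (\<integral>(\<omega>, v). K v \<omega> * (\<xi> \<omega> * indicator {a<..b} v) \<partial>prod_upto t)"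
    by (intro Bochner_Integration.integral_cong) (auto simp: indicator_def space_pair_measure)
  then show ?thesis
    using elementary[OF ab(1) _ _ \<xi>, of "min t b"] True ab by (simp add: min_absorb2)
next
  case False
  have "(\<integral>(\<omega>, v). K v \<omega> * (\<xi> \<omega> * indicator {a<..b} v) \<partial>prod_upto t) = (\<integral>p. 0 \<partial>prod_upto t)"
    using False
    by (intro Bochner_Integration.integral_cong) (auto simp: indicator_def space_pair_measure)
  then show ?thesis using False ab by simp
qed

lemma step_pairing:
  assumes step: "step_integrand M F n u \<xi>"
  shows "expectation (\<lambda>\<omega>. Y \<omega> * step_integral W n u \<xi> t \<omega>)
    = (\<integral>(\<omega>, v). K v \<omega> * step_process n u \<xi> v \<omega> \<partial>prod_upto t)"
proof -
  note u = step_integrandD[OF step]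
  let ?S = "\<lambda>i \<omega>. Y \<omega> * (\<xi> i \<omega> * (W (min t (u (Suc i))) \<omega> - W (min t (u i)) \<omega>))"
  let ?s = "\<lambda>i (\<omega>, v). K v \<omega> * (\<xi> i \<omega> * indicator {u i<..u (Suc i)} v)"
  have integral_term: "integrable M (?S i)" if "i < n" for i
    using t u[OF that]
    by (intro square_integrable_mult_integrable[OF Y] square_integrable_increment
        bounded_measurable_mult_square_integrable[OF u(1,3)[OF that]]) (auto simp: min_le_iff_disj)
  have process_term: "integrable (prod_upto t) (?s i)" if "i < n" for i
    using square_integrable_mult_integrable[OF K
      square_integrable_elementary[OF u(1,3)[OF that], of t "u (Suc i)"]]
    by (simp add: split_beta')
  have "expectation (\<lambda>\<omega>. Y \<omega> * step_integral W n u \<xi> t \<omega>) = (\<Sum>i<n. expectation (?S i))"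
    using integral_term by (simp add: step_integral_def sum_distrib_left)
  also have "\<dots> = (\<Sum>i<n. \<integral>p. ?s i p \<partial>prod_upto t)"
    by (intro sum.cong refl elementary_pairing_stopped u) auto
  also have "\<dots> = (\<integral>p. (\<Sum>i<n. ?s i p) \<partial>prod_upto t)"
    using process_term by simp
  also have "\<dots> = (\<integral>(\<omega>, v). K v \<omega> * step_process n u \<xi> v \<omega> \<partial>prod_upto t)"
    by (intro Bochner_Integration.integral_cong refl)
      (simp only: step_process_def sum_distrib_left split_beta')
  finally show ?thesis .
qed

end

lemma ito_integral_L2_approx:
  assumes ito: "ito_integral_L2 M F W H I" and t: "0 \<le> t"
  obtains n u \<xi> where "\<And>k. step_integrand M F (n k) (u k) (\<xi> k)"
    and "L2_tendsto (prod_upto t) (\<lambda>k (\<omega>, v). step_process (n k) (u k) (\<xi> k) v \<omega>) (\<lambda>(\<omega>, v). H v \<omega>)"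
    and "L2_tendsto M (\<lambda>k. step_integral W (n k) (u k) (\<xi> k) t) (I t)"
proof -
  from ito t obtain n u \<xi> where step: "\<And>k. step_integrand M F (n k) (u k) (\<xi> k)"
    and process: "(\<lambda>k. \<integral>\<^sup>+\<omega>. (\<integral>\<^sup>+v\<in>{0..t}.
      ennreal ((step_process (n k) (u k) (\<xi> k) v \<omega> - H v \<omega>)\<^sup>2) \<partial>lborel) \<partial>M) \<longlonglongrightarrow> 0"
    and integral: "L2_tendsto M (\<lambda>k. step_integral W (n k) (u k) (\<xi> k) t) (I t)"
    unfolding ito_integral_L2_def L2_tendsto_def by meson
  have "(\<lambda>(\<omega>, v). H v \<omega>) \<in> borel_measurable (prod_upto t)"
    using ito by (auto simp: ito_integral_L2_def L2_loc_def intro: measurable_process_upto)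
  note [measurable] = this square_integrableD(1)[OF square_integrable_step(2)[OF step t]]
  have "(\<integral>\<^sup>+\<omega>. (\<integral>\<^sup>+v\<in>{0..t}. ennreal ((step_process (n k) (u k) (\<xi> k) v \<omega> - H v \<omega>)\<^sup>2) \<partial>lborel) \<partial>M)
      = (\<integral>\<^sup>+p. ennreal (((\<lambda>(\<omega>, v). step_process (n k) (u k) (\<xi> k) v \<omega>) p - (\<lambda>(\<omega>, v). H v \<omega>) p)\<^sup>2)
        \<partial>prod_upto t)" for k
    unfolding set_nn_integral_upto by (subst lborel_upto.nn_integral_fst[symmetric]) auto
  with process show ?thesis by (intro that[OF step _ integral]) (simp only: L2_tendsto_def)
qed

lemma
  assumes ito: "ito_integral_L2 M F W H I" and t: "0 \<le> t"
  shows ito_square_integrable: "square_integrable M (I t)"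
    and ito_integrand_square_integrable: "square_integrable (prod_upto t) (\<lambda>(\<omega>, v). H v \<omega>)"
    and ito_pairing: "square_integrable M Y \<Longrightarrow> square_integrable (prod_upto t) (\<lambda>(\<omega>, v). K v \<omega>) \<Longrightarrow>
      (\<And>a b \<xi>. 0 \<le> a \<Longrightarrow> a \<le> b \<Longrightarrow> b \<le> t \<Longrightarrow> bounded_measurable a \<xi> \<Longrightarrow>
        expectation (\<lambda>\<omega>. Y \<omega> * (\<xi> \<omega> * (W b \<omega> - W a \<omega>)))
          = (\<integral>(\<omega>, v). K v \<omega> * (\<xi> \<omega> * indicator {a<..b} v) \<partial>prod_upto t)) \<Longrightarrow>
      expectation (\<lambda>\<omega>. Y \<omega> * I t \<omega>) = (\<integral>(\<omega>, v). K v \<omega> * H v \<omega> \<partial>prod_upto t)"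
proof -
  obtain n u \<xi> where step: "\<And>k. step_integrand M F (n k) (u k) (\<xi> k)"
    and process: "L2_tendsto (prod_upto t) (\<lambda>k (\<omega>, v). step_process (n k) (u k) (\<xi> k) v \<omega>) (\<lambda>(\<omega>, v). H v \<omega>)"
    and integral: "L2_tendsto M (\<lambda>k. step_integral W (n k) (u k) (\<xi> k) t) (I t)"
    by (fact ito_integral_L2_approx[OF ito t])
  have H: "(\<lambda>(\<omega>, v). H v \<omega>) \<in> borel_measurable (prod_upto t)" and I: "I t \<in> borel_measurable M"
    using ito t by (auto simp: ito_integral_L2_def L2_loc_def adapted_def
        intro: measurable_process_upto measurable_F_imp_M)
  note integral_limit = square_integrable_step(1)[OF step t] I integral
    and process_limit = square_integrable_step(2)[OF step t] H process
  show "square_integrable M (I t)" by (rule square_integrable_L2_limit[OF integral_limit])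
  show "square_integrable (prod_upto t) (\<lambda>(\<omega>, v). H v \<omega>)"
    by (rule square_integrable_L2_limit[OF process_limit])
  assume Y: "square_integrable M Y" and K: "square_integrable (prod_upto t) (\<lambda>(\<omega>, v). K v \<omega>)"
    and elementary: "\<And>a b \<xi>. 0 \<le> a \<Longrightarrow> a \<le> b \<Longrightarrow> b \<le> t \<Longrightarrow> bounded_measurable a \<xi> \<Longrightarrow>
        expectation (\<lambda>\<omega>. Y \<omega> * (\<xi> \<omega> * (W b \<omega> - W a \<omega>)))
          = (\<integral>(\<omega>, v). K v \<omega> * (\<xi> \<omega> * indicator {a<..b} v) \<partial>prod_upto t)"
  show "expectation (\<lambda>\<omega>. Y \<omega> * I t \<omega>) = (\<integral>(\<omega>, v). K v \<omega> * H v \<omega> \<partial>prod_upto t)"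
  proof (rule LIMSEQ_unique[OF tendsto_integral_mult_L2[OF integral_limit Y]])
    show "(\<lambda>k. expectation (\<lambda>\<omega>. Y \<omega> * step_integral W (n k) (u k) (\<xi> k) t \<omega>))
        \<longlonglongrightarrow> (\<integral>(\<omega>, v). K v \<omega> * H v \<omega> \<partial>prod_upto t)"
      using tendsto_integral_mult_L2[OF process_limit K]
      by (subst step_pairing[OF t Y K elementary step]) (simp_all add: split_beta')
  qed
qed

lemma elementary_isometry:
  assumes ab: "0 \<le> a" "a \<le> b" "b \<le> T" and cd: "0 \<le> c" "c \<le> d"
    and \<xi>: "bounded_measurable a \<xi>" and \<eta>: "bounded_measurable c \<eta>"
  shows "expectation (\<lambda>\<omega>. (\<eta> \<omega> * (W d \<omega> - W c \<omega>)) * (\<xi> \<omega> * (W b \<omega> - W a \<omega>)))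
    = (\<integral>(\<omega>, v). (\<eta> \<omega> * indicator {c<..d} v) * (\<xi> \<omega> * indicator {a<..b} v) \<partial>prod_upto T)"
proof -
  have Y: "bounded_measurable (max a c) (\<lambda>\<omega>. \<xi> \<omega> * \<eta> \<omega>)"
    using ab cd \<xi> \<eta> by (intro bounded_measurable_mult) (auto intro: bounded_measurable_mono)
  have "(\<integral>(\<omega>, v). (\<eta> \<omega> * indicator {c<..d} v) * (\<xi> \<omega> * indicator {a<..b} v) \<partial>prod_upto T)
      = (\<integral>(\<omega>, v). (\<xi> \<omega> * \<eta> \<omega>) * indicator {max a c<..min b d} v \<partial>prod_upto T)"
    by (intro Bochner_Integration.integral_cong) (auto simp: indicator_def)
  also have "\<dots> = expectation (\<lambda>\<omega>. \<xi> \<omega> * \<eta> \<omega>) * (\<integral>v. indicator {max a c<..min b d} v \<partial>lborel_upto T)"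
    using ab square_integrable_integrable[OF bounded_measurable_square_integrable[OF _ Y]]
    by (intro upto.integral_times lborel_upto.integrable_const_bound[where B = 1]
      measurable_lborel_upto)
      (auto simp: indicator_def)
  also have "(\<integral>v. indicator {max a c<..min b d} v \<partial>lborel_upto T)
      = max 0 (min T (min b d) - max a c)"
    using ab by (intro integral_upto_indicator_Ioc) simp
  also have "min T (min b d) = min b d" using ab by (simp add: min_absorb2 min.coboundedI1)
  also have "expectation (\<lambda>\<omega>. \<xi> \<omega> * \<eta> \<omega>) * max 0 (min b d - max a c)
      = expectation (\<lambda>\<omega>. (\<xi> \<omega> * \<eta> \<omega>) * ((W b \<omega> - W a \<omega>) * (W d \<omega> - W c \<omega>)))"
    using expectation_increments[OF ab(1,2) cd Y] by simp
  finally show ?thesis by (simp add: mult_ac)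
qed

lemma ito_isometry_elementary:
  assumes ito: "ito_integral_L2 M F W H I" and s: "0 \<le> s"
    and cd: "0 \<le> c" "c \<le> d" and \<eta>: "bounded_measurable c \<eta>"
  shows "expectation (\<lambda>\<omega>. (\<eta> \<omega> * (W d \<omega> - W c \<omega>)) * I s \<omega>)
    = (\<integral>(\<omega>, v). (\<eta> \<omega> * indicator {c<..d} v) * H v \<omega> \<partial>prod_upto s)"
  using assms
  by (intro ito_pairing[OF ito s] elementary_isometry
    bounded_measurable_mult_square_integrable[OF cd(1) \<eta>]
      square_integrable_increment square_integrable_elementary)

lemma ito_isometry:
  assumes ito: "ito_integral_L2 M F W H I" and s: "0 \<le> s" "s \<le> t"
  shows "expectation (\<lambda>\<omega>. I s \<omega> * I t \<omega>) = (\<integral>v. expectation (\<lambda>\<omega>. (H v \<omega>)\<^sup>2) \<partial>lborel_upto s)"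
proof -
  have t: "0 \<le> t" using s by simp
  note Hs = ito_integrand_square_integrable[OF ito s(1)]
    and Ht = ito_integrand_square_integrable[OF ito t]
  let ?K = "\<lambda>v \<omega>. indicator {..s} v * H v \<omega>"
  have "(\<lambda>p. indicator {..s} (snd p)) \<in> borel_measurable (prod_upto t)" by measurable
  from square_integrable_bounded_mult[OF Ht this, of 1]
  have K: "square_integrable (prod_upto t) (\<lambda>(\<omega>, v). ?K v \<omega>)"
    by (simp add: split_beta' indicator_def)
  have "expectation (\<lambda>\<omega>. I s \<omega> * I t \<omega>) = (\<integral>(\<omega>, v). ?K v \<omega> * H v \<omega> \<partial>prod_upto t)"
  proof (rule ito_pairing[OF ito t ito_square_integrable[OF ito s(1)] K])
    fix a b \<xi> assume ab: "0 \<le> a" "a \<le> b" "b \<le> t" and \<xi>: "bounded_measurable a \<xi>"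
    note elem = square_integrable_elementary[OF ab(1) \<xi>]
    have "expectation (\<lambda>\<omega>. I s \<omega> * (\<xi> \<omega> * (W b \<omega> - W a \<omega>)))
        = (\<integral>(\<omega>, v). (\<xi> \<omega> * indicator {a<..b} v) * H v \<omega> \<partial>prod_upto s)"
      using ito_isometry_elementary[OF ito s(1) ab(1,2) \<xi>] by (simp add: mult.commute)
    also have "\<dots> = (\<integral>(\<omega>, v). indicator {..s} v * ((\<xi> \<omega> * indicator {a<..b} v) * H v \<omega>) \<partial>prod_upto t)"
      using square_integrable_mult_integrable[OF elem Hs]
        square_integrable_mult_integrable[OF elem K]
      by (intro integral_prod_upto_eq_indicator[OF s(2)]) (auto simp: split_beta' mult_ac)
    finally show "expectation (\<lambda>\<omega>. I s \<omega> * (\<xi> \<omega> * (W b \<omega> - W a \<omega>)))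
        = (\<integral>(\<omega>, v). ?K v \<omega> * (\<xi> \<omega> * indicator {a<..b} v) \<partial>prod_upto t)"
      by (simp add: mult_ac)
  qed
  also have "\<dots> = (\<integral>(\<omega>, v). (H v \<omega>)\<^sup>2 \<partial>prod_upto s)"
    using square_integrableD(2)[OF Hs] square_integrable_mult_integrable[OF Ht K]
    by (subst integral_prod_upto_eq_indicator[OF s(2)])
      (auto simp: split_beta' power2_eq_square mult_ac)
  also have "\<dots> = (\<integral>v. expectation (\<lambda>\<omega>. (H v \<omega>)\<^sup>2) \<partial>lborel_upto s)"
    using square_integrableD(2)[OF Hs]
    by (subst upto.integral_snd[symmetric]) (auto simp: split_beta')
  finally show ?thesis .
qed

lemma elementary_girsanov:
  assumes ab: "0 \<le> a" "a \<le> b" "b \<le> T" and \<xi>: "bounded_measurable a \<xi>"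
  shows "expectation (\<lambda>\<omega>. exp_martingale \<alpha> T \<omega> * (\<xi> \<omega> * (W b \<omega> - W a \<omega>)))
    = (\<integral>(\<omega>, v). (\<alpha> * exp_martingale \<alpha> v \<omega>) * (\<xi> \<omega> * indicator {a<..b} v) \<partial>prod_upto T)"
proof -
  let ?m = "expectation (\<lambda>\<omega>. exp_martingale \<alpha> a \<omega> * \<xi> \<omega>)"
  have b: "0 \<le> b" using ab by simp
  have \<xi>_measurable: "\<xi> \<in> borel_measurable (F a)" using \<xi> by (simp add: bounded_measurable_def)
  have \<xi>_int: "integrable M (\<lambda>\<omega>. exp_martingale \<alpha> a \<omega> * \<xi> \<omega>)"
    using exp_martingale_square_integrable[OF ab(1)]
      bounded_measurable_square_integrable[OF ab(1) \<xi>]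
    by (rule square_integrable_mult_integrable)
  let ?Z = "\<lambda>\<omega>. \<xi> \<omega> * (W b \<omega> - W a \<omega>)"
  have "?Z \<in> borel_measurable (F b)"
    using ab measurable_F_mono[OF ab(1,2) \<xi>_measurable] W_measurable_F[OF ab(1,2)]
      W_measurable_F[OF b order_refl]
    by measurable
  moreover have "integrable M (\<lambda>\<omega>. exp_martingale \<alpha> b \<omega> * ?Z \<omega>)"
    by (intro square_integrable_mult_integrable exp_martingale_square_integrable[OF b]
        bounded_measurable_mult_square_integrable[OF ab(1) \<xi>] square_integrable_increment ab)
  ultimately have "expectation (\<lambda>\<omega>. exp_martingale \<alpha> T \<omega> * ?Z \<omega>) = ?m * (\<alpha> * (b - a))"
    using exp_martingale_mult_increment_expectation[OF ab(1,2) \<xi>_measurable \<xi>_int]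
    by (simp add: exp_martingale_mult_expectation[OF b ab(3)])
  also have "\<dots> = (\<integral>v. \<alpha> * ?m * indicator {a<..b} v \<partial>lborel_upto T)"
    using ab
    by (simp only: integral_mult_right_zero integral_upto_indicator_Ioc min_absorb2
      max_absorb2) simp
  also have "\<dots>
      = (\<integral>v. expectation (\<lambda>\<omega>. (\<alpha> * exp_martingale \<alpha> v \<omega>) * (\<xi> \<omega> * indicator {a<..b} v)) \<partial>lborel_upto T)"
  proof (intro Bochner_Integration.integral_cong refl)
    fix v
    show "\<alpha> * ?m * indicator {a<..b} v
        = expectation (\<lambda>\<omega>. (\<alpha> * exp_martingale \<alpha> v \<omega>) * (\<xi> \<omega> * indicator {a<..b} v))"
      using exp_martingale_mult_expectation[OF ab(1) _ \<xi>_measurable \<xi>_int, of v]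
      by (simp add: indicator_def mult.assoc)
  qed
  also have "\<dots> = (\<integral>(\<omega>, v). (\<alpha> * exp_martingale \<alpha> v \<omega>) * (\<xi> \<omega> * indicator {a<..b} v) \<partial>prod_upto T)"
    using square_integrable_mult_integrable[OF
        square_integrable_cmult[OF exp_martingale_square_integrable_prod]
        square_integrable_elementary[OF ab(1) \<xi>]]
    by (intro upto.integral_snd) (simp add: split_beta')
  finally show ?thesis .
qed

lemma exp_martingale_ito_integrable:
  assumes ito: "ito_integral_L2 M F W H I" and T: "0 \<le> T"
  shows "integrable (prod_upto T) (\<lambda>(\<omega>, v). exp_martingale \<alpha> v \<omega> * H v \<omega>)"
  using square_integrable_mult_integrable[OF exp_martingale_square_integrable_prod
      ito_integrand_square_integrable[OF ito T]]
  by (simp add: split_beta')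

lemma ito_girsanov:
  assumes ito: "ito_integral_L2 M F W H I" and s: "0 \<le> s" "s \<le> T"
  shows "expectation (\<lambda>\<omega>. exp_martingale \<alpha> T \<omega> * I s \<omega>)
    = \<alpha> * (\<integral>v. expectation (\<lambda>\<omega>. exp_martingale \<alpha> v \<omega> * H v \<omega>) \<partial>lborel_upto s)"
proof -
  note square_integrable = exp_martingale_square_integrable[OF s(1)]
    ito_square_integrable[OF ito s(1)]
  have "expectation (\<lambda>\<omega>. exp_martingale \<alpha> T \<omega> * I s \<omega>)
      = expectation (\<lambda>\<omega>. exp_martingale \<alpha> s \<omega> * I s \<omega>)"
    using ito s
    by (intro exp_martingale_mult_expectation[OF s]
      square_integrable_mult_integrable[OF square_integrable])
      (auto simp: ito_integral_L2_def adapted_def)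
  also have "\<dots> = (\<integral>(\<omega>, v). (\<alpha> * exp_martingale \<alpha> v \<omega>) * H v \<omega> \<partial>prod_upto s)"
    using square_integrable_cmult[OF exp_martingale_square_integrable_prod]
    by (intro ito_pairing[OF ito s(1) square_integrable(1)] elementary_girsanov)
      (simp add: split_beta')
  also have "\<dots> = \<alpha> * (\<integral>(\<omega>, v). exp_martingale \<alpha> v \<omega> * H v \<omega> \<partial>prod_upto s)"
    by (simp add: split_beta' mult.assoc)
  finally show ?thesis
    by (simp add: upto.integral_snd[OF exp_martingale_ito_integrable[OF ito s(1)]])
qed

subsection \<open>Discounted Ito integrals\<close>

lemma ito_integral_L2_continuous_version:
  assumes ito: "ito_integral_L2 M F W H I"
  shows "ito_integral_L2 M F W H (continuous_version I)"
proof -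
  have I: "adapted F I" "continuous_paths M I" using ito by (auto simp: ito_integral_L2_def)
  have "(\<integral>\<^sup>+\<omega>. ennreal ((S \<omega> - continuous_version I T \<omega>)\<^sup>2) \<partial>M)
      = (\<integral>\<^sup>+\<omega>. ennreal ((S \<omega> - I T \<omega>)\<^sup>2) \<partial>M)"
    for S T
    using AE_continuous_version[OF I(2)] by (intro nn_integral_cong_AE, eventually_elim) simp
  then show ?thesis
    using ito adapted_continuous_version[OF I]
    by (simp add: ito_integral_L2_def continuous_paths_def continuous_on_continuous_version)
qed

lemma
  assumes K: "adapted F K" and K_square: "square_integrable (prod_upto T) (\<lambda>(\<omega>, s). K s \<omega>)"
    and T: "0 \<le> T"
  shows exp_martingale_time_integrable:
    "integrable M (\<lambda>\<omega>. exp_martingale \<alpha> T \<omega> * (\<integral>s. K s \<omega> \<partial>lborel_upto T))"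
    and exp_martingale_time_integral:
      "expectation (\<lambda>\<omega>. exp_martingale \<alpha> T \<omega> * (\<integral>s. K s \<omega> \<partial>lborel_upto T))
      = (\<integral>s. expectation (\<lambda>\<omega>. exp_martingale \<alpha> s \<omega> * K s \<omega>) \<partial>lborel_upto T)"
proof -
  have terminal_int: "integrable (prod_upto T) (\<lambda>(\<omega>, s). exp_martingale \<alpha> T \<omega> * K s \<omega>)"
    using square_integrable_mult_integrable[OF upto.square_integrable_times[OF
          exp_martingale_square_integrable[OF T] lborel_upto.square_integrable_const[of _ 1]] K_square]
    by (simp add: split_beta')
  show "integrable M (\<lambda>\<omega>. exp_martingale \<alpha> T \<omega> * (\<integral>s. K s \<omega> \<partial>lborel_upto T))"
    using upto.integrable_fst[OF terminal_int] by simp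
  have running_int: "integrable (prod_upto T) (\<lambda>(\<omega>, s). exp_martingale \<alpha> s \<omega> * K s \<omega>)"
    using square_integrable_mult_integrable[OF exp_martingale_square_integrable_prod K_square]
    by (simp add: split_beta')
  have "expectation (\<lambda>\<omega>. exp_martingale \<alpha> T \<omega> * (\<integral>s. K s \<omega> \<partial>lborel_upto T))
      = (\<integral>s. expectation (\<lambda>\<omega>. exp_martingale \<alpha> T \<omega> * K s \<omega>) \<partial>lborel_upto T)"
    using upto.Fubini_integral[OF terminal_int] by simp
  also have "\<dots> = (\<integral>s. expectation (\<lambda>\<omega>. exp_martingale \<alpha> s \<omega> * K s \<omega>) \<partial>lborel_upto T)"
  proof (rule integral_cong_AE)
    show "AE s in lborel_upto T. expectation (\<lambda>\<omega>. exp_martingale \<alpha> T \<omega> * K s \<omega>)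
        = expectation (\<lambda>\<omega>. exp_martingale \<alpha> s \<omega> * K s \<omega>)"
      using upto.AE_integrable_snd[OF running_int] AE_space
    proof eventually_elim
      case (elim s)
      then show ?case
        using K by (intro exp_martingale_mult_expectation) (auto simp: adapted_def)
    qed
  qed (use upto.integrable_snd[OF terminal_int] upto.integrable_snd[OF running_int] in
      \<open>auto simp: borel_measurable_integrable\<close>)
  finally show "expectation (\<lambda>\<omega>. exp_martingale \<alpha> T \<omega> * (\<integral>s. K s \<omega> \<partial>lborel_upto T))
      = (\<integral>s. expectation (\<lambda>\<omega>. exp_martingale \<alpha> s \<omega> * K s \<omega>) \<partial>lborel_upto T)" .
qed

context
  fixes H I :: "real \<Rightarrow> 'a \<Rightarrow> real" and T :: real
  assumes ito: "ito_integral_L2 M F W H I" and cont: "\<And>\<omega>. continuous_on {0..} (\<lambda>t. I t \<omega>)"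
    and T: "0 \<le> T"
begin

lemma integrable_ito_second_moment:
  "integrable (lborel_upto T) (\<lambda>v. expectation (\<lambda>\<omega>. (H v \<omega>)\<^sup>2))"
  using upto.integrable_snd square_integrableD(2)[OF ito_integrand_square_integrable[OF ito T]]
  by (simp add: split_beta')

lemma ito_process_square_integrable: "square_integrable (prod_upto T) (\<lambda>(\<omega>, s). I s \<omega>)"
proof (rule square_integrable_processI)
  show "measurable_process M I"
    using ito cont by (intro measurable_process_adapted_continuous) (auto simp: ito_integral_L2_def)
  fix s assume s: "s \<in> {0..T}"
  then show "square_integrable M (I s)" by (intro ito_square_integrable[OF ito]) simp
  have "expectation (\<lambda>\<omega>. (I s \<omega>)\<^sup>2)
      = (\<integral>v. indicator {..s} v * expectation (\<lambda>\<omega>. (H v \<omega>)\<^sup>2) \<partial>lborel_upto T)"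
    using ito_isometry[OF ito _ order_refl, of s] s
    by (simp add: power2_eq_square integral_upto_eq_indicator)
  also have "\<dots> \<le> (\<integral>v. expectation (\<lambda>\<omega>. (H v \<omega>)\<^sup>2) \<partial>lborel_upto T)"
    by (intro integral_mono_AE' integrable_ito_second_moment AE_I2) (auto simp: indicator_def)
  finally show "expectation (\<lambda>\<omega>. (I s \<omega>)\<^sup>2) \<le> (\<integral>v. expectation (\<lambda>\<omega>. (H v \<omega>)\<^sup>2) \<partial>lborel_upto T)" .
qed

lemma discounted_ito_square_integrable: "square_integrable M (\<lambda>\<omega>. discounted b T (\<lambda>s. I s \<omega>))"
  unfolding discounted_def
  by (intro square_integrable_add square_integrable_cmult ito_square_integrable[OF ito T]
      upto.square_integrable_integral_fst lborel_upto.finite_measure_axioms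
      square_integrable_exp_mult_prod ito_process_square_integrable)

lemma discounted_ito_expectation:
  assumes Y: "square_integrable M Y"
  shows "expectation (\<lambda>\<omega>. Y \<omega> * discounted b T (\<lambda>s. I s \<omega>))
    = discounted b T (\<lambda>s. expectation (\<lambda>\<omega>. Y \<omega> * I s \<omega>))"
proof -
  have int: "integrable (prod_upto T) (\<lambda>(\<omega>, s). Y \<omega> * (exp (- b * s) * I s \<omega>))"
    using square_integrable_mult_integrable[OF
        upto.square_integrable_times[OF Y lborel_upto.square_integrable_const[of _ 1]]
        square_integrable_exp_mult_prod[OF ito_process_square_integrable, of "- b"]]
    by (simp add: split_beta')
  have "expectation (\<lambda>\<omega>. Y \<omega> * discounted b T (\<lambda>s. I s \<omega>))
      = expectation (\<lambda>\<omega>. exp (- b * T) * (Y \<omega> * I T \<omega>)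
          + b * (\<integral>s. Y \<omega> * (exp (- b * s) * I s \<omega>) \<partial>lborel_upto T))"
    by (simp add: discounted_def algebra_simps)
  also have "\<dots> = exp (- b * T) * expectation (\<lambda>\<omega>. Y \<omega> * I T \<omega>)
      + b * expectation (\<lambda>\<omega>. \<integral>s. Y \<omega> * (exp (- b * s) * I s \<omega>) \<partial>lborel_upto T)"
    using square_integrable_mult_integrable[OF Y ito_square_integrable[OF ito T]]
      upto.integrable_fst[OF int]
    by (subst Bochner_Integration.integral_add)
      (simp_all only: integrable_mult_right integral_mult_right_zero)
  also have "expectation (\<lambda>\<omega>. \<integral>s. Y \<omega> * (exp (- b * s) * I s \<omega>) \<partial>lborel_upto T)
      = (\<integral>s. expectation (\<lambda>\<omega>. exp (- b * s) * (Y \<omega> * I s \<omega>)) \<partial>lborel_upto T)"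
    using upto.Fubini_integral[OF int] by (simp only: mult.left_commute)
  finally show ?thesis by (simp add: discounted_def)
qed

lemma discounted_ito_pairing:
  assumes Y: "square_integrable M Y" and g: "integrable (lborel_upto T) g"
    and pairing: "\<And>s. s \<in> {0..T} \<Longrightarrow> expectation (\<lambda>\<omega>. Y \<omega> * I s \<omega>) = (\<integral>v. g v \<partial>lborel_upto s)"
  shows "expectation (\<lambda>\<omega>. Y \<omega> * discounted b T (\<lambda>s. I s \<omega>))
      = (\<integral>v. exp (- b * v) * g v \<partial>lborel_upto T)"
proof -
  have "expectation (\<lambda>\<omega>. Y \<omega> * discounted b T (\<lambda>s. I s \<omega>))
      = discounted b T (\<lambda>s. expectation (\<lambda>\<omega>. Y \<omega> * I s \<omega>))"
    by (rule discounted_ito_expectation[OF Y])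
  also have "\<dots> = discounted b T (\<lambda>s. \<integral>v. g v \<partial>lborel_upto s)"
    by (rule discounted_cong[OF pairing T])
  also have "\<dots> = (\<integral>v. exp (- b * v) * g v \<partial>lborel_upto T)"
    by (rule discounted_integral[OF g T])
  finally show ?thesis .
qed

lemma discounted_ito_girsanov:
  "expectation (\<lambda>\<omega>. exp_martingale \<alpha> T \<omega> * discounted b T (\<lambda>s. I s \<omega>))
    = \<alpha> * (\<integral>v. exp (- b * v) * expectation (\<lambda>\<omega>. exp_martingale \<alpha> v \<omega> * H v \<omega>) \<partial>lborel_upto T)"
proof -
  have "integrable (lborel_upto T) (\<lambda>v. \<alpha> * expectation (\<lambda>\<omega>. exp_martingale \<alpha> v \<omega> * H v \<omega>))"
    using upto.integrable_snd[OF exp_martingale_ito_integrable[OF ito T]] by simp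
  then have "expectation (\<lambda>\<omega>. exp_martingale \<alpha> T \<omega> * discounted b T (\<lambda>s. I s \<omega>))
      = (\<integral>v. exp (- b * v) * (\<alpha> * expectation (\<lambda>\<omega>. exp_martingale \<alpha> v \<omega> * H v \<omega>)) \<partial>lborel_upto T)"
    by (rule discounted_ito_pairing[OF exp_martingale_square_integrable[OF T]])
      (simp add: ito_girsanov[OF ito])
  then show ?thesis by (simp add: mult.left_commute)
qed

lemma discounted_ito_isometry:
  "expectation (\<lambda>\<omega>. (discounted b T (\<lambda>s. I s \<omega>))\<^sup>2)
    = (\<integral>v. exp (- b * v) * (exp (- b * v) * expectation (\<lambda>\<omega>. (H v \<omega>)\<^sup>2)) \<partial>lborel_upto T)"
proof -
  let ?J = "\<lambda>\<omega>. discounted b T (\<lambda>s. I s \<omega>)" and ?h = "\<lambda>v. expectation (\<lambda>\<omega>. (H v \<omega>)\<^sup>2)"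
  have mixed: "expectation (\<lambda>\<omega>. ?J \<omega> * I t \<omega>) = (\<integral>v. exp (- b * v) * ?h v \<partial>lborel_upto t)"
    if t: "t \<in> {0..T}" for t
  proof -
    have "integrable (lborel_upto T) (\<lambda>v. indicator {..t} v * ?h v)"
      using t integrable_upto_subset[OF integrable_ito_second_moment]
      by (simp flip: integrable_upto_iff_indicator)
    then have "expectation (\<lambda>\<omega>. I t \<omega> * ?J \<omega>)
        = (\<integral>v. exp (- b * v) * (indicator {..t} v * ?h v) \<partial>lborel_upto T)"
    proof (rule discounted_ito_pairing[rotated])
      show "square_integrable M (I t)" using t by (intro ito_square_integrable[OF ito]) simp
      fix s assume s: "s \<in> {0..T}"
      show "expectation (\<lambda>\<omega>. I t \<omega> * I s \<omega>) = (\<integral>v. indicator {..t} v * ?h v \<partial>lborel_upto s)"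
      proof (cases "t \<le> s")
        case True
        then show ?thesis
          using ito_isometry[OF ito _ True] t by (simp add: integral_upto_eq_indicator)
      next
        case False
        then have "(\<integral>v. indicator {..t} v * ?h v \<partial>lborel_upto s) = (\<integral>v. ?h v \<partial>lborel_upto s)"
          by (intro Bochner_Integration.integral_cong) auto
        then show ?thesis using ito_isometry[OF ito, of s t] s False by (simp add: mult.commute)
      qed
    qed
    then show ?thesis
      using t
      by (simp add: integral_upto_eq_indicator[of t T] mult.left_commute mult.commute[of _ "I t _"])
  qed
  have "expectation (\<lambda>\<omega>. ?J \<omega> * ?J \<omega>) = (\<integral>v. exp (- b * v) * (exp (- b * v) * ?h v) \<partial>lborel_upto T)"
    by (rule discounted_ito_pairing[OF discounted_ito_square_integrable
          integrable_upto_exp_mult[OF integrable_ito_second_moment] mixed])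
  then show ?thesis by (simp add: power2_eq_square)
qed

lemma discounted_ito_mean: "expectation (\<lambda>\<omega>. discounted b T (\<lambda>s. I s \<omega>)) = 0"
  using discounted_ito_girsanov[of 0 b] by simp

lemma square_integrable_integrand_difference:
  "square_integrable (prod_upto T) (\<lambda>(\<omega>, v). exp (- b * v) * H v \<omega> - c * exp_martingale \<beta> v \<omega>)"
  using square_integrable_diff[OF
      square_integrable_exp_mult_prod[OF ito_integrand_square_integrable[OF ito T], of "- b"]
      square_integrable_cmult[OF exp_martingale_square_integrable_prod]]
  by (simp add: split_beta')

lemma integrand_distance_expansion:
  "(\<integral>v. expectation (\<lambda>\<omega>. (exp (- b * v) * H v \<omega> - x * \<beta> * exp_martingale \<beta> v \<omega>)\<^sup>2) \<partial>lborel_upto T)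
    = expectation (\<lambda>\<omega>. (discounted b T (\<lambda>s. I s \<omega>))\<^sup>2)
      - 2 * (x * expectation (\<lambda>\<omega>. exp_martingale \<beta> T \<omega> * discounted b T (\<lambda>s. I s \<omega>)))
      + x\<^sup>2 * (exp (\<beta>\<^sup>2 * T) - 1)"
proof -
  let ?h = "\<lambda>(\<omega>, v). exp (- b * v) * H v \<omega>" and ?m = "\<lambda>(\<omega>, v). x * \<beta> * exp_martingale \<beta> v \<omega>"
  have h: "square_integrable (prod_upto T) ?h"
    by (rule square_integrable_exp_mult_prod[OF ito_integrand_square_integrable[OF ito T]])
  have m: "square_integrable (prod_upto T) ?m"
    using square_integrable_cmult[OF exp_martingale_square_integrable_prod, of T "x * \<beta>"]
    by (simp add: split_beta')
  have "(\<integral>p. (?h p)\<^sup>2 \<partial>prod_upto T)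
      = (\<integral>v. expectation (\<lambda>\<omega>. (exp (- b * v) * H v \<omega>)\<^sup>2) \<partial>lborel_upto T)"
    using upto.integral_snd[where f = "\<lambda>\<omega> v. (exp (- b * v) * H v \<omega>)\<^sup>2"] square_integrableD(2)[OF h]
    by (simp add: split_beta')
  then have h_square: "(\<integral>p. (?h p)\<^sup>2 \<partial>prod_upto T)
      = expectation (\<lambda>\<omega>. (discounted b T (\<lambda>s. I s \<omega>))\<^sup>2)"
    unfolding discounted_ito_isometry
    by (simp add: power_mult_distrib power2_eq_square[of "exp _"] mult.assoc)
  have "(\<integral>p. ?m p * ?h p \<partial>prod_upto T)
      = (\<integral>v. expectation (\<lambda>\<omega>. x * \<beta> * (exp (- b * v) * (exp_martingale \<beta> v \<omega> * H v \<omega>))) \<partial>lborel_upto T)"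
    using upto.integral_snd[where f = "\<lambda>\<omega> v. x * \<beta> * exp_martingale \<beta> v \<omega> * (exp (- b * v) * H v \<omega>)"]
      square_integrable_mult_integrable[OF m h]
    by (simp only: split_beta' fst_conv snd_conv mult_ac)
  then have mixed: "(\<integral>p. ?m p * ?h p \<partial>prod_upto T)
      = x * expectation (\<lambda>\<omega>. exp_martingale \<beta> T \<omega> * discounted b T (\<lambda>s. I s \<omega>))"
    unfolding discounted_ito_girsanov by (simp add: mult.assoc)
  have "(\<integral>p. (?m p)\<^sup>2 \<partial>prod_upto T)
      = (\<integral>v. expectation (\<lambda>\<omega>. (x * \<beta> * exp_martingale \<beta> v \<omega>)\<^sup>2) \<partial>lborel_upto T)"
    using upto.integral_snd[where f = "\<lambda>\<omega> v. (x * \<beta> * exp_martingale \<beta> v \<omega>)\<^sup>2"]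
      square_integrableD(2)[OF m]
    by (simp add: split_beta')
  also have "\<dots> = (\<integral>v. x\<^sup>2 * (\<beta>\<^sup>2 * exp (\<beta>\<^sup>2 * v)) \<partial>lborel_upto T)"
    by (intro Bochner_Integration.integral_cong refl)
      (simp add: power_mult_distrib exp_martingale_square_expectation mult.assoc)
  finally have m_square: "(\<integral>p. (?m p)\<^sup>2 \<partial>prod_upto T) = x\<^sup>2 * (exp (\<beta>\<^sup>2 * T) - 1)"
    using integral_upto_exp[OF T, of "\<beta>\<^sup>2"] by simp
  show ?thesis
    using upto.integral_snd[where f = "\<lambda>\<omega> v. (exp (- b * v) * H v \<omega> - x * \<beta> * exp_martingale \<beta> v \<omega>)\<^sup>2"]
      square_integrableD(2)[OF square_integrable_integrand_difference] integral_square_diff[OF h m]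
    unfolding h_square mixed m_square by (simp add: split_beta')
qed

text \<open>The right-hand side is the isometry for the integral of \<open>exp (- b v) H - x \<beta> M\<^sup>\<beta>\<close>, because
  \<open>M\<^sup>\<beta> - 1\<close> is the integral of \<open>\<beta> M\<^sup>\<beta>\<close>. That fact would need Ito's formula; the Girsanov
  identity yields the mixed term without it.\<close>

lemma discounted_ito_distance:
  "expectation (\<lambda>\<omega>. (discounted b T (\<lambda>s. I s \<omega>) - x * (exp_martingale \<beta> T \<omega> - 1))\<^sup>2)
    = (\<integral>v. expectation (\<lambda>\<omega>. (exp (- b * v) * H v \<omega> - x * \<beta> * exp_martingale \<beta> v \<omega>)\<^sup>2) \<partial>lborel_upto T)"
proof -
  let ?J = "\<lambda>\<omega>. discounted b T (\<lambda>s. I s \<omega>)" and ?M = "exp_martingale \<beta> T"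
  note J = discounted_ito_square_integrable[of b]
    and M = exp_martingale_square_integrable[OF T, of \<beta>]
    and one = square_integrable_const[of 1]
  have shifted: "square_integrable M (\<lambda>\<omega>. x * (?M \<omega> - 1))"
    by (intro square_integrable_cmult square_integrable_diff M one)
  have "expectation (\<lambda>\<omega>. (x * (?M \<omega> - 1)) * ?J \<omega>) = x * expectation (\<lambda>\<omega>. ?M \<omega> * ?J \<omega>)"
    using square_integrable_mult_integrable[OF M J] square_integrable_integrable[OF J]
    by (simp add: left_diff_distrib mult.assoc discounted_ito_mean)
  moreover have "expectation (\<lambda>\<omega>. (x * (?M \<omega> - 1))\<^sup>2) = x\<^sup>2 * (exp (\<beta>\<^sup>2 * T) - 1)"
    using integral_square_diff[OF M one] exp_martingale_expectation[OF T, of \<beta>]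
      exp_martingale_square_expectation[OF T, of \<beta>]
    by (simp add: power_mult_distrib prob_space)
  ultimately show ?thesis
    unfolding integral_square_diff[OF J shifted] integrand_distance_expansion by simp
qed

end

end

subsection \<open>The budget inequality\<close>

abbreviation stop_integrand :: "('a \<Rightarrow> real) \<Rightarrow> (real \<Rightarrow> 'a \<Rightarrow> real) \<Rightarrow> real \<Rightarrow> 'a \<Rightarrow> real" where
  "stop_integrand \<tau> H \<equiv> \<lambda>t \<omega>. if t \<le> \<tau> \<omega> then H t \<omega> else 0"

abbreviation stop_process :: "('a \<Rightarrow> real) \<Rightarrow> (real \<Rightarrow> 'a \<Rightarrow> real) \<Rightarrow> real \<Rightarrow> 'a \<Rightarrow> real" where
  "stop_process \<tau> Z \<equiv> \<lambda>t \<omega>. Z (min t (\<tau> \<omega>)) \<omega>"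

context brownian_motion
begin

definition localised_solution ::
  "real \<Rightarrow> (real \<Rightarrow> 'a \<Rightarrow> real) \<Rightarrow> (real \<Rightarrow> 'a \<Rightarrow> real) \<Rightarrow> (real \<Rightarrow> 'a \<Rightarrow> real) \<Rightarrow> (real \<Rightarrow> 'a \<Rightarrow> real) \<Rightarrow>
   ('a \<Rightarrow> real) \<Rightarrow> bool" where
  "localised_solution x b H X I \<tau> \<longleftrightarrow>
     continuous_paths M X \<and> continuous_paths M I \<and>
     (AE \<omega> in M. \<forall>t\<ge>0. set_integrable lborel {0..t} (\<lambda>s. b s \<omega>)) \<and>
     (AE \<omega> in M. \<forall>t\<ge>0. X t \<omega> = x + (LBINT s:{0..t}. b s \<omega>) + I t \<omega>) \<and>
     \<tau> \<in> borel_measurable M \<and> (\<forall>\<omega>\<in>space M. 0 \<le> \<tau> \<omega>) \<and>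
     ito_integral_L2 M F W (stop_integrand \<tau> H) (stop_process \<tau> I)"

lemma localised_solutionD:
  assumes "localised_solution x b H X I \<tau>"
  shows "\<tau> \<in> borel_measurable M" "\<And>\<omega>. \<omega> \<in> space M \<Longrightarrow> 0 \<le> \<tau> \<omega>"
    and "ito_integral_L2 M F W (stop_integrand \<tau> H) (stop_process \<tau> I)"
    and "AE \<omega> in M. \<forall>t. continuous_version (stop_process \<tau> I) t \<omega> = stop_process \<tau> I t \<omega>"
  using assms AE_continuous_version[of M "stop_process \<tau> I"]
  by (auto simp: localised_solution_def ito_integral_L2_def)

lemma solves_SDE_localisation:
  assumes "solves_SDE M F W x b H X"
  obtains I and \<tau> :: "nat \<Rightarrow> 'a \<Rightarrow> real"
  where "\<And>n. localised_solution x b H X I (\<tau> n)"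
    and "\<And>T. AE \<omega> in M. \<forall>\<^sub>F n in sequentially. T \<le> \<tau> n \<omega>"
proof -
  from assms obtain I where ito: "ito_integral M F W H I"
    and eq: "AE \<omega> in M. \<forall>t\<ge>0. X t \<omega> = x + (LBINT s:{0..t}. b s \<omega>) + I t \<omega>"
    unfolding solves_SDE_def by auto
  then obtain \<tau> :: "nat \<Rightarrow> 'a \<Rightarrow> real"
    where stopping: "\<And>n. stopping_time F (\<tau> n)" "\<And>n \<omega>. \<omega> \<in> space M \<Longrightarrow> 0 \<le> \<tau> n \<omega>"
      and lim: "AE \<omega> in M. filterlim (\<lambda>n. \<tau> n \<omega>) at_top sequentially"
      and stopped: "\<And>n. ito_integral_L2 M F W (stop_integrand (\<tau> n) H) (stop_process (\<tau> n) I)"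
    unfolding ito_integral_def by auto
  have "AE \<omega> in M. \<forall>\<^sub>F n in sequentially. T \<le> \<tau> n \<omega>" for T
    using lim by eventually_elim (simp add: filterlim_at_top)
  moreover have "localised_solution x b H X I (\<tau> n)" for n
    using assms ito eq stopping stopped stopping_time_measurable[of "\<tau> n"]
    by (auto simp: localised_solution_def solves_SDE_def ito_integral_def)
  ultimately show ?thesis by (intro that)
qed

lemma localised_solution_linear:
  assumes sol: "localised_solution x (\<lambda>t \<omega>. b * X t \<omega> + g t \<omega>) H X I \<tau>" and T: "0 \<le> T"
  shows "AE \<omega> in M. integrable (lborel_upto (min T (\<tau> \<omega>))) (\<lambda>s. g s \<omega>) \<and>
    exp (- b * min T (\<tau> \<omega>)) * X (min T (\<tau> \<omega>)) \<omega> = x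
      + (\<integral>s. exp (- b * s) * g s \<omega> \<partial>lborel_upto (min T (\<tau> \<omega>))) + discounted b T (\<lambda>s. stop_process \<tau> I s \<omega>)"
proof -
  have "AE \<omega> in M. continuous_on {0..} (\<lambda>t. X t \<omega>)" "AE \<omega> in M. continuous_on {0..} (\<lambda>t. I t \<omega>)"
    "AE \<omega> in M. \<forall>t\<ge>0. integrable (lborel_upto t) (\<lambda>s. b * X s \<omega> + g s \<omega>)"
    "AE \<omega> in M. \<forall>t\<ge>0. X t \<omega> = x + (\<integral>s. b * X s \<omega> + g s \<omega> \<partial>lborel_upto t) + I t \<omega>"
    using sol
    by (auto simp: localised_solution_def continuous_paths_def set_integrable_upto
      set_integral_upto)
  then show ?thesis
    using AE_space
  proof eventually_elim
    case (elim \<omega>)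
    have drift: "integrable (lborel_upto t) (\<lambda>s. b * X s \<omega> + g s \<omega>)"
      and eq: "X t \<omega> = x + (\<integral>s. b * X s \<omega> + g s \<omega> \<partial>lborel_upto t) + I t \<omega>" if "0 \<le> t" for t
      using elim(3,4) that by auto
    show ?case
      using stopped_linear_path_equation[OF elim(1,2) drift eq T
        localised_solutionD(2)[OF sol elim(5)]]
      by simp
  qed
qed

definition discounted_gains ::
  "real \<Rightarrow> real \<Rightarrow> (real \<Rightarrow> 'a \<Rightarrow> real) \<Rightarrow> (real \<Rightarrow> 'a \<Rightarrow> real) \<Rightarrow> real \<Rightarrow> 'a \<Rightarrow> real" where
  "discounted_gains r lam H I T \<omega> =
    lam * (\<integral>s. exp (- r * s) * H s \<omega> \<partial>lborel_upto T) + discounted r T (\<lambda>s. I s \<omega>)"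

lemma
  assumes ito: "ito_integral_L2 M F W H I" and cont: "\<And>\<omega>. continuous_on {0..} (\<lambda>t. I t \<omega>)"
    and T: "0 \<le> T"
  shows discounted_gains_integrable:
      "integrable M (\<lambda>\<omega>. exp_martingale (- lam) T \<omega> * discounted_gains r lam H I T \<omega>)"
    and discounted_gains_expectation:
      "expectation (\<lambda>\<omega>. exp_martingale (- lam) T \<omega> * discounted_gains r lam H I T \<omega>) = 0"
proof -
  let ?m = "exp_martingale (- lam)" and ?A = "\<lambda>\<omega>. \<integral>s. exp (- r * s) * H s \<omega> \<partial>lborel_upto T"
    and ?J = "\<lambda>\<omega>. discounted r T (\<lambda>s. I s \<omega>)"
  have "adapted F (\<lambda>s \<omega>. exp (- r * s) * H s \<omega>)"
    using ito by (auto simp: ito_integral_L2_def L2_loc_def adapted_def)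
  note drift = this square_integrable_exp_mult_prod[OF ito_integrand_square_integrable[OF ito T]] T
  have drift_int: "integrable M (\<lambda>\<omega>. ?m T \<omega> * ?A \<omega>)"
    by (rule exp_martingale_time_integrable[OF drift])
  have ito_int: "integrable M (\<lambda>\<omega>. ?m T \<omega> * ?J \<omega>)"
    by (intro square_integrable_mult_integrable exp_martingale_square_integrable[OF T]
        discounted_ito_square_integrable[OF ito cont T])
  have split: "?m T \<omega> * discounted_gains r lam H I T \<omega>
      = lam * (?m T \<omega> * ?A \<omega>) + ?m T \<omega> * ?J \<omega>" for \<omega>
    by (simp add: discounted_gains_def algebra_simps)
  show "integrable M (\<lambda>\<omega>. ?m T \<omega> * discounted_gains r lam H I T \<omega>)"
    unfolding split using drift_int ito_int by simp
  have "expectation (\<lambda>\<omega>. ?m T \<omega> * discounted_gains r lam H I T \<omega>)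
      = lam * expectation (\<lambda>\<omega>. ?m T \<omega> * ?A \<omega>) + expectation (\<lambda>\<omega>. ?m T \<omega> * ?J \<omega>)"
    unfolding split using drift_int ito_int by simp
  also have "expectation (\<lambda>\<omega>. ?m T \<omega> * ?A \<omega>)
      = (\<integral>s. exp (- r * s) * expectation (\<lambda>\<omega>. ?m s \<omega> * H s \<omega>) \<partial>lborel_upto T)"
    unfolding exp_martingale_time_integral[OF drift] by (simp add: mult.left_commute)
  finally show "expectation (\<lambda>\<omega>. ?m T \<omega> * discounted_gains r lam H I T \<omega>) = 0"
    unfolding discounted_ito_girsanov[OF ito cont T] by simp
qed

definition discounted_consumption ::
  "real \<Rightarrow> (real \<Rightarrow> 'a \<Rightarrow> real) \<Rightarrow> ('a \<Rightarrow> real) \<Rightarrow> real \<Rightarrow> 'a \<Rightarrow> ennreal" where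
  "discounted_consumption r c \<tau> T \<omega>
    = (\<integral>\<^sup>+s. (if s \<le> \<tau> \<omega> then ennreal (exp (- r * s) * c s \<omega>) else 0) \<partial>lborel_upto T)"

context
  fixes c \<pi> X I :: "real \<Rightarrow> 'a \<Rightarrow> real" and r \<sigma> lam x :: real and \<tau> :: "'a \<Rightarrow> real"
  assumes c: "c \<in> L1_loc_nonneg M F" and X_nonneg: "AE \<omega> in M. \<forall>t\<ge>0. 0 \<le> X t \<omega>"
    and sol: "localised_solution x (\<lambda>t \<omega>. r * X t \<omega> + \<sigma> * lam * \<pi> t \<omega> - c t \<omega>) (\<lambda>t \<omega>. \<sigma> * \<pi> t \<omega>) X I \<tau>"
begin

lemma stopped_wealth_eq:
  assumes T: "0 \<le> T"
  shows "AE \<omega> in M. exp (- r * min T (\<tau> \<omega>)) * X (min T (\<tau> \<omega>)) \<omega>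
      + (\<integral>s. exp (- r * s) * c s \<omega> \<partial>lborel_upto (min T (\<tau> \<omega>)))
    = x + discounted_gains r lam (stop_integrand \<tau> (\<lambda>t \<omega>. \<sigma> * \<pi> t \<omega>)) (stop_process \<tau> I) T \<omega>"
proof -
  let ?g = "\<lambda>s \<omega>. \<sigma> * lam * \<pi> s \<omega> - c s \<omega>"
  have "localised_solution x (\<lambda>t \<omega>. r * X t \<omega> + ?g t \<omega>) (\<lambda>t \<omega>. \<sigma> * \<pi> t \<omega>) X I \<tau>"
    using sol by (simp only: add_diff_eq)
  from localised_solution_linear[OF this T] L1_loc_path_integrable[OF c, of T] show ?thesis
  proof eventually_elim
    case (elim \<omega>)
    let ?\<theta> = "min T (\<tau> \<omega>)"
    have c_int: "integrable (lborel_upto ?\<theta>) (\<lambda>s. c s \<omega>)"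
      by (rule integrable_upto_subset[OF elim(2)]) simp
    have \<pi>_int: "integrable (lborel_upto ?\<theta>) (\<lambda>s. \<sigma> * lam * \<pi> s \<omega>)"
      using Bochner_Integration.integrable_add[OF elim(1)[THEN conjunct1] c_int] by simp
    have "(\<integral>s. exp (- r * s) * ?g s \<omega> \<partial>lborel_upto ?\<theta>)
        = (\<integral>s. exp (- r * s) * (\<sigma> * lam * \<pi> s \<omega>) \<partial>lborel_upto ?\<theta>)
          - (\<integral>s. exp (- r * s) * c s \<omega> \<partial>lborel_upto ?\<theta>)"
      using integrable_upto_exp_mult[OF \<pi>_int, of "- r"]
        integrable_upto_exp_mult[OF c_int, of "- r"]
      by (simp add: right_diff_distrib)
    also have "(\<integral>s. exp (- r * s) * (\<sigma> * lam * \<pi> s \<omega>) \<partial>lborel_upto ?\<theta>)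
        = (\<integral>s. lam * (exp (- r * s) * stop_integrand \<tau> (\<lambda>t \<omega>. \<sigma> * \<pi> t \<omega>) s \<omega>) \<partial>lborel_upto T)"
      unfolding integral_upto_eq_indicator[OF min.cobounded1]
      by (intro Bochner_Integration.integral_cong) (auto simp: indicator_def)
    finally show ?case using elim(1) by (simp add: discounted_gains_def)
  qed
qed

lemma discounted_consumption_le:
  assumes T: "0 \<le> T"
  shows "AE \<omega> in M.
    0 \<le> x + discounted_gains r lam (stop_integrand \<tau> (\<lambda>t \<omega>. \<sigma> * \<pi> t \<omega>)) (stop_process \<tau> I) T \<omega> \<and>
    discounted_consumption r c \<tau> T \<omega>
      \<le> ennreal (x + discounted_gains r lam (stop_integrand \<tau> (\<lambda>t \<omega>. \<sigma> * \<pi> t \<omega>)) (stop_process \<tau> I) T \<omega>)"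
proof -
  have c_nonneg: "AE \<omega> in M. AE t in lborel. 0 \<le> t \<longrightarrow> 0 \<le> c t \<omega>"
    using c by (simp add: L1_loc_nonneg_def)
  show ?thesis
    using stopped_wealth_eq[OF T] X_nonneg c_nonneg L1_loc_path_integrable[OF c, of T] AE_space
  proof eventually_elim
    case (elim \<omega>)
    let ?\<theta> = "min T (\<tau> \<omega>)"
    let ?C = "\<integral>s. exp (- r * s) * c s \<omega> \<partial>lborel_upto ?\<theta>"
    have int: "integrable (lborel_upto ?\<theta>) (\<lambda>s. exp (- r * s) * c s \<omega>)"
      by (intro integrable_upto_exp_mult integrable_upto_subset[OF elim(4)]) simp
    have nonneg: "AE s in lborel_upto ?\<theta>. 0 \<le> exp (- r * s) * c s \<omega>"
      using AE_lborel_uptoI[OF elim(3)] by eventually_elim simp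
    have "discounted_consumption r c \<tau> T \<omega>
        = (\<integral>\<^sup>+s. ennreal (exp (- r * s) * c s \<omega>) \<partial>lborel_upto ?\<theta>)"
      unfolding nn_integral_upto_eq_indicator[OF min.cobounded1] discounted_consumption_def
      by (intro nn_integral_cong) (auto simp: indicator_def)
    also have "\<dots> = ennreal ?C" by (rule nn_integral_eq_integral[OF int nonneg])
    finally have "discounted_consumption r c \<tau> T \<omega> = ennreal ?C" .
    moreover have "0 \<le> exp (- r * ?\<theta>) * X ?\<theta> \<omega>"
      using elim(2) T localised_solutionD(2)[OF sol elim(5)] by simp
    moreover have "0 \<le> ?C" by (rule integral_nonneg_AE[OF nonneg])
    ultimately show ?case unfolding elim(1)[symmetric] by (simp add: ennreal_leI)
  qed
qed

lemma stopped_budget: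
  assumes T: "0 \<le> T"
  shows "(\<integral>\<^sup>+\<omega>. ennreal (exp_martingale (- lam) T \<omega>) * discounted_consumption r c \<tau> T \<omega> \<partial>M)
      \<le> ennreal x"
proof -
  let ?m = "exp_martingale (- lam) T" and ?C = "discounted_consumption r c \<tau> T"
  let ?J = "continuous_version (stop_process \<tau> I)"
  let ?G = "discounted_gains r lam (stop_integrand \<tau> (\<lambda>t \<omega>. \<sigma> * \<pi> t \<omega>)) ?J T"
  note gains = ito_integral_L2_continuous_version[OF localised_solutionD(3)[OF sol]]
    continuous_on_continuous_version T
  have bound: "AE \<omega> in M. 0 \<le> ?m \<omega> * (x + ?G \<omega>) \<and> ennreal (?m \<omega>) * ?C \<omega>
      \<le> ennreal (?m \<omega> * (x + ?G \<omega>))"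
    using discounted_consumption_le[OF T] localised_solutionD(4)[OF sol]
    by eventually_elim (simp add: discounted_gains_def ennreal_mult mult_left_mono)
  have int: "integrable M (\<lambda>\<omega>. ?m \<omega> * (x + ?G \<omega>))"
    using exp_martingale_integrable[OF T] discounted_gains_integrable[OF gains]
    by (simp add: distrib_left)
  have "(\<integral>\<^sup>+\<omega>. ennreal (?m \<omega>) * ?C \<omega> \<partial>M) \<le> (\<integral>\<^sup>+\<omega>. ennreal (?m \<omega> * (x + ?G \<omega>)) \<partial>M)"
    using bound by (intro nn_integral_mono_AE) auto
  also have "\<dots> = ennreal (expectation (\<lambda>\<omega>. ?m \<omega> * (x + ?G \<omega>)))"
    using bound by (intro nn_integral_eq_integral int) auto
  also have "expectation (\<lambda>\<omega>. ?m \<omega> * (x + ?G \<omega>)) = x"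
    using exp_martingale_integrable[OF T] exp_martingale_expectation[OF T]
      discounted_gains_integrable[OF gains] discounted_gains_expectation[OF gains]
    by (simp add: distrib_left)
  finally show ?thesis .
qed

end

definition state_price_density :: "real \<Rightarrow> real \<Rightarrow> real \<Rightarrow> 'a \<Rightarrow> real" where
  "state_price_density r lam t \<omega> = exp (- r * t) * exp_martingale (- lam) t \<omega>"

lemma state_price_density_pos: "0 < state_price_density r lam t \<omega>"
  by (simp add: state_price_density_def)

lemma measurable_process_state_price_density: "measurable_process M (state_price_density r lam)"
proof (rule measurable_process_continuous)
  show "state_price_density r lam t \<in> borel_measurable M" if "0 \<le> t" for t
    unfolding state_price_density_def[abs_def] using that by measurable
  show "continuous_on {0..} (\<lambda>t. state_price_density r lam t \<omega>)" for \<omega>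
    unfolding state_price_density_def exp_martingale_def
    by (intro continuous_intros continuous_on_continuous_version) auto
qed

context
  fixes c \<pi> X :: "real \<Rightarrow> 'a \<Rightarrow> real" and r \<sigma> lam x :: real
  assumes c: "c \<in> L1_loc_nonneg M F" and wealth: "wealth_process M F W r \<sigma> lam x c \<pi> X"
    and nonneg: "AE \<omega> in M. \<forall>t\<ge>0. 0 \<le> X t \<omega>"
begin

lemma consumption_measurable [measurable]:
  "(\<lambda>p. c (snd p) (fst p)) \<in> borel_measurable (prod_upto T)"
  using c measurable_process_upto[of M c T] by (simp add: L1_loc_nonneg_def split_beta')

lemma terminal_budget:
  assumes T: "0 \<le> T"
  shows "(\<integral>\<^sup>+\<omega>. ennreal (exp_martingale (- lam) T \<omega>)
      * (\<integral>\<^sup>+s. ennreal (exp (- r * s) * c s \<omega>) \<partial>lborel_upto T) \<partial>M) \<le> ennreal x"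
proof -
  obtain I and \<tau> :: "nat \<Rightarrow> 'a \<Rightarrow> real" where
    sol: "\<And>n. localised_solution x (\<lambda>t \<omega>. r * X t \<omega> + \<sigma> * lam * \<pi> t \<omega> - c t \<omega>) (\<lambda>t \<omega>. \<sigma> * \<pi> t \<omega>) X I (\<tau> n)"
    and \<tau>_lim: "\<And>T. AE \<omega> in M. \<forall>\<^sub>F n in sequentially. T \<le> \<tau> n \<omega>"
    by (fact solves_SDE_localisation[OF wealth[unfolded wealth_process_def]])
  let ?m = "\<lambda>\<omega>. ennreal (exp_martingale (- lam) T \<omega>)"
  note [measurable] = localised_solutionD(1)[OF sol]
  show ?thesis
  proof (rule nn_integral_le_liminf[OF _ stopped_budget[OF c nonneg sol T]])
    show "(\<lambda>\<omega>. ?m \<omega> * discounted_consumption r c (\<tau> n) T \<omega>) \<in> borel_measurable M" for n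
      unfolding discounted_consumption_def using T by measurable
    show "AE \<omega> in M. \<forall>\<^sub>F n in sequentially. ?m \<omega> * discounted_consumption r c (\<tau> n) T \<omega>
        = ?m \<omega> * (\<integral>\<^sup>+s. ennreal (exp (- r * s) * c s \<omega>) \<partial>lborel_upto T)"
      using \<tau>_lim[of T]
    proof eventually_elim
      case (elim \<omega>)
      then show ?case
        unfolding discounted_consumption_def
        by eventually_elim (intro arg_cong2[where f = "(*)"] nn_integral_cong, auto)
    qed
  qed simp
qed

lemma budget_upto:
  assumes T: "0 \<le> T"
  shows "(\<integral>\<^sup>+s. \<integral>\<^sup>+\<omega>. ennreal (state_price_density r lam s \<omega>) * ennreal (c s \<omega>) \<partial>M \<partial>lborel_upto T)
      \<le> ennreal x"
proof -
  let ?m = "exp_martingale (- lam)" and ?f = "\<lambda>s \<omega>. ennreal (exp (- r * s) * c s \<omega>)"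
  have "(\<integral>\<^sup>+s. \<integral>\<^sup>+\<omega>. ennreal (state_price_density r lam s \<omega>) * ennreal (c s \<omega>) \<partial>M \<partial>lborel_upto T)
      = (\<integral>\<^sup>+s. \<integral>\<^sup>+\<omega>. ennreal (?m T \<omega>) * ?f s \<omega> \<partial>M \<partial>lborel_upto T)"
  proof (rule nn_integral_cong)
    fix s assume "s \<in> space (lborel_upto T)"
    then have s: "0 \<le> s" "s \<le> T" by auto
    have [measurable]: "c s \<in> borel_measurable (F s)"
      using c s by (auto simp: L1_loc_nonneg_def adapted_def)
    have "(\<integral>\<^sup>+\<omega>. ennreal (state_price_density r lam s \<omega>) * ennreal (c s \<omega>) \<partial>M)
        = (\<integral>\<^sup>+\<omega>. ennreal (?m s \<omega>) * ?f s \<omega> \<partial>M)"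
      by (intro nn_integral_cong)
        (simp add: state_price_density_def ennreal_mult', simp add: mult_ac)
    also have "\<dots> = (\<integral>\<^sup>+\<omega>. ennreal (?m T \<omega>) * ?f s \<omega> \<partial>M)"
      by (rule exp_martingale_mult_nn_integral[OF s, symmetric]) measurable
    finally show "(\<integral>\<^sup>+\<omega>. ennreal (state_price_density r lam s \<omega>) * ennreal (c s \<omega>) \<partial>M)
        = (\<integral>\<^sup>+\<omega>. ennreal (?m T \<omega>) * ?f s \<omega> \<partial>M)" .
  qed
  also have "\<dots> = (\<integral>\<^sup>+\<omega>. \<integral>\<^sup>+s. ennreal (?m T \<omega>) * ?f s \<omega> \<partial>lborel_upto T \<partial>M)"
    using T by (intro upto.Fubini') measurable
  also have "\<dots> = (\<integral>\<^sup>+\<omega>. ennreal (?m T \<omega>) * (\<integral>\<^sup>+s. ?f s \<omega> \<partial>lborel_upto T) \<partial>M)"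
  proof (intro nn_integral_cong nn_integral_cmult)
    fix \<omega> assume \<omega>: "\<omega> \<in> space M"
    have "(\<lambda>(\<omega>, s). ?f s \<omega>) \<in> borel_measurable (prod_upto T)" by measurable
    from measurable_compose[OF measurable_Pair1'[OF \<omega>] this]
    show "(\<lambda>s. ?f s \<omega>) \<in> borel_measurable (lborel_upto T)" by simp
  qed
  also have "\<dots> \<le> ennreal x" by (rule terminal_budget[OF T])
  finally show ?thesis .
qed

lemma budget_constraint:
  "(\<integral>\<^sup>+s. \<integral>\<^sup>+\<omega>. ennreal (state_price_density r lam s \<omega>) * ennreal (c s \<omega>) \<partial>M \<partial>half_line)
      \<le> ennreal x"
proof -
  let ?g = "\<lambda>s. \<integral>\<^sup>+\<omega>. ennreal (state_price_density r lam s \<omega>) * ennreal (c s \<omega>) \<partial>M"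
  have "(\<lambda>(\<omega>, s). state_price_density r lam s \<omega>) \<in> borel_measurable (M \<Otimes>\<^sub>M half_line)"
    "(\<lambda>(\<omega>, s). c s \<omega>) \<in> borel_measurable (M \<Otimes>\<^sub>M half_line)"
    using c measurable_process_state_price_density
    by (auto intro!: measurable_process_restrict_space simp: L1_loc_nonneg_def)
  then have "(\<lambda>(\<omega>, s). ennreal (state_price_density r lam s \<omega>) * ennreal (c s \<omega>))
      \<in> borel_measurable (M \<Otimes>\<^sub>M half_line)"
    by (simp add: split_beta')
  from half_line.borel_measurable_nn_integral_snd[OF this]
  have g: "?g \<in> borel_measurable half_line" by simp
  have "(\<integral>\<^sup>+s. indicator {..real n} s * ?g s \<partial>half_line) \<le> ennreal x" for n
  proof -
    have "(\<integral>\<^sup>+s. indicator {..real n} s * ?g s \<partial>half_line) = (\<integral>\<^sup>+s. ?g s \<partial>lborel_upto (real n))"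
      unfolding lborel_upto_def
      by (simp add: nn_integral_restrict_space, intro nn_integral_cong) (auto simp: indicator_def)
    then show ?thesis using budget_upto[of "real n"] by simp
  qed
  then show ?thesis
  proof (rule nn_integral_le_liminf[rotated])
    have "\<forall>\<^sub>F n in sequentially. indicator {..real n} s * ?g s = ?g s" for s
    proof -
      have "\<forall>\<^sub>F n in sequentially. s \<le> real n"
        using filterlim_real_sequentially by (simp add: filterlim_at_top)
      then show ?thesis by eventually_elim simp
    qed
    then show "AE s in half_line.
        \<forall>\<^sub>F n in sequentially. indicator {..real n} s * ?g s = ?g s" by simp
    show "(\<lambda>s. indicator {..real n} s * ?g s) \<in> borel_measurable half_line" for n
      by (intro borel_measurable_times_ennreal measurable_restrict_space1 g) measurable
  qed simp
qed

end

subsection \<open>Uniqueness of geometric Brownian motion\<close>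

definition exp_martingale_tail :: "('a \<Rightarrow> real) \<Rightarrow> real \<Rightarrow> real \<Rightarrow> real" where
  "exp_martingale_tail \<tau> \<beta> v = expectation (\<lambda>\<omega>. if v \<le> \<tau> \<omega> then 0 else (exp_martingale \<beta> v \<omega>)\<^sup>2)"

lemma exp_martingale_tail_integrable_prod:
  assumes [measurable]: "\<tau> \<in> borel_measurable M"
  shows "integrable (prod_upto T) (\<lambda>(\<omega>, v). if v \<le> \<tau> \<omega> then 0 else (exp_martingale \<beta> v \<omega>)\<^sup>2)"
proof (rule Bochner_Integration.integrable_bound)
  note M = exp_martingale_square_integrable_prod[of T \<beta>]
  show "integrable (prod_upto T) (\<lambda>p. (case p of (\<omega>, v) \<Rightarrow> exp_martingale \<beta> v \<omega>)\<^sup>2)"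
    by (rule square_integrableD(2)[OF M])
  have [measurable]: "(\<lambda>p. exp_martingale \<beta> (snd p) (fst p)) \<in> borel_measurable (prod_upto T)"
    using square_integrableD(1)[OF M] by (simp add: split_beta')
  show "(\<lambda>(\<omega>, v). if v \<le> \<tau> \<omega> then 0 else (exp_martingale \<beta> v \<omega>)\<^sup>2) \<in> borel_measurable (prod_upto T)"
    unfolding split_beta' by measurable
qed auto

lemma
  assumes \<tau>: "\<tau> \<in> borel_measurable M"
  shows exp_martingale_tail_integrable: "integrable (lborel_upto T) (exp_martingale_tail \<tau> \<beta>)"
    and integral_exp_martingale_tail: "(\<integral>v. exp_martingale_tail \<tau> \<beta> v \<partial>lborel_upto T)
      = (\<integral>(\<omega>, v). (if v \<le> \<tau> \<omega> then 0 else (exp_martingale \<beta> v \<omega>)\<^sup>2) \<partial>prod_upto T)"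
  using upto.integrable_snd[OF exp_martingale_tail_integrable_prod[OF \<tau>]]
    upto.integral_snd[OF exp_martingale_tail_integrable_prod[OF \<tau>]]
  by (simp_all add: exp_martingale_tail_def[abs_def])

lemma exp_martingale_tail_tendsto_0:
  assumes \<tau>: "\<And>n. \<tau> n \<in> borel_measurable M"
    and lim: "AE \<omega> in M. \<forall>\<^sub>F n in sequentially. T \<le> \<tau> n \<omega>"
  shows "(\<lambda>n. \<integral>v. exp_martingale_tail (\<tau> n) \<beta> v \<partial>lborel_upto T) \<longlonglongrightarrow> 0"
proof -
  have "(\<lambda>n. \<integral>(\<omega>, v). (if v \<le> \<tau> n \<omega> then 0 else (exp_martingale \<beta> v \<omega>)\<^sup>2) \<partial>prod_upto T)
      \<longlonglongrightarrow> (\<integral>p. 0 \<partial>prod_upto T)"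
  proof (rule integral_dominated_convergence)
    show "integrable (prod_upto T) (\<lambda>p. (case p of (\<omega>, v) \<Rightarrow> exp_martingale \<beta> v \<omega>)\<^sup>2)"
      by (rule square_integrableD(2)[OF exp_martingale_square_integrable_prod])
    show "AE p in prod_upto T.
        (\<lambda>n. case p of (\<omega>, v) \<Rightarrow> if v \<le> \<tau> n \<omega> then 0 else (exp_martingale \<beta> v \<omega>)\<^sup>2) \<longlonglongrightarrow> 0"
      using upto.AE_fst[OF lim, of T] AE_space
    proof eventually_elim
      case (elim p)
      obtain \<omega> v where p: "p = (\<omega>, v)" by fastforce
      have "\<forall>\<^sub>F n in sequentially. T \<le> \<tau> n \<omega>" using elim(1) p by simp
      then have "\<forall>\<^sub>F n in sequentially. (if v \<le> \<tau> n \<omega> then 0 else (exp_martingale \<beta> v \<omega>)\<^sup>2) = 0"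
        by eventually_elim (use elim(2) p in \<open>auto simp: space_pair_measure\<close>)
      then show ?case unfolding p by (auto intro: tendsto_eventually)
    qed
  qed (use exp_martingale_tail_integrable_prod[OF \<tau>] in auto)
  then show ?thesis by (simp add: integral_exp_martingale_tail[OF \<tau>])
qed

context
  fixes X I :: "real \<Rightarrow> 'a \<Rightarrow> real" and b \<beta> x :: real and \<tau> :: "'a \<Rightarrow> real"
  assumes sol: "localised_solution x (\<lambda>t \<omega>. b * X t \<omega>) (\<lambda>t \<omega>. \<beta> * X t \<omega>) X I \<tau>"
begin

text \<open>The second moment of the error is the time integral of the second moment of an integrand which,
  up to \<open>\<tau>\<close>, is \<open>\<beta>\<close> times the error itself: this closes the Gronwall loop.\<close>

definition gbm_error :: "real \<Rightarrow> 'a \<Rightarrow> real" where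
  "gbm_error t \<omega>
    = discounted b t (\<lambda>s. continuous_version (stop_process \<tau> I) s \<omega>) - x * (exp_martingale \<beta> t \<omega> - 1)"

lemmas \<tau>_measurable [measurable] = localised_solutionD(1)[OF sol]

lemmas ito_version =
  ito_integral_L2_continuous_version[OF localised_solutionD(3)[OF sol]] continuous_on_continuous_version

lemma AE_gbm_error:
  assumes t: "0 \<le> t"
  shows "AE \<omega> in M. gbm_error t \<omega>
    = exp (- b * min t (\<tau> \<omega>)) * X (min t (\<tau> \<omega>)) \<omega> - x * exp_martingale \<beta> t \<omega>"
  using localised_solution_linear[of x b X "\<lambda>_ _. 0", simplified, OF sol t]
    localised_solutionD(4)[OF sol]
  by eventually_elim (simp add: gbm_error_def algebra_simps)

lemma square_integrable_gbm_error: "0 \<le> t \<Longrightarrow> square_integrable M (gbm_error t)"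
  unfolding gbm_error_def[abs_def]
  by (intro square_integrable_diff square_integrable_cmult
    discounted_ito_square_integrable[OF ito_version]
      exp_martingale_square_integrable square_integrable_const)

definition gbm_integrand_distance :: "real \<Rightarrow> real" where
  "gbm_integrand_distance v = expectation (\<lambda>\<omega>.
    (exp (- b * v) * stop_integrand \<tau> (\<lambda>t \<omega>. \<beta> * X t \<omega>) v \<omega> - x * \<beta> * exp_martingale \<beta> v \<omega>)\<^sup>2)"

lemma
  assumes t: "0 \<le> t"
  shows gbm_integrand_distance_integrable: "integrable (lborel_upto t) gbm_integrand_distance"
    and gbm_error_second_moment:
      "expectation (\<lambda>\<omega>. (gbm_error t \<omega>)\<^sup>2) = (\<integral>v. gbm_integrand_distance v \<partial>lborel_upto t)"
proof -
  have "integrable (prod_upto t) (\<lambda>(\<omega>, v). (exp (- b * v) * stop_integrand \<tau> (\<lambda>t \<omega>. \<beta> * X t \<omega>) v \<omega>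
      - x * \<beta> * exp_martingale \<beta> v \<omega>)\<^sup>2)"
    using square_integrableD(2)[OF square_integrable_integrand_difference[OF ito_version t]]
    by (simp add: split_beta')
  from upto.integrable_snd[OF this] show "integrable (lborel_upto t) gbm_integrand_distance"
    by (simp add: gbm_integrand_distance_def[abs_def])
  show "expectation (\<lambda>\<omega>. (gbm_error t \<omega>)\<^sup>2) = (\<integral>v. gbm_integrand_distance v \<partial>lborel_upto t)"
    unfolding gbm_error_def gbm_integrand_distance_def
    by (rule discounted_ito_distance[OF ito_version t])
qed

lemma gbm_integrand_distance_le:
  assumes v: "0 \<le> v"
  shows "gbm_integrand_distance v
      \<le> \<beta>\<^sup>2 * expectation (\<lambda>\<omega>. (gbm_error v \<omega>)\<^sup>2) + \<beta>\<^sup>2 * x\<^sup>2 * exp_martingale_tail \<tau> \<beta> v"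
proof -
  let ?tail = "\<lambda>\<omega>. if v \<le> \<tau> \<omega> then 0 else (exp_martingale \<beta> v \<omega>)\<^sup>2"
  have error: "integrable M (\<lambda>\<omega>. (gbm_error v \<omega>)\<^sup>2)"
    by (rule square_integrableD(2)[OF square_integrable_gbm_error[OF v]])
  have tail: "integrable M ?tail"
    by (rule Bochner_Integration.integrable_bound[OF
      square_integrableD(2)[OF exp_martingale_square_integrable[OF v]]])
      (use v in \<open>auto intro!: measurable_If\<close>)
  have "gbm_integrand_distance v \<le> expectation (\<lambda>\<omega>. \<beta>\<^sup>2 * (gbm_error v \<omega>)\<^sup>2 + \<beta>\<^sup>2 * x\<^sup>2 * ?tail \<omega>)"
    unfolding gbm_integrand_distance_def
  proof (rule integral_mono_AE')
    show "AE \<omega> in M.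
        (exp (- b * v) * stop_integrand \<tau> (\<lambda>t \<omega>. \<beta> * X t \<omega>) v \<omega> - x * \<beta> * exp_martingale \<beta> v \<omega>)\<^sup>2
        \<le> \<beta>\<^sup>2 * (gbm_error v \<omega>)\<^sup>2 + \<beta>\<^sup>2 * x\<^sup>2 * ?tail \<omega>"
      using AE_gbm_error[OF v]
    proof eventually_elim
      case (elim \<omega>)
      show ?case
      proof (cases "v \<le> \<tau> \<omega>")
        case True
        then have error_eq: "gbm_error v \<omega> = exp (- b * v) * X v \<omega> - x * exp_martingale \<beta> v \<omega>"
          using elim by (simp only: min_absorb1)
        have "exp (- b * v) * (\<beta> * X v \<omega>) - x * \<beta> * exp_martingale \<beta> v \<omega> = \<beta> * gbm_error v \<omega>"
          unfolding error_eq by (simp add: algebra_simps)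
        then show ?thesis using True by (simp add: power_mult_distrib)
      qed (simp add: power_mult_distrib)
    qed
  qed (use error tail in auto)
  also have "\<dots> = \<beta>\<^sup>2 * expectation (\<lambda>\<omega>. (gbm_error v \<omega>)\<^sup>2) + \<beta>\<^sup>2 * x\<^sup>2 * exp_martingale_tail \<tau> \<beta> v"
    using error tail by (simp add: exp_martingale_tail_def)
  finally show ?thesis .
qed

lemma gbm_error_bound:
  assumes T: "0 \<le> T"
  shows "expectation (\<lambda>\<omega>. (gbm_error T \<omega>)\<^sup>2)
    \<le> \<beta>\<^sup>2 * x\<^sup>2 * (\<integral>v. exp_martingale_tail \<tau> \<beta> v \<partial>lborel_upto T) * exp (\<beta>\<^sup>2 * T)"
proof (rule Gronwall_inequality[where D = "\<lambda>t. expectation (\<lambda>\<omega>. (gbm_error t \<omega>)\<^sup>2)", OF _ _ T])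
  let ?D = "\<lambda>t. expectation (\<lambda>\<omega>. (gbm_error t \<omega>)\<^sup>2)"
  show cont: "continuous_on {0..T} ?D"
    using continuous_on_integral_upto[OF gbm_integrand_distance_integrable[OF T]]
    by (rule continuous_on_cong[THEN iffD1, OF refl, rotated]) (simp add: gbm_error_second_moment)
  fix t assume t: "t \<in> {0..T}"
  have D: "integrable (lborel_upto t) ?D"
    using t by (intro integrable_upto_continuous continuous_on_subset[OF cont]) auto
  note tail = exp_martingale_tail_integrable[OF \<tau>_measurable, of _ \<beta>]
  have tail_nonneg: "0 \<le> exp_martingale_tail \<tau> \<beta> v" for v
    unfolding exp_martingale_tail_def by (intro Bochner_Integration.integral_nonneg) auto
  have "?D t = (\<integral>v. gbm_integrand_distance v \<partial>lborel_upto t)"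
    using t by (simp add: gbm_error_second_moment)
  also have "\<dots> \<le> (\<integral>v. \<beta>\<^sup>2 * ?D v + \<beta>\<^sup>2 * x\<^sup>2 * exp_martingale_tail \<tau> \<beta> v \<partial>lborel_upto t)"
    using t by (intro integral_mono gbm_integrand_distance_integrable gbm_integrand_distance_le
        Bochner_Integration.integrable_add integrable_mult_right D tail) auto
  also have "\<dots> = \<beta>\<^sup>2 * (\<integral>v. ?D v \<partial>lborel_upto t)
      + \<beta>\<^sup>2 * x\<^sup>2 * (\<integral>v. exp_martingale_tail \<tau> \<beta> v \<partial>lborel_upto t)"
    by (subst Bochner_Integration.integral_add) (simp_all add: D tail)
  also have "(\<integral>v. exp_martingale_tail \<tau> \<beta> v \<partial>lborel_upto t)
      \<le> (\<integral>v. exp_martingale_tail \<tau> \<beta> v \<partial>lborel_upto T)"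
    using t tail tail_nonneg
    by (subst integral_upto_eq_indicator[of t T])
      (auto intro!: integral_mono_AE' simp: indicator_def)
  finally show "?D t \<le> \<beta>\<^sup>2 * x\<^sup>2 * (\<integral>v. exp_martingale_tail \<tau> \<beta> v \<partial>lborel_upto T)
      + \<beta>\<^sup>2 * (\<integral>v. ?D v \<partial>lborel_upto t)"
    by (simp add: mult_left_mono)
qed simp

end

lemma gbm_unique:
  assumes X: "solves_SDE M F W x (\<lambda>t \<omega>. b * X t \<omega>) (\<lambda>t \<omega>. \<beta> * X t \<omega>) X" and T: "0 \<le> T"
  shows "AE \<omega> in M. X T \<omega> = x * exp (b * T) * exp_martingale \<beta> T \<omega>"
proof -
  obtain I and \<tau> :: "nat \<Rightarrow> 'a \<Rightarrow> real" where
    sol: "\<And>n. localised_solution x (\<lambda>t \<omega>. b * X t \<omega>) (\<lambda>t \<omega>. \<beta> * X t \<omega>) X I (\<tau> n)"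
    and \<tau>_lim: "\<And>T. AE \<omega> in M. \<forall>\<^sub>F n in sequentially. T \<le> \<tau> n \<omega>"
    by (fact solves_SDE_localisation[OF X])
  let ?e = "\<lambda>n. gbm_error I b \<beta> x (\<tau> n) T"
    and ?d = "\<lambda>\<omega>. exp (- b * T) * X T \<omega> - x * exp_martingale \<beta> T \<omega>"
  have error_square: "square_integrable M (?e n)" for n
    by (rule square_integrable_gbm_error[OF sol T])
  have "(\<integral>\<^sup>+\<omega>. ennreal ((?d \<omega>)\<^sup>2) \<partial>M) \<le> ennreal 0"
  proof (rule nn_integral_le_liminf)
    let ?C = "\<lambda>n. \<beta>\<^sup>2 * x\<^sup>2 * (\<integral>v. exp_martingale_tail (\<tau> n) \<beta> v \<partial>lborel_upto T) * exp (\<beta>\<^sup>2 * T)"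
    show "(\<lambda>\<omega>. ennreal ((?e n \<omega>)\<^sup>2)) \<in> borel_measurable M" for n
      using square_integrableD(1)[OF error_square] by measurable
    show "(\<integral>\<^sup>+\<omega>. ennreal ((?e n \<omega>)\<^sup>2) \<partial>M) \<le> ennreal (?C n)" for n
      using square_integrableD(2)[OF error_square] gbm_error_bound[OF sol T]
      by (simp add: nn_integral_eq_integral ennreal_leI)
    show "(\<lambda>n. ennreal (?C n)) \<longlonglongrightarrow> ennreal 0"
      using exp_martingale_tail_tendsto_0[OF localised_solutionD(1)[OF sol] \<tau>_lim]
      by (intro tendsto_ennrealI tendsto_mult_left_zero tendsto_mult_right_zero)
    have "AE \<omega> in M. \<forall>n. ?e n \<omega>
        = exp (- b * min T (\<tau> n \<omega>)) * X (min T (\<tau> n \<omega>)) \<omega> - x * exp_martingale \<beta> T \<omega>"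
      using AE_gbm_error[OF sol T] by (simp add: AE_all_countable)
    with \<tau>_lim[of T] show "AE \<omega> in M.
        \<forall>\<^sub>F n in sequentially. ennreal ((?e n \<omega>)\<^sup>2) = ennreal ((?d \<omega>)\<^sup>2)"
    proof eventually_elim
      case (elim \<omega>)
      show ?case using elim(1) by eventually_elim (simp add: elim(2) min_absorb1)
    qed
  qed
  moreover have "(\<lambda>\<omega>. ennreal ((?d \<omega>)\<^sup>2)) \<in> borel_measurable M"
    using X T measurable_process_section[of M X T] by (simp add: solves_SDE_def)
  ultimately have "AE \<omega> in M. ennreal ((?d \<omega>)\<^sup>2) = 0" by (simp add: nn_integral_0_iff_AE)
  then show ?thesis
  proof eventually_elim
    case (elim \<omega>)
    then have "exp (- b * T) * X T \<omega> = x * exp_martingale \<beta> T \<omega>" by (simp add: ennreal_eq_0_iff)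
    then have "exp (b * T) * (exp (- b * T) * X T \<omega>)
        = exp (b * T) * (x * exp_martingale \<beta> T \<omega>)" by simp
    then show ?case by (simp add: mult.assoc[symmetric] exp_add[symmetric])
  qed
qed

end

subsection \<open>Linear feedback strategies\<close>

lemma continuous_nonneg_of_Rats:
  fixes f :: "real \<Rightarrow> real"
  assumes "continuous_on {0..} f" "\<And>q. q \<in> \<rat> \<Longrightarrow> 0 \<le> q \<Longrightarrow> 0 \<le> f q" "0 \<le> t"
  shows "0 \<le> f t"
proof -
  have "closure ({0<..} \<inter> \<rat>) = {0::real..}"
    by (simp add: closure_open_Int_superset Rats_closure_real)
  then show ?thesis
    using continuous_ge_on_closure[of "{0<..} \<inter> \<rat>" f t 0] assms by simp
qed

context brownian_motion
begin

context
  fixes X :: "real \<Rightarrow> 'a \<Rightarrow> real" and x b \<beta> :: real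
  assumes X: "solves_SDE M F W x (\<lambda>t \<omega>. b * X t \<omega>) (\<lambda>t \<omega>. \<beta> * X t \<omega>) X"
begin

lemma gbm_nonneg:
  assumes x: "0 \<le> x"
  shows "AE \<omega> in M. \<forall>t\<ge>0. 0 \<le> X t \<omega>"
proof -
  have cont: "AE \<omega> in M. continuous_on {0..} (\<lambda>t. X t \<omega>)"
    using X by (simp add: solves_SDE_def continuous_paths_def)
  have "AE \<omega> in M. \<forall>q\<in>\<rat> \<inter> {0..}. X q \<omega> = x * exp (b * q) * exp_martingale \<beta> q \<omega>"
    using gbm_unique[OF X]
    by (subst AE_ball_countable) (auto intro: countable_subset[OF _ countable_rat])
  with cont show ?thesis
  proof eventually_elim
    case (elim \<omega>)
    then have "0 \<le> X q \<omega>" if "q \<in> \<rat>" "0 \<le> q" for q using that x by simp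
    with elim(1) show ?case by (auto intro: continuous_nonneg_of_Rats)
  qed
qed

lemma gbm_square_integrable_prod: "square_integrable (prod_upto R) (\<lambda>(\<omega>, t). X t \<omega>)"
proof (rule square_integrable_processI)
  show X_measurable: "measurable_process M X" using X by (simp add: solves_SDE_def)
  fix t assume t: "t \<in> {0..R}"
  let ?Y = "\<lambda>\<omega>. x * exp (b * t) * exp_martingale \<beta> t \<omega>"
  have eq: "AE \<omega> in M. ?Y \<omega> = X t \<omega>"
    using t by (intro eventually_mono[OF gbm_unique[OF X]]) auto
  have Y_square: "square_integrable M ?Y"
    using t by (intro square_integrable_cmult exp_martingale_square_integrable) simp
  then show X_square: "square_integrable M (X t)"
    using t
    by (intro square_integrable_cong_AE[OF _ _ eq] measurable_process_section[OF X_measurable]) auto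
  have "expectation (\<lambda>\<omega>. (X t \<omega>)\<^sup>2) = expectation (\<lambda>\<omega>. (?Y \<omega>)\<^sup>2)"
    using square_integrableD[OF X_square] square_integrableD[OF Y_square] eq
    by (intro integral_cong_AE) auto
  also have "\<dots> = x\<^sup>2 * exp ((2 * b + \<beta>\<^sup>2) * t)"
    using t
    by (simp add: power_mult_distrib exp_martingale_square_expectation distrib_right exp_add
      mult.assoc
        flip: exp_double)
  also have "\<dots> \<le> x\<^sup>2 * exp (\<bar>2 * b + \<beta>\<^sup>2\<bar> * R)"
    using t mult_le_abs_mult[of t R "2 * b + \<beta>\<^sup>2"] by (simp add: mult_left_mono)
  finally show "expectation (\<lambda>\<omega>. (X t \<omega>)\<^sup>2) \<le> x\<^sup>2 * exp (\<bar>2 * b + \<beta>\<^sup>2\<bar> * R)" .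
qed

end

lemma linear_feedback_admissible:
  assumes X: "solves_SDE M F W x (\<lambda>t \<omega>. (r + \<sigma> * lam * p - k) * X t \<omega>) (\<lambda>t \<omega>. (\<sigma> * p) * X t \<omega>) X"
    and x: "0 \<le> x" and k: "0 \<le> k"
  shows "((\<lambda>t \<omega>. k * X t \<omega>), (\<lambda>t \<omega>. p * X t \<omega>)) \<in> admissible M F W r \<sigma> lam x"
proof -
  have "measurable_process M X" "adapted F X" using X by (auto simp: solves_SDE_def)
  then have process: "measurable_process M (\<lambda>t \<omega>. q * X t \<omega>)" "adapted F (\<lambda>t \<omega>. q * X t \<omega>)" for q
    by (auto simp: measurable_process_def adapted_def split_beta')
  have X_square: "square_integrable (prod_upto R) (\<lambda>(\<omega>, t). q * X t \<omega>)" for q R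
    using square_integrable_cmult[OF gbm_square_integrable_prod[OF X]] by (simp add: split_beta')
  have "square_integrable (prod_upto R) (\<lambda>(\<omega>, t). 1 * 1)" for R
    by (intro upto.square_integrable_times square_integrable_const
      lborel_upto.square_integrable_const)
  from square_integrable_mult_integrable[OF this X_square]
  have X_integrable: "integrable (prod_upto R) (\<lambda>(\<omega>, t). k * X t \<omega>)" for R
    by (simp add: split_beta')
  have "AE \<omega> in M. \<forall>t\<ge>0. 0 \<le> k * X t \<omega>" using gbm_nonneg[OF X x] by eventually_elim (use k in auto)
  then have "(\<lambda>t \<omega>. k * X t \<omega>) \<in> L1_loc_nonneg M F" by (intro L1_loc_nonnegI process X_integrable)
  moreover have "(\<lambda>t \<omega>. p * X t \<omega>) \<in> L2_loc M F" by (intro L2_locI process X_square)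
  moreover have "wealth_process M F W r \<sigma> lam x (\<lambda>t \<omega>. k * X t \<omega>) (\<lambda>t \<omega>. p * X t \<omega>) X"
    using X by (simp add: wealth_process_def algebra_simps)
  ultimately show ?thesis using gbm_nonneg[OF X x] by (auto simp: admissible_def)
qed

end

subsection \<open>Optimality\<close>

definition discounted_disutility :: "real \<Rightarrow> real \<Rightarrow> real \<Rightarrow> real \<Rightarrow> ennreal" where
  "discounted_disutility \<rho> \<gamma> s c = e2ennreal (- (ereal (exp (- \<rho> * s)) * crra_utility \<gamma> c))"

lemma objective_eq_disutility:
  "objective M \<rho> \<gamma> c
    = - enn2ereal (\<integral>\<^sup>+\<omega>. \<integral>\<^sup>+s. discounted_disutility \<rho> \<gamma> s (c s \<omega>) \<partial>half_line \<partial>M)"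
  by (simp add: objective_def discounted_disutility_def nn_integral_restrict_space)

lemma discounted_disutility_pos:
  assumes "0 < c" "1 < \<gamma>"
  shows "discounted_disutility \<rho> \<gamma> s c = ennreal (exp (- \<rho> * s) * (c powr (1 - \<gamma>) / (\<gamma> - 1)))"
proof -
  have "- (exp (- \<rho> * s) * (c powr (1 - \<gamma>) / (1 - \<gamma>))) = exp (- \<rho> * s) * (c powr (1 - \<gamma>) / (\<gamma> - 1))"
    by (metis minus_diff_eq minus_divide_right mult_minus_right)
  then show ?thesis
    using assms by (simp add: discounted_disutility_def crra_utility_def e2ennreal_ereal)
qed

lemma discounted_disutility_nonpos: "c \<le> 0 \<Longrightarrow> discounted_disutility \<rho> \<gamma> s c = \<top>"
  by (simp add: discounted_disutility_def crra_utility_def e2ennreal_infty)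

lemma crra_disutility_tangent:
  fixes c d \<gamma> :: real
  assumes "0 < c" "0 < d" "1 < \<gamma>"
  shows "d powr (1 - \<gamma>) / (\<gamma> - 1) + d powr (- \<gamma>) * d \<le> c powr (1 - \<gamma>) / (\<gamma> - 1) + d powr (- \<gamma>) * c"
proof -
  let ?f = "\<lambda>y. y powr (1 - \<gamma>) / (\<gamma> - 1)"
  have deriv: "(?f has_real_derivative - (y powr (- \<gamma>))) (at y)" if "0 < y" for y
  proof -
    have "((\<lambda>y. y powr (1 - \<gamma>)) has_real_derivative (1 - \<gamma>) * y powr (- \<gamma>)) (at y)"
      using that by (auto intro!: derivative_eq_intros)
    moreover have "(1 - \<gamma>) * y powr (- \<gamma>) / (\<gamma> - 1) = - (y powr (- \<gamma>))"
      using assms by (simp add: divide_eq_eq left_diff_distrib right_diff_distrib)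
    ultimately show ?thesis using DERIV_cdivide[of _ _ y UNIV "\<gamma> - 1"] by metis
  qed
  have "convex_on {0<..} ?f"
  proof (rule f''_ge0_imp_convex)
    show "((\<lambda>y. - (y powr (- \<gamma>))) has_real_derivative \<gamma> * y powr (- \<gamma> - 1)) (at y)"
      if "y \<in> {0<..}" for y
      using that by (auto intro!: derivative_eq_intros)
  qed (use deriv assms in auto)
  from convex_on_imp_above_tangent[OF this _ _ _ DERIV_subset[OF deriv[OF \<open>0 < d\<close>]], of c]
  have "- (d powr (- \<gamma>)) * (c - d) \<le> ?f c - ?f d" using assms by (simp add: interior_open)
  then show ?thesis by (simp add: algebra_simps)
qed

lemma discounted_disutility_tangent:
  assumes d: "0 < d" and \<gamma>: "1 < \<gamma>" and q: "exp (- \<rho> * s) * d powr (- \<gamma>) = q"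
  shows "discounted_disutility \<rho> \<gamma> s d + ennreal q * ennreal d
    \<le> discounted_disutility \<rho> \<gamma> s c + ennreal q * ennreal c"
proof (cases "c \<le> 0")
  case True
  then show ?thesis by (simp add: discounted_disutility_nonpos)
next
  case False
  then have c: "0 < c" by simp
  have q_pos: "0 < q" using d by (simp flip: q)
  have "exp (- \<rho> * s) * (d powr (1 - \<gamma>) / (\<gamma> - 1) + d powr (- \<gamma>) * d)
      \<le> exp (- \<rho> * s) * (c powr (1 - \<gamma>) / (\<gamma> - 1) + d powr (- \<gamma>) * c)"
    using crra_disutility_tangent[OF c d \<gamma>] by (rule mult_left_mono) simp
  then have "exp (- \<rho> * s) * (d powr (1 - \<gamma>) / (\<gamma> - 1)) + q * d
      \<le> exp (- \<rho> * s) * (c powr (1 - \<gamma>) / (\<gamma> - 1)) + q * c"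
    by (simp only: distrib_left mult.assoc flip: q)
  then show ?thesis
    using c d \<gamma> q_pos
    by (simp add: discounted_disutility_pos ennreal_leI flip: ennreal_mult ennreal_plus)
qed

lemma nn_integral_exp_half_line:
  assumes "0 < k" "0 \<le> C"
  shows "(\<integral>\<^sup>+s. ennreal (C * (k * exp (- k * s))) \<partial>half_line) = ennreal C"
proof -
  interpret prob_space "density lborel (exponential_density k)"
    by (rule prob_space_exponential_density[OF assms(1)])
  have "(\<integral>\<^sup>+s. ennreal (C * (k * exp (- k * s))) \<partial>half_line)
      = (\<integral>\<^sup>+s. ennreal C * ennreal (exponential_density k s) \<partial>lborel)"
    using assms by (auto simp: nn_integral_restrict_space exponential_density_def indicator_def
        ennreal_mult' mult_ac intro!: nn_integral_cong)
  also have "\<dots> = ennreal C * emeasure (density lborel (exponential_density k)) UNIV"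
    by (simp add: nn_integral_cmult emeasure_density)
  finally show ?thesis using emeasure_space_1 by simp
qed

lemma value_function_eqI:
  assumes "(c, \<pi>) \<in> admissible M F W r \<sigma> lam x"
    and "\<And>c' \<pi>'. (c', \<pi>') \<in> admissible M F W r \<sigma> lam x \<Longrightarrow> objective M \<rho> \<gamma> c' \<le> objective M \<rho> \<gamma> c"
  shows "value_function M F W r \<sigma> lam \<rho> \<gamma> x = objective M \<rho> \<gamma> c"
  unfolding value_function_def
proof (rule antisym)
  show "(SUP (c, \<pi>)\<in>admissible M F W r \<sigma> lam x. objective M \<rho> \<gamma> c) \<le> objective M \<rho> \<gamma> c"
    using assms(2) by (auto intro!: SUP_least)
  show "objective M \<rho> \<gamma> c \<le> (SUP (c, \<pi>)\<in>admissible M F W r \<sigma> lam x. objective M \<rho> \<gamma> c)"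
    by (rule SUP_upper2[OF assms(1)]) simp
qed

context brownian_motion
begin

definition expected_disutility :: "real \<Rightarrow> real \<Rightarrow> (real \<Rightarrow> 'a \<Rightarrow> real) \<Rightarrow> ennreal" where
  "expected_disutility \<rho> \<gamma> c = (\<integral>\<^sup>+\<omega>. \<integral>\<^sup>+s. discounted_disutility \<rho> \<gamma> s (c s \<omega>) \<partial>half_line \<partial>M)"

definition consumption_cost :: "real \<Rightarrow> real \<Rightarrow> (real \<Rightarrow> 'a \<Rightarrow> real) \<Rightarrow> ennreal" where
  "consumption_cost r lam c
    = (\<integral>\<^sup>+s. \<integral>\<^sup>+\<omega>. ennreal (state_price_density r lam s \<omega>) * ennreal (c s \<omega>) \<partial>M \<partial>half_line)"

lemma lagrangian_eq:
  assumes c: "measurable_process M c" and "0 \<le> y"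
  shows "(\<integral>\<^sup>+s. \<integral>\<^sup>+\<omega>. discounted_disutility \<rho> \<gamma> s (c s \<omega>)
      + ennreal (y * state_price_density r lam s \<omega>) * ennreal (c s \<omega>) \<partial>M \<partial>half_line)
    = expected_disutility \<rho> \<gamma> c + ennreal y * consumption_cost r lam c"
proof -
  let ?N = "M \<Otimes>\<^sub>M half_line"
  have [measurable]: "(\<lambda>p. c (snd p) (fst p)) \<in> borel_measurable ?N"
    "(\<lambda>p. state_price_density r lam (snd p) (fst p)) \<in> borel_measurable ?N"
    using measurable_process_restrict_space[OF c] 
      measurable_process_restrict_space[OF measurable_process_state_price_density]
    by (auto simp: split_beta')
  have [measurable]: "snd \<in> borel_measurable ?N"
    by (rule measurable_compose[OF measurable_snd measurable_restrict_space1]) simp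
  have [measurable]: "crra_utility \<gamma> \<in> borel_measurable borel"
    unfolding crra_utility_def by measurable
  have disutility: "(\<lambda>(\<omega>, s). discounted_disutility \<rho> \<gamma> s (c s \<omega>)) \<in> borel_measurable ?N"
    unfolding discounted_disutility_def split_beta' by measurable
  have cost: "(\<lambda>(\<omega>, s). ennreal (state_price_density r lam s \<omega>) * ennreal (c s \<omega>))
      \<in> borel_measurable ?N"
    unfolding split_beta' by measurable
  have "(\<integral>\<^sup>+s. \<integral>\<^sup>+\<omega>. discounted_disutility \<rho> \<gamma> s (c s \<omega>)
      + ennreal (y * state_price_density r lam s \<omega>) * ennreal (c s \<omega>) \<partial>M \<partial>half_line)
    = (\<integral>\<^sup>+p. (case p of (\<omega>, s) \<Rightarrow> discounted_disutility \<rho> \<gamma> s (c s \<omega>))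
      + ennreal y * (case p of (\<omega>, s) \<Rightarrow> ennreal (state_price_density r lam s \<omega>) * ennreal (c s \<omega>)) \<partial>?N)"
    using disutility cost \<open>0 \<le> y\<close>
    by (subst half_line.nn_integral_snd[symmetric])
      (auto simp: ennreal_mult less_imp_le[OF state_price_density_pos] mult.assoc)
  also have "\<dots> = (\<integral>\<^sup>+(\<omega>, s). discounted_disutility \<rho> \<gamma> s (c s \<omega>) \<partial>?N)
      + ennreal y * (\<integral>\<^sup>+(\<omega>, s). ennreal (state_price_density r lam s \<omega>) * ennreal (c s \<omega>) \<partial>?N)"
    using disutility cost by (subst nn_integral_add) (auto simp: nn_integral_cmult)
  finally show ?thesis
    unfolding expected_disutility_def consumption_cost_def
    using half_line.M2.nn_integral_fst[OF disutility] half_line.nn_integral_snd[OF cost] by simp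
qed

end

locale merton_problem = brownian_motion M F W
  for M :: "'a measure" and F :: "real \<Rightarrow> 'a measure" and W :: "real \<Rightarrow> 'a \<Rightarrow> real" +
  fixes r \<rho> lam \<gamma> k x :: real
  assumes \<gamma>: "1 < \<gamma>" and k_pos: "0 < k" and x_pos: "0 < x"
    and k_eq: "\<gamma> * k = \<rho> - (1 - \<gamma>) * (r + lam\<^sup>2 / (2 * \<gamma>))"
begin

definition optimal_consumption :: "real \<Rightarrow> 'a \<Rightarrow> real" where
  "optimal_consumption s \<omega> = k * (x * exp ((r + lam\<^sup>2 / \<gamma> - k) * s) * exp_martingale (lam / \<gamma>) s \<omega>)"

definition shadow_price :: real where
  "shadow_price = (k * x) powr (- \<gamma>)"

lemma optimal_consumption_pos: "0 < optimal_consumption s \<omega>"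
  and shadow_price_pos: "0 < shadow_price"
  using k_pos x_pos by (auto simp: optimal_consumption_def shadow_price_def)

lemma first_order_condition:
  "exp (- \<rho> * s) * optimal_consumption s \<omega> powr (- \<gamma>)
      = shadow_price * state_price_density r lam s \<omega>"
proof -
  let ?w = "continuous_version W s \<omega>"
  let ?e = "(r + lam\<^sup>2 / \<gamma> - k) * s + (lam / \<gamma> * ?w - (lam / \<gamma>)\<^sup>2 * s / 2)"
  have "optimal_consumption s \<omega> = (k * x) * exp ?e"
    by (simp add: optimal_consumption_def exp_martingale_def exp_add)
  then have "optimal_consumption s \<omega> powr (- \<gamma>) = shadow_price * exp (- \<gamma> * ?e)"
    using k_pos x_pos by (simp add: powr_mult shadow_price_def exp_powr_real mult.commute)
  then have "exp (- \<rho> * s) * optimal_consumption s \<omega> powr (- \<gamma>)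
      = shadow_price * exp (- \<rho> * s + - \<gamma> * ?e)"
    by (simp only: exp_add mult.left_commute)
  also have "- \<rho> * s + - \<gamma> * ?e = - r * s + (- lam * ?w - (- lam)\<^sup>2 * s / 2)"
  proof -
    have "\<gamma> * ?e = (\<gamma> * r + lam\<^sup>2 - \<gamma> * k) * s + (lam * ?w - lam\<^sup>2 / \<gamma> * s / 2)"
      using \<gamma> by (simp add: field_simps power2_eq_square)
    also have "\<dots> = - \<rho> * s + r * s + lam * ?w + lam\<^sup>2 * s / 2"
      unfolding k_eq using \<gamma> by (simp add: field_simps)
    finally show ?thesis by simp
  qed
  also have "exp \<dots> = state_price_density r lam s \<omega>"
    by (simp only: state_price_density_def exp_martingale_def exp_add)
  finally show ?thesis .
qed

lemma consumption_cost_optimal: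
  assumes c: "\<And>s. 0 \<le> s \<Longrightarrow> AE \<omega> in M. c s \<omega> = optimal_consumption s \<omega>"
  shows "consumption_cost r lam c = ennreal x"
proof -
  have price: "state_price_density r lam s \<omega> * optimal_consumption s \<omega>
      = x * (k * exp (- k * s)) * exp_martingale (- lam + lam / \<gamma>) s \<omega>" for s \<omega>
  proof -
    have "state_price_density r lam s \<omega> * optimal_consumption s \<omega>
        = k * x * (exp (- r * s + (r + lam\<^sup>2 / \<gamma> - k) * s)
          * (exp_martingale (- lam) s \<omega> * exp_martingale (lam / \<gamma>) s \<omega>))"
      by (simp only: state_price_density_def optimal_consumption_def exp_add mult_ac)
    also have "\<dots> = k * x * (exp (- r * s + (r + lam\<^sup>2 / \<gamma> - k) * s + - lam * (lam / \<gamma>) * s)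
        * exp_martingale (- lam + lam / \<gamma>) s \<omega>)"
      by (simp only: exp_martingale_times exp_add mult_ac)
    also have "- r * s + (r + lam\<^sup>2 / \<gamma> - k) * s + - lam * (lam / \<gamma>) * s = - k * s"
      by (simp add: algebra_simps power2_eq_square)
    finally show ?thesis by (simp add: mult_ac)
  qed
  have "(\<integral>\<^sup>+\<omega>. ennreal (state_price_density r lam s \<omega>) * ennreal (c s \<omega>) \<partial>M)
      = ennreal (x * (k * exp (- k * s)))"
    if s: "0 \<le> s" for s
  proof -
    have "(\<integral>\<^sup>+\<omega>. ennreal (state_price_density r lam s \<omega>) * ennreal (c s \<omega>) \<partial>M)
        = (\<integral>\<^sup>+\<omega>. ennreal (x * (k * exp (- k * s)) * exp_martingale (- lam + lam / \<gamma>) s \<omega>) \<partial>M)"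
      using c[OF s] unfolding price[symmetric]
      by (intro nn_integral_cong_AE, eventually_elim)
        (simp add: ennreal_mult less_imp_le[OF state_price_density_pos]
          less_imp_le[OF optimal_consumption_pos])
    then show ?thesis
      using k_pos x_pos exp_martingale_integrable[OF s] exp_martingale_expectation[OF s]
      by (simp add: nn_integral_eq_integral)
  qed
  then have "consumption_cost r lam c = (\<integral>\<^sup>+s. ennreal (x * (k * exp (- k * s))) \<partial>half_line)"
    unfolding consumption_cost_def by (intro nn_integral_cong) (simp add: space_restrict_space)
  then show ?thesis using k_pos x_pos by (simp only: nn_integral_exp_half_line less_imp_le)
qed

lemma expected_disutility_optimal_le:
  assumes chat: "measurable_process M chat"
    "\<And>s. 0 \<le> s \<Longrightarrow> AE \<omega> in M. chat s \<omega> = optimal_consumption s \<omega>"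
    and c: "measurable_process M c" and budget: "consumption_cost r lam c \<le> ennreal x"
  shows "expected_disutility \<rho> \<gamma> chat \<le> expected_disutility \<rho> \<gamma> c"
proof -
  let ?L = "\<lambda>c s \<omega>. discounted_disutility \<rho> \<gamma> s (c s \<omega>)
    + ennreal (shadow_price * state_price_density r lam s \<omega>) * ennreal (c s \<omega>)"
  have pointwise: "?L optimal_consumption s \<omega> \<le> ?L c s \<omega>" for s \<omega>
    by (rule discounted_disutility_tangent[OF optimal_consumption_pos \<gamma> first_order_condition])
  have "expected_disutility \<rho> \<gamma> chat + ennreal shadow_price * ennreal x
      = (\<integral>\<^sup>+s. \<integral>\<^sup>+\<omega>. ?L chat s \<omega> \<partial>M \<partial>half_line)"
    using lagrangian_eq[OF chat(1)] consumption_cost_optimal[OF chat(2)] shadow_price_pos by simp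
  also have "\<dots> \<le> (\<integral>\<^sup>+s. \<integral>\<^sup>+\<omega>. ?L c s \<omega> \<partial>M \<partial>half_line)"
  proof (rule nn_integral_mono)
    fix s assume "s \<in> space half_line"
    then have "AE \<omega> in M. chat s \<omega> = optimal_consumption s \<omega>"
      by (intro chat(2)) (simp add: space_restrict_space)
    then show "(\<integral>\<^sup>+\<omega>. ?L chat s \<omega> \<partial>M) \<le> (\<integral>\<^sup>+\<omega>. ?L c s \<omega> \<partial>M)"
      by (intro nn_integral_mono_AE, eventually_elim) (simp add: pointwise)
  qed
  also have "\<dots> = expected_disutility \<rho> \<gamma> c + ennreal shadow_price * consumption_cost r lam c"
    using shadow_price_pos by (intro lagrangian_eq[OF c]) simp
  also have "\<dots> \<le> expected_disutility \<rho> \<gamma> c + ennreal shadow_price * ennreal x"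
    by (intro add_left_mono mult_left_mono budget) simp
  finally show ?thesis by (simp add: ennreal_mult_eq_top_iff flip: ennreal_mult)
qed

lemma objective_le_optimal:
  assumes chat: "measurable_process M chat"
    "\<And>s. 0 \<le> s \<Longrightarrow> AE \<omega> in M. chat s \<omega> = optimal_consumption s \<omega>"
    and c: "(c, \<pi>) \<in> admissible M F W r \<sigma> lam x"
  shows "objective M \<rho> \<gamma> c \<le> objective M \<rho> \<gamma> chat"
proof -
  from c obtain X where c_L1: "c \<in> L1_loc_nonneg M F"
    and X: "wealth_process M F W r \<sigma> lam x c \<pi> X" "AE \<omega> in M. \<forall>t\<ge>0. 0 \<le> X t \<omega>"
    by (auto simp: admissible_def)
  have "expected_disutility \<rho> \<gamma> chat \<le> expected_disutility \<rho> \<gamma> c"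
    using c_L1 budget_constraint[OF c_L1 X]
    by (intro expected_disutility_optimal_le[OF chat])
      (auto simp: L1_loc_nonneg_def consumption_cost_def)
  then show ?thesis
    by (simp add: objective_eq_disutility expected_disutility_def less_eq_ennreal.rep_eq)
qed

end

theorem theorem3p6:
  fixes M :: "'a measure" and F :: "real \<Rightarrow> 'a measure" and W :: "real \<Rightarrow> 'a \<Rightarrow> real"
    and r \<mu> \<rho> \<sigma> lam \<gamma> a x :: real
    and Xhat chat pihat :: "real \<Rightarrow> 'a \<Rightarrow> real"
  assumes "brownian_motion M F W"
    and "\<sigma> > 0" and "lam = (\<mu> - r) / \<sigma>" and "\<gamma> > 1"
    and "\<rho> > (1 - \<gamma>) * (r + lam\<^sup>2 / (2 * \<gamma>))"
    and "a = ((\<rho> - (1 - \<gamma>) * (r + lam\<^sup>2 / (2 * \<gamma>))) / \<gamma>) powr (- \<gamma>)"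
    and "x > 0"
    and "solves_SDE M F W x
           (\<lambda>t \<omega>. (r + lam\<^sup>2 / \<gamma> - a powr (- 1 / \<gamma>)) * Xhat t \<omega>)
           (\<lambda>t \<omega>. lam / \<gamma> * Xhat t \<omega>) Xhat"
    and "chat = (\<lambda>t \<omega>. a powr (- 1 / \<gamma>) * Xhat t \<omega>)"
    and "pihat = (\<lambda>t \<omega>. lam / (\<sigma> * \<gamma>) * Xhat t \<omega>)"
  shows "(chat, pihat) \<in> admissible M F W r \<sigma> lam x \<and>
         value_function M F W r \<sigma> lam \<rho> \<gamma> x = objective M \<rho> \<gamma> chat"
proof -
  define k where "k = (\<rho> - (1 - \<gamma>) * (r + lam\<^sup>2 / (2 * \<gamma>))) / \<gamma>"
  have "0 < k" using assms(4,5) by (simp add: k_def)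
  then interpret merton_problem M F W r \<rho> lam \<gamma> k x
    using assms(1,4,7) by (simp add: merton_problem_def merton_problem_axioms_def k_def)
  have "a powr (- 1 / \<gamma>) = k" using \<gamma> \<open>0 < k\<close> by (simp add: assms(6) powr_powr flip: k_def)
  then have X: "solves_SDE M F W x (\<lambda>t \<omega>. (r + lam\<^sup>2 / \<gamma> - k) * Xhat t \<omega>) (\<lambda>t \<omega>. lam / \<gamma> * Xhat t \<omega>) Xhat"
    and chat: "chat = (\<lambda>t \<omega>. k * Xhat t \<omega>)"
    using assms(8,9) by simp_all
  have admissible: "(chat, pihat) \<in> admissible M F W r \<sigma> lam x"
    unfolding chat assms(10)
    using X assms(2,7) \<open>0 < k\<close>
    by (intro linear_feedback_admissible) (simp_all add: power2_eq_square)
  have "AE \<omega> in M. chat s \<omega> = optimal_consumption s \<omega>" if "0 \<le> s" for s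
    using gbm_unique[OF X that] by eventually_elim (simp add: chat optimal_consumption_def)
  then have "objective M \<rho> \<gamma> c \<le> objective M \<rho> \<gamma> chat"
    if "(c, \<pi>) \<in> admissible M F W r \<sigma> lam x" for c \<pi>
    using admissible
    by (intro objective_le_optimal[OF _ _ that]) (auto simp: admissible_def L1_loc_nonneg_def)
  with admissible show ?thesis by (auto intro: value_function_eqI)
qed

end
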